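(* Let $n\ge 1$ be an integer, let $\sigma\ge 1$ and $2\delta\in(0,\sigma)$ be real numbers, let $m\in(1,2)$, and assume $n>\frac{2m\delta}{m-1}$. Then there is a constant $C>0$, independent of $t$ and of the data $u_0,u_1$, such that the solution $u$ of the Cauchy problem $$\partial_t^2u+(-\Delta)^{\sigma}u+(-\Delta)^{\delta}\partial_tu=0,\qquad u(0,x)=u_0(x),\quad \partial_tu(0,x)=u_1(x),\qquad t\ge 0,\ x\in\mathbb{R}^n,$$ satisfies, for all $t\ge 0$ and all data for which the norms on the respective right-hand side are finite, the following $(L^m\cap L^2)-L^2$ estimates: $$\|u(t,\cdot)\|_{L^2(\mathbb{R}^n)}\le C(1+t)^{-\frac{n}{2(\sigma-\delta)}\left(\frac1m-\frac12\right)}\|u_0\|_{L^m(\mathbb{R}^n)\cap L^2(\mathbb{R}^n)}+C(1+t)^{-\frac{n}{2(\sigma-\delta)}\left(\frac1m-\frac12\right)}\|u_1\|_{L^{2\delta,m}(\mathbb{R}^n)\cap L^2(\mathbb{R}^n)},$$ $$\|(-\Delta)^{\sigma/2}u(t,\cdot)\|_{L^2(\mathbb{R}^n)}\le C(1+t)^{-\frac{n}{2(\sigma-\delta)}\left(\frac1m-\frac12\right)-\frac{\sigma}{2(\sigma-\delta)}}\|u_0\|_{L^m(\mathbb{R}^n)\cap H^\sigma(\mathbb{R}^n)}+C(1+t)^{-\frac{n}{2(\sigma-\delta)}\left(\frac1m-\frac12\right)-\frac{\sigma}{2(\sigma-\delta)}}\|u_1\|_{L^{2\delta,m}(\mathbb{R}^n)\cap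 L^2(\mathbb{R}^n)},$$ $$\|\partial_tu(t,\cdot)\|_{L^2(\mathbb{R}^n)}\le C(1+t)^{-\frac{n}{2(\sigma-\delta)}\left(\frac1m-\frac12\right)-1}\|u_0\|_{L^m(\mathbb{R}^n)\cap H^\sigma(\mathbb{R}^n)}+C(1+t)^{-\frac{n}{2(\sigma-\delta)}\left(\frac1m-\frac12\right)-1}\|u_1\|_{L^{2\delta,m}(\mathbb{R}^n)\cap L^2(\mathbb{R}^n)}.$$ In particular, the following $L^2-L^2$ estimates hold (again for all $t\ge0$ and all data for which the respective right-hand side is finite): $$\|u(t,\cdot)\|_{L^2(\mathbb{R}^n)}\le C\left(\|u_0\|_{L^2(\mathbb{R}^n)}+\|u_1\|_{L^{2\delta,2}(\mathbb{R}^n)\cap L^2(\mathbb{R}^n)}\right),$$ $$\|(-\Delta)^{\sigma/2}u(t,\cdot)\|_{L^2(\mathbb{R}^n)}\le C(1+t)^{-\frac{\sigma}{2(\sigma-\delta)}}\left(\|u_0\|_{H^\sigma(\mathbb{R}^n)}+\|u_1\|_{L^{2\delta,2}(\mathbb{R}^n)\cap L^2(\mathbb{R}^n)}\right),$$ $$\|\partial_tu(t,\cdot)\|_{L^2(\mathbb{R}^n)}\le C(1+t)^{-1}\left(\|u_0\|_{H^\sigma(\mathbb{R}^n)}+\|u_1\|_{L^{2\delta,2}(\mathbb{R}^n)\cap L^2(\mathbb{R}^n)}\right).$$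
   Context: $\mathcal F$ (also written $\hat{\ }$) is the Fourier transform in $x\in\mathbb{R}^n$, and $|\cdot|$ is the Euclidean norm. The fractional Laplacian is defined by $\mathcal F((-\Delta)^a f)(\xi)=|\xi|^{2a}\mathcal F(f)(\xi)$. For $s\ge 0$, $\|f\|_{H^s(\mathbb{R}^n)}=\|(1+|\xi|^2)^{s/2}\mathcal F(f)\|_{L^2(\mathbb{R}^n)}$. For $m\in(1,2]$ and $\rho\ge0$, the weighted space $L^{\rho,m}(\mathbb{R}^n)$ consists of the functions $g$ with $\|g\|_{L^{\rho,m}(\mathbb{R}^n)}:=\||x|^\rho g\|_{L^m(\mathbb{R}^n)}=\left(\int_{\mathbb{R}^n}|x|^{\rho m}|g(x)|^m\,dx\right)^{1/m}<\infty$. The norm of an intersection is the sum of the norms: $\|f\|_{X\cap Y}=\|f\|_X+\|f\|_Y$. The solution $u$ is understood through its partial Fourier transform: for a.e. $\xi$, $\hat u(\cdot,\xi)$ is the solution of the ordinary differential equation $\partial_t^2\hat u+|\xi|^{2\delta}\partial_t\hat u+|\xi|^{2\sigma}\hat u=0$ with $\hat u(0,\xi)=\hat u_0(\xi)$, $\partial_t\hat u(0,\xi)=\hat u_1(\xi)$. Equivalently, with $\lambda_{1,2}(\xi)=\frac12\left(-|\xi|^{2\delta}\pm\sqrt{|\xi|^{4\delta}-4|\xi|^{2\sigma}}\right)$ and $\lambda_1\ne\lambda_2$, $$\hat u(t,\xi)=\frac{\lambda_1e^{\lambda_2t}-\lambda_2e^{\lambda_1t}}{\lambda_1-\lambda_2}\hat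 u_0(\xi)+\frac{e^{\lambda_1t}-e^{\lambda_2t}}{\lambda_1-\lambda_2}\hat u_1(\xi).$$ *)

theory Defs
  imports "HOL-Analysis.Analysis"
begin

text \<open>
  Functions are complex-valued and Borel measurable on \<open>real ^ 'n\<close>, and stand for their
  almost-everywhere classes. A norm below is the junk value 0 when the integral diverges, so it is
  always used together with membership in the corresponding space.
\<close>

definition Lp_space :: "real \<Rightarrow> (real ^ 'n \<Rightarrow> complex) set" where
  "Lp_space p = {f \<in> borel_measurable lborel. integrable lborel (\<lambda>x. norm (f x) powr p)}"

definition Lp_norm :: "real \<Rightarrow> (real ^ 'n \<Rightarrow> complex) \<Rightarrow> real" where
  "Lp_norm p f = (LINT x|lborel. norm (f x) powr p) powr (1 / p)"

definition weighted_Lp_space :: "real \<Rightarrow> real \<Rightarrow> (real ^ 'n \<Rightarrow> complex) set" where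
  "weighted_Lp_space \<rho> m =
     {g \<in> borel_measurable lborel. (\<lambda>x. (norm x powr \<rho>) *\<^sub>R g x) \<in> Lp_space m}"

definition weighted_Lp_norm :: "real \<Rightarrow> real \<Rightarrow> (real ^ 'n \<Rightarrow> complex) \<Rightarrow> real" where
  "weighted_Lp_norm \<rho> m g = Lp_norm m (\<lambda>x. (norm x powr \<rho>) *\<^sub>R g x)"

definition L2_tendsto ::
  "('i \<Rightarrow> real ^ 'n \<Rightarrow> complex) \<Rightarrow> (real ^ 'n \<Rightarrow> complex) \<Rightarrow> 'i filter \<Rightarrow> bool" where
  "L2_tendsto f g F \<longleftrightarrow>
     (\<forall>\<^sub>F i in F. (\<lambda>x. f i x - g x) \<in> Lp_space 2) \<and>
     ((\<lambda>i. Lp_norm 2 (\<lambda>x. f i x - g x)) \<longlongrightarrow> 0) F"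

definition truncated_fourier ::
  "real \<Rightarrow> (real ^ 'n \<Rightarrow> complex) \<Rightarrow> real ^ 'n \<Rightarrow> complex" where
  "truncated_fourier R f \<xi> =
     ((2 * pi) powr (- (real CARD('n) / 2))) *\<^sub>R
       (LINT x:cball 0 R|lborel. cis (- (x \<bullet> \<xi>)) * f x)"

text \<open>
  The Fourier transform on \<open>L\<^sup>2\<close> (unitary normalisation, kernel \<open>exp (- \<i> x \<bullet> \<xi>)\<close>), as the
  \<open>L\<^sup>2\<close>-limit of the transforms of the truncations of \<open>f\<close> to balls. By Plancherel's theorem the
  limit exists for every \<open>f\<close> in \<open>L\<^sup>2\<close>; it is unique up to null sets, and a representative is chosen.
\<close>

definition fourier :: "(real ^ 'n \<Rightarrow> complex) \<Rightarrow> real ^ 'n \<Rightarrow> complex" where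
  "fourier f = (SOME g. g \<in> Lp_space 2 \<and> L2_tendsto (\<lambda>R. truncated_fourier R f) g at_top)"

definition sobolev_space :: "real \<Rightarrow> (real ^ 'n \<Rightarrow> complex) set" where
  "sobolev_space s =
     {f \<in> Lp_space 2. (\<lambda>\<xi>. ((1 + (norm \<xi>)\<^sup>2) powr (s / 2)) *\<^sub>R fourier f \<xi>) \<in> Lp_space 2}"

definition sobolev_norm :: "real \<Rightarrow> (real ^ 'n \<Rightarrow> complex) \<Rightarrow> real" where
  "sobolev_norm s f = Lp_norm 2 (\<lambda>\<xi>. ((1 + (norm \<xi>)\<^sup>2) powr (s / 2)) *\<^sub>R fourier f \<xi>)"

text \<open>
  The fractional Laplacian \<open>(-\<Delta>)\<^sup>a\<close> as an operator in \<open>L\<^sup>2\<close>. Its value is meaningful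
  (and unique up to null sets) on the domain only.
\<close>

definition frac_laplacian_domain :: "real \<Rightarrow> (real ^ 'n \<Rightarrow> complex) set" where
  "frac_laplacian_domain a =
     {f \<in> Lp_space 2. (\<lambda>\<xi>. (norm \<xi> powr (2 * a)) *\<^sub>R fourier f \<xi>) \<in> Lp_space 2}"

definition frac_laplacian ::
  "real \<Rightarrow> (real ^ 'n \<Rightarrow> complex) \<Rightarrow> real ^ 'n \<Rightarrow> complex" where
  "frac_laplacian a f =
     (SOME g. g \<in> Lp_space 2 \<and>
        (AE \<xi> in lborel. fourier g \<xi> = (norm \<xi> powr (2 * a)) *\<^sub>R fourier f \<xi>))"

text \<open>
  The time derivative of an \<open>L\<^sup>2\<close>-valued curve on \<open>[0, \<infinity>)\<close>, as the \<open>L\<^sup>2\<close>-limit of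
  difference quotients (one-sided at 0).
\<close>

definition has_time_deriv ::
  "(real \<Rightarrow> real ^ 'n \<Rightarrow> complex) \<Rightarrow> (real ^ 'n \<Rightarrow> complex) \<Rightarrow> real \<Rightarrow> bool" where
  "has_time_deriv u w t \<longleftrightarrow>
     w \<in> Lp_space 2 \<and>
     L2_tendsto (\<lambda>s x. (u s x - u t x) /\<^sub>R (s - t)) w (at t within {0..})"

definition time_deriv ::
  "(real \<Rightarrow> real ^ 'n \<Rightarrow> complex) \<Rightarrow> real \<Rightarrow> real ^ 'n \<Rightarrow> complex" where
  "time_deriv u t = (SOME w. has_time_deriv u w t)"

text \<open>
  Solutions of the Cauchy problem, through the partial Fourier transform. For each \<open>t\<close> the function
  \<open>fourier (u t)\<close> is determined only up to a null set depending on \<open>t\<close>; therefore the differential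
  equation is required of a family \<open>v\<close> of representatives.
\<close>

definition is_solution ::
  "real \<Rightarrow> real \<Rightarrow> (real ^ 'n \<Rightarrow> complex) \<Rightarrow> (real ^ 'n \<Rightarrow> complex) \<Rightarrow>
   (real \<Rightarrow> real ^ 'n \<Rightarrow> complex) \<Rightarrow> bool" where
  "is_solution \<sigma> \<delta> u0 u1 u \<longleftrightarrow>
     (\<forall>t\<ge>0. u t \<in> Lp_space 2) \<and>
     (\<exists>v :: real \<Rightarrow> real ^ 'n \<Rightarrow> complex.
        (\<forall>t\<ge>0. AE \<xi> in lborel. fourier (u t) \<xi> = v t \<xi>) \<and>
        (AE \<xi> in lborel. \<exists>v' v'' :: real \<Rightarrow> complex.
           v 0 \<xi> = fourier u0 \<xi> \<and> v' 0 = fourier u1 \<xi> \<and>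
           (\<forall>t\<ge>0.
              ((\<lambda>s. v s \<xi>) has_vector_derivative v' t) (at t within {0..}) \<and>
              (v' has_vector_derivative v'' t) (at t within {0..}) \<and>
              v'' t + (norm \<xi> powr (2 * \<delta>)) *\<^sub>R v' t + (norm \<xi> powr (2 * \<sigma>)) *\<^sub>R v t \<xi> = 0)))"

end

theory Submission
  imports Defs "HOL-Probability.Characteristic_Functions"
begin

text \<open>
  At each frequency the transform of the solution is a damped oscillator
  \<open>z'' + |\<xi>|\<^sup>2\<^sup>\<delta> z' + |\<xi>|\<^sup>2\<^sup>\<sigma> z = 0\<close>. Quadratic energy functionals show that it decays exponentially for
  \<open>|\<xi>| \<ge> 1\<close>, whereas for \<open>|\<xi>| \<le> 1\<close> one has \<open>|z(t)| \<le> C exp (- c |\<xi>|\<^sup>\<beta> t) (|z(0)| + |\<xi>|\<^sup>-\<^sup>2\<^sup>\<delta> |z'(0)|)\<close> with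
  \<open>\<beta> = 2 (\<sigma> - \<delta>)\<close>, and \<open>z'(t)\<close> carries the additional factor \<open>|\<xi>|\<^sup>\<beta>\<close> up to a faster decaying term. A dyadic
  decomposition then converts the growth \<open>O(R\<^sup>p)\<close> of the low-frequency energy of the data on
  \<open>|\<xi>| \<le> R\<close> into the decay \<open>O(t\<^sup>-\<^sup>p\<^sup>/\<^sup>\<beta>)\<close> of the squared \<open>L\<^sup>2\<close> norm. For \<open>m < 2\<close> this growth, with
  \<open>p = 2 n (1/m - 1/2)\<close>, needs neither the Hausdorff--Young inequality nor Pitt's inequality: a datum is cut,
  depending on \<open>R\<close>, into a part bounded in \<open>L\<^sup>1\<close> and a part bounded in \<open>L\<^sup>2\<close>. For \<open>m = 2\<close> the same
  cut, made separately in every dyadic frequency shell, gives a Hardy inequality on the Fourier side.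
\<close>


subsection \<open>The space of square-integrable functions\<close>

text \<open>The datum \<open>u1\<close> enters at low frequency with the factor
  |\<xi>|^(-2\<delta>), and the weight |x|^(2\<delta>) pays for it: it improves the growth of the
  low-frequency energy of \<open>u1\<close> by R^(4\<delta>). For this the weighted datum must be
  integrable near x = 0. With m' = m/(m-1), the hypothesis n > 2m\<delta>/(m-1) says exactly that
  |x|^(-2\<delta>) lies in L^m' near the origin. It also implies n > 4\<delta>, the condition for
  the Hardy inequality at m = 2. That case has its own argument because the growth exponent p
  vanishes there, and dividing by |\<xi>|^(4\<delta>) shell by shell would give a divergent sum.

  The two regimes are separated by comparing |\<xi>|^(4\<delta>) with |\<xi>|^(2\<sigma>), not by
  the sign of the discriminant |\<xi>|^(4\<delta>) - 4|\<xi>|^(2\<sigma>). Since 2\<delta> <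
  \<sigma>, the border is |\<xi>| = 1. The energy functionals do not see the sphere on which the two
  roots coincide and the explicit formula degenerates; that formula serves only to construct a
  solution.\<close>

lemma Lp_space_2_iff:
  "f \<in> Lp_space 2 \<longleftrightarrow> f \<in> borel_measurable borel \<and> integrable lborel (\<lambda>x. (norm (f x))\<^sup>2)"
  by (simp add: Lp_space_def)

lemma Lp_space_2_iff_nn_integral:
  "f \<in> Lp_space 2 \<longleftrightarrow>
     f \<in> borel_measurable borel \<and> (\<integral>\<^sup>+x. ennreal ((norm (f x))\<^sup>2) \<partial>lborel) < \<infinity>"
  by (auto simp: Lp_space_2_iff integrable_iff_bounded)

lemma Lp_norm_2_eq: "Lp_norm 2 f = sqrt (LINT x|lborel. (norm (f x))\<^sup>2)"
  by (simp add: Lp_norm_def powr_half_sqrt)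

lemma Lp_norm_nonneg [simp]: "0 \<le> Lp_norm p f"
  by (simp add: Lp_norm_def)

lemma Lp_norm_2_power2: "(Lp_norm 2 f)\<^sup>2 = (LINT x|lborel. (norm (f x))\<^sup>2)"
  by (simp add: Lp_norm_2_eq)

lemma ennreal_Lp_norm_2_power2:
  "f \<in> Lp_space 2 \<Longrightarrow> ennreal ((Lp_norm 2 f)\<^sup>2) = (\<integral>\<^sup>+x. ennreal ((norm (f x))\<^sup>2) \<partial>lborel)"
  by (simp add: Lp_norm_2_power2 Lp_space_2_iff nn_integral_eq_integral)

lemma Lp_space_borel_measurable [measurable_dest]:
  "f \<in> Lp_space p \<Longrightarrow> f \<in> borel_measurable borel"
  by (simp add: Lp_space_def)

lemma Lp_space_2_I:
  assumes "f \<in> borel_measurable borel"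
    and "(\<integral>\<^sup>+x. ennreal ((norm (f x))\<^sup>2) \<partial>lborel) \<le> ennreal c"
  shows "f \<in> Lp_space 2"
  using assms by (auto simp: Lp_space_2_iff_nn_integral top_unique less_top[symmetric])

lemma Lp_norm_2_leI:
  assumes "f \<in> borel_measurable borel" and "0 \<le> c"
    and "(\<integral>\<^sup>+x. ennreal ((norm (f x))\<^sup>2) \<partial>lborel) \<le> ennreal (c\<^sup>2)"
  shows "Lp_norm 2 f \<le> c"
proof -
  have "f \<in> Lp_space 2" using assms by (auto intro: Lp_space_2_I)
  then have "ennreal ((Lp_norm 2 f)\<^sup>2) \<le> ennreal (c\<^sup>2)"
    using assms by (simp add: ennreal_Lp_norm_2_power2)
  then show ?thesis using \<open>0 \<le> c\<close> by (simp add: power2_le_iff_abs_le)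
qed

lemma Lp_norm_cong_AE:
  assumes "AE x in lborel. f x = g x"
    and [measurable]: "f \<in> borel_measurable borel" "g \<in> borel_measurable borel"
  shows "Lp_norm p f = Lp_norm p g"
  unfolding Lp_norm_def using assms(1)
  by (intro arg_cong2[where f="(powr)"] integral_cong_AE) auto

lemma Lp_space_cong_AE:
  assumes "AE x in lborel. f x = g x"
    and [measurable]: "f \<in> borel_measurable borel" "g \<in> borel_measurable borel"
  shows "f \<in> Lp_space p \<longleftrightarrow> g \<in> Lp_space p"
proof -
  have "integrable lborel (\<lambda>x. norm (f x) powr p) \<longleftrightarrow> integrable lborel (\<lambda>x. norm (g x) powr p)"
    using assms(1) by (intro integrable_cong_AE) auto
  then show ?thesis by (simp add: Lp_space_def)
qed

lemma Lp_norm_2_zero_AE: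
  assumes "f \<in> Lp_space 2" "Lp_norm 2 f = 0"
  shows "AE x in lborel. f x = 0"
proof -
  have "(LINT x|lborel. (norm (f x))\<^sup>2) = 0" using assms(2) by (simp add: Lp_norm_2_eq)
  then have "AE x in lborel. (norm (f x))\<^sup>2 = 0"
    using assms(1) by (subst (asm) integral_nonneg_eq_0_iff_AE) (auto simp: Lp_space_2_iff)
  then show ?thesis by simp
qed

lemma Lp_space_2_scaleR:
  assumes "f \<in> Lp_space 2" shows "(\<lambda>x. c *\<^sub>R f x) \<in> Lp_space 2"
  using assms by (auto simp: Lp_space_2_iff power_mult_distrib)

lemma Lp_norm_2_scaleR: "Lp_norm 2 (\<lambda>x. c *\<^sub>R f x) = \<bar>c\<bar> * Lp_norm 2 f"
  by (simp add: Lp_norm_2_eq power_mult_distrib real_sqrt_mult)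

lemma Lp_space_2_bound:
  assumes "g \<in> Lp_space 2" "f \<in> borel_measurable borel"
    and "AE x in lborel. norm (f x) \<le> norm (g x)"
  shows "f \<in> Lp_space 2" "Lp_norm 2 f \<le> Lp_norm 2 g"
proof -
  note [measurable] = assms(2)
  show *: "f \<in> Lp_space 2"
    unfolding Lp_space_2_iff
  proof (intro conjI assms)
    show "integrable lborel (\<lambda>x. (norm (f x))\<^sup>2)"
      by (rule Bochner_Integration.integrable_bound[where f="\<lambda>x. (norm (g x))\<^sup>2"])
        (use assms in \<open>auto simp: Lp_space_2_iff intro!: power_mono\<close>)
  qed
  show "Lp_norm 2 f \<le> Lp_norm 2 g"
    unfolding Lp_norm_2_eq real_sqrt_le_iff
    by (rule integral_mono_AE) (use * assms in \<open>auto simp: Lp_space_2_iff intro!: power_mono\<close>)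
qed

lemma Lp_space_2_add:
  assumes "f \<in> Lp_space 2" "g \<in> Lp_space 2"
  shows "(\<lambda>x. f x + g x) \<in> Lp_space 2"
proof -
  have [measurable]: "f \<in> borel_measurable borel" "g \<in> borel_measurable borel"
    using assms by (auto simp: Lp_space_def)
  have le: "(norm (f x + g x))\<^sup>2 \<le> 2 * (norm (f x))\<^sup>2 + 2 * (norm (g x))\<^sup>2" for x
    using power_mono[OF norm_triangle_ineq[of "f x" "g x"], of 2] sum_squares_bound[of "norm (f x)" "norm (g x)"]
    by (simp add: power2_sum)
  have "integrable lborel (\<lambda>x. 2 * (norm (f x))\<^sup>2 + 2 * (norm (g x))\<^sup>2)"
    using assms by (simp add: Lp_space_2_iff)
  then have "integrable lborel (\<lambda>x. (norm (f x + g x))\<^sup>2)"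
    by (rule Bochner_Integration.integrable_bound) (auto intro!: AE_I2 le)
  then show ?thesis by (simp add: Lp_space_2_iff)
qed

lemma Lp_space_2_diff:
  assumes "f \<in> Lp_space 2" "g \<in> Lp_space 2"
  shows "(\<lambda>x. f x - g x) \<in> Lp_space 2"
  using Lp_space_2_add[OF assms(1) Lp_space_2_scaleR[OF assms(2), of "-1"]] by simp

lemma Lp_norm_2_diff_commute: "Lp_norm 2 (\<lambda>x. f x - g x) = Lp_norm 2 (\<lambda>x. g x - f x)"
  by (simp add: Lp_norm_def norm_minus_commute)

text \<open>The real part of the Hermitian product, since \<open>inner\<close> on
  \<open>complex\<close> is the scalar product of the plane. It determines the norms of differences,
  and uniqueness and inversion are proved through these.\<close>

definition L2_inner :: "(real ^ 'n \<Rightarrow> complex) \<Rightarrow> (real ^ 'n \<Rightarrow> complex) \<Rightarrow> real" where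
  "L2_inner f g = (LINT x|lborel. f x \<bullet> g x)"

lemma integrable_inner_L2:
  assumes "f \<in> Lp_space 2" "g \<in> Lp_space 2"
  shows "integrable lborel (\<lambda>x. f x \<bullet> g x)"
proof -
  have [measurable]: "f \<in> borel_measurable borel" "g \<in> borel_measurable borel"
    using assms by (auto simp: Lp_space_def)
  have le: "\<bar>f x \<bullet> g x\<bar> \<le> (norm (f x))\<^sup>2 + (norm (g x))\<^sup>2" for x
    using Cauchy_Schwarz_ineq2[of "f x" "g x"] sum_squares_bound[of "norm (f x)" "norm (g x)"]
      mult_nonneg_nonneg[of "norm (f x)" "norm (g x)"] by simp
  have "integrable lborel (\<lambda>x. (norm (f x))\<^sup>2 + (norm (g x))\<^sup>2)"
    using assms by (simp add: Lp_space_2_iff)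
  then show ?thesis
    by (rule Bochner_Integration.integrable_bound) (auto intro!: AE_I2 le)
qed

lemma L2_inner_self: "L2_inner f f = (Lp_norm 2 f)\<^sup>2"
  by (simp add: L2_inner_def Lp_norm_2_power2 power2_norm_eq_inner)

lemma Lp_norm_2_diff_power2:
  assumes "f \<in> Lp_space 2" "g \<in> Lp_space 2"
  shows "(Lp_norm 2 (\<lambda>x. f x - g x))\<^sup>2 = (Lp_norm 2 f)\<^sup>2 - 2 * L2_inner f g + (Lp_norm 2 g)\<^sup>2"
proof -
  have "(norm (f x - g x))\<^sup>2 = (norm (f x))\<^sup>2 - 2 * (f x \<bullet> g x) + (norm (g x))\<^sup>2" for x
    by (simp add: power2_norm_eq_inner inner_diff_left inner_diff_right inner_commute)
  then show ?thesis
    using assms integrable_inner_L2[OF assms]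
    by (simp add: Lp_norm_2_power2 L2_inner_def Lp_space_2_iff)
qed

lemma L2_inner_scaleR_right: "L2_inner f (\<lambda>x. c *\<^sub>R g x) = c * L2_inner f g"
  by (simp add: L2_inner_def)

lemma L2_inner_diff_left:
  assumes "f \<in> Lp_space 2" "g \<in> Lp_space 2" "h \<in> Lp_space 2"
  shows "L2_inner (\<lambda>x. f x - g x) h = L2_inner f h - L2_inner g h"
  by (simp add: L2_inner_def inner_diff_left integrable_inner_L2 assms)

lemma L2_inner_commute: "L2_inner f g = L2_inner g f"
  by (simp add: L2_inner_def inner_commute)

lemma L2_Cauchy_Schwarz:
  assumes "f \<in> Lp_space 2" "g \<in> Lp_space 2"
  shows "\<bar>L2_inner f g\<bar> \<le> Lp_norm 2 f * Lp_norm 2 g"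
proof (cases "Lp_norm 2 g = 0")
  case True
  have [measurable]: "f \<in> borel_measurable borel" "g \<in> borel_measurable borel"
    using assms by (auto simp: Lp_space_def)
  have "AE x in lborel. f x \<bullet> g x = 0" using Lp_norm_2_zero_AE[OF assms(2) True] by auto
  then have "L2_inner f g = 0" unfolding L2_inner_def by (subst integral_cong_AE[where g="\<lambda>_. 0"]) auto
  then show ?thesis by simp
next
  case False
  let ?F = "Lp_norm 2 f" and ?G = "Lp_norm 2 g" and ?I = "L2_inner f g"
  \<comment> \<open>The coefficient of the orthogonal projection of \<open>f\<close> onto
    \<open>g\<close>, which minimises the norm of \<open>f - c g\<close>.\<close>
  define c where "c = ?I / ?G\<^sup>2"
  have "0 \<le> ?F\<^sup>2 - 2 * (c * ?I) + c\<^sup>2 * ?G\<^sup>2"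
    using Lp_norm_2_diff_power2[OF assms(1) Lp_space_2_scaleR[OF assms(2), of c]]
      zero_le_power2[of "Lp_norm 2 (\<lambda>x. f x - c *\<^sub>R g x)"]
    by (simp add: L2_inner_scaleR_right Lp_norm_2_scaleR power_mult_distrib)
  also have "\<dots> = ?F\<^sup>2 - ?I\<^sup>2 / ?G\<^sup>2" using False by (simp add: c_def field_simps power2_eq_square)
  finally have "?I\<^sup>2 \<le> ?F\<^sup>2 * ?G\<^sup>2" using False by (simp add: divide_simps split: if_splits)
  then have "?I\<^sup>2 \<le> (?F * ?G)\<^sup>2" by (simp add: power_mult_distrib)
  then show ?thesis using abs_le_square_iff[of ?I "?F * ?G"] by simp
qed

lemma Lp_norm_2_triangle_diff:
  assumes "f \<in> Lp_space 2" "g \<in> Lp_space 2"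
  shows "Lp_norm 2 (\<lambda>x. f x - g x) \<le> Lp_norm 2 f + Lp_norm 2 g"
proof (rule power2_le_imp_le)
  show "(Lp_norm 2 (\<lambda>x. f x - g x))\<^sup>2 \<le> (Lp_norm 2 f + Lp_norm 2 g)\<^sup>2"
    using Lp_norm_2_diff_power2[OF assms] L2_Cauchy_Schwarz[OF assms] by (simp add: power2_sum)
qed simp

lemma Lp_norm_2_triangle:
  assumes "f \<in> Lp_space 2" "g \<in> Lp_space 2" "h \<in> Lp_space 2"
  shows "Lp_norm 2 (\<lambda>x. f x - h x) \<le> Lp_norm 2 (\<lambda>x. f x - g x) + Lp_norm 2 (\<lambda>x. g x - h x)"
  using Lp_norm_2_triangle_diff[OF Lp_space_2_diff[OF assms(1,2)] Lp_space_2_diff[OF assms(3,2)]]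
  by (simp add: Lp_norm_2_diff_commute[of h g])

lemma Lp_norm_2_triangle_sub:
  assumes "f \<in> Lp_space 2" "g \<in> Lp_space 2"
  shows "\<bar>Lp_norm 2 f - Lp_norm 2 g\<bar> \<le> Lp_norm 2 (\<lambda>x. f x - g x)"
proof -
  have z: "(\<lambda>x. 0) \<in> Lp_space 2" by (simp add: Lp_space_2_iff)
  show ?thesis
    using Lp_norm_2_triangle[OF assms z] Lp_norm_2_triangle[OF assms(2,1) z]
    by (simp add: Lp_norm_2_diff_commute[of g f])
qed

lemma L2_tendsto_Lp_norm:
  assumes "L2_tendsto f g F" "g \<in> Lp_space 2"
  shows "((\<lambda>i. Lp_norm 2 (f i)) \<longlongrightarrow> Lp_norm 2 g) F"
proof -
  have ev: "\<forall>\<^sub>F i in F. f i \<in> Lp_space 2"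
    using assms(1) unfolding L2_tendsto_def
    by (auto elim!: eventually_mono dest: Lp_space_2_add[OF _ assms(2)])
  have "((\<lambda>i. Lp_norm 2 (f i) - Lp_norm 2 g) \<longlongrightarrow> 0) F"
  proof (rule Lim_null_comparison)
    show "\<forall>\<^sub>F i in F. norm (Lp_norm 2 (f i) - Lp_norm 2 g) \<le> Lp_norm 2 (\<lambda>x. f i x - g x)"
      using ev by eventually_elim (auto intro: Lp_norm_2_triangle_sub assms)
  qed (use assms in \<open>auto simp: L2_tendsto_def\<close>)
  then show ?thesis using LIM_zero_iff by blast
qed

lemma L2_tendsto_inner:
  assumes "L2_tendsto f g F" "g \<in> Lp_space 2" "h \<in> Lp_space 2"
  shows "((\<lambda>i. L2_inner (f i) h) \<longlongrightarrow> L2_inner g h) F"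
proof -
  have ev: "\<forall>\<^sub>F i in F. f i \<in> Lp_space 2"
    using assms(1) unfolding L2_tendsto_def
    by (auto elim!: eventually_mono dest: Lp_space_2_add[OF _ assms(2)])
  have "((\<lambda>i. L2_inner (f i) h - L2_inner g h) \<longlongrightarrow> 0) F"
  proof (rule Lim_null_comparison)
    show "\<forall>\<^sub>F i in F. norm (L2_inner (f i) h - L2_inner g h) \<le> Lp_norm 2 (\<lambda>x. f i x - g x) * Lp_norm 2 h"
      using ev
    proof eventually_elim
      case (elim i)
      then show ?case
        using L2_Cauchy_Schwarz[OF Lp_space_2_diff[OF elim assms(2)] assms(3)] assms
        by (simp add: L2_inner_diff_left)
    qed
    show "((\<lambda>i. Lp_norm 2 (\<lambda>x. f i x - g x) * Lp_norm 2 h) \<longlongrightarrow> 0) F"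
      using assms(1) by (auto simp: L2_tendsto_def intro: tendsto_mult_left_zero)
  qed
  then show ?thesis using LIM_zero_iff by blast
qed

lemma L2_tendsto_unique:
  assumes "L2_tendsto f g F" "L2_tendsto f h F" "F \<noteq> bot" "g \<in> Lp_space 2" "h \<in> Lp_space 2"
  shows "AE x in lborel. g x = h x"
proof -
  have "((\<lambda>i. Lp_norm 2 (\<lambda>x. f i x - g x) + Lp_norm 2 (\<lambda>x. f i x - h x)) \<longlongrightarrow> 0 + 0) F"
    using assms by (intro tendsto_add) (auto simp: L2_tendsto_def)
  moreover have "\<forall>\<^sub>F i in F. Lp_norm 2 (\<lambda>x. g x - h x) \<le>
      Lp_norm 2 (\<lambda>x. f i x - g x) + Lp_norm 2 (\<lambda>x. f i x - h x)"
  proof -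
    have "\<forall>\<^sub>F i in F. (\<lambda>x. f i x - g x) \<in> Lp_space 2" using assms by (simp add: L2_tendsto_def)
    then show ?thesis
    proof eventually_elim
      case (elim i)
      have "f i \<in> Lp_space 2" using Lp_space_2_add[OF elim assms(4)] by simp
      from Lp_norm_2_triangle[OF assms(4) this assms(5)] show ?case
        by (simp add: Lp_norm_2_diff_commute[of g])
    qed
  qed
  ultimately have "Lp_norm 2 (\<lambda>x. g x - h x) \<le> 0"
    using assms(3) by (intro tendsto_lowerbound) auto
  then have "Lp_norm 2 (\<lambda>x. g x - h x) = 0" using Lp_norm_nonneg[of 2 "\<lambda>x. g x - h x"] by linarith
  from Lp_norm_2_zero_AE[OF Lp_space_2_diff[OF assms(4,5)] this] show ?thesis by simp
qed

lemma L2_tendsto_diff: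
  assumes "L2_tendsto f g F" "L2_tendsto f' g' F"
  shows "L2_tendsto (\<lambda>i x. f i x - f' i x) (\<lambda>x. g x - g' x) F"
  unfolding L2_tendsto_def
proof (intro conjI)
  have *: "\<forall>\<^sub>F i in F. (\<lambda>x. f i x - g x) \<in> Lp_space 2 \<and> (\<lambda>x. f' i x - g' x) \<in> Lp_space 2"
    using assms by (auto simp: L2_tendsto_def eventually_conj_iff)
  have eq: "f i x - f' i x - (g x - g' x) = f i x - g x - (f' i x - g' x)" for i x by simp
  show "\<forall>\<^sub>F i in F. (\<lambda>x. f i x - f' i x - (g x - g' x)) \<in> Lp_space 2"
    unfolding eq using * by eventually_elim (auto intro: Lp_space_2_diff)
  show "((\<lambda>i. Lp_norm 2 (\<lambda>x. f i x - f' i x - (g x - g' x))) \<longlongrightarrow> 0) F"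
  proof (rule Lim_null_comparison)
    show "\<forall>\<^sub>F i in F. norm (Lp_norm 2 (\<lambda>x. f i x - f' i x - (g x - g' x))) \<le>
        Lp_norm 2 (\<lambda>x. f i x - g x) + Lp_norm 2 (\<lambda>x. f' i x - g' x)"
      unfolding eq using * by eventually_elim (auto intro: Lp_norm_2_triangle_diff)
    show "((\<lambda>i. Lp_norm 2 (\<lambda>x. f i x - g x) + Lp_norm 2 (\<lambda>x. f' i x - g' x)) \<longlongrightarrow> 0) F"
      using assms by (auto simp: L2_tendsto_def intro: tendsto_add_zero)
  qed
qed

lemma L2_tendsto_scaleR:
  assumes "L2_tendsto f g F"
  shows "L2_tendsto (\<lambda>i x. c *\<^sub>R f i x) (\<lambda>x. c *\<^sub>R g x) F"
  using assms unfolding L2_tendsto_def scaleR_diff_right[symmetric]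
  by (auto simp: Lp_norm_2_scaleR intro!: tendsto_mult_right_zero elim: eventually_mono Lp_space_2_scaleR)

text \<open>Riesz--Fischer: along a subsequence with summable increments the sequence converges almost
  everywhere, and Fatou's lemma turns the Cauchy property into convergence to that limit.\<close>

lemma L2_complete:
  fixes f :: "real \<Rightarrow> real ^ 'n \<Rightarrow> complex"
  assumes f: "\<And>R. f R \<in> Lp_space 2"
    and Cauchy: "\<And>e. 0 < e \<Longrightarrow> \<exists>K. \<forall>R\<ge>K. \<forall>S\<ge>K. Lp_norm 2 (\<lambda>x. f R x - f S x) \<le> e"
  shows "\<exists>g \<in> Lp_space 2. L2_tendsto f g at_top"
proof -
  have [measurable]: "f R \<in> borel_measurable borel" for R using f by (auto simp: Lp_space_def)
  have "\<forall>k::nat. \<exists>K. \<forall>R\<ge>K. \<forall>S\<ge>K. Lp_norm 2 (\<lambda>x. f R x - f S x) \<le> (1/4)^k" using Cauchy by simp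
  then obtain K where K: "\<And>k R S. R \<ge> K k \<Longrightarrow> S \<ge> K k \<Longrightarrow> Lp_norm 2 (\<lambda>x. f R x - f S x) \<le> (1/4)^k"
    by metis
  \<comment> \<open>The maximum over all earlier thresholds gives \<open>K j \<le> s k\<close>
    whenever \<open>j \<le> k\<close>; the summand \<open>real k\<close> forces \<open>s\<close> to
    infinity even if the thresholds stay bounded.\<close>
  define s where "s k = Max (K ` {..k}) + real k" for k
  have sK: "K j \<le> s k" if "j \<le> k" for j k
    unfolding s_def using that by (intro add_increasing2 Max_ge) auto
  have s_top: "filterlim s at_top sequentially"
  proof (rule filterlim_at_top_mono[OF filterlim_real_sequentially[THEN filterlim_tendsto_add_at_top[OF tendsto_const[of "K 0"]]]])
    show "\<forall>\<^sub>F x in sequentially. K 0 + real x \<le> s x"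
      by (auto simp: s_def intro!: always_eventually Max_ge)
  qed
  define d where "d k x = f (s (Suc k)) x - f (s k) x" for k x
  have [measurable]: "d k \<in> borel_measurable borel" for k unfolding d_def by measurable
  have dL: "d k \<in> Lp_space 2" for k unfolding d_def by (intro Lp_space_2_diff f)
  have dn: "Lp_norm 2 (d k) \<le> (1/4)^k" for k unfolding d_def by (intro K sK) auto
  have "(\<integral>\<^sup>+x. (\<Sum>k. ennreal (4^k * (norm (d k x))\<^sup>2)) \<partial>lborel)
      = (\<Sum>k. ennreal (4^k) * ennreal ((Lp_norm 2 (d k))\<^sup>2))"
    by (subst nn_integral_suminf)
      (auto simp: ennreal_mult nn_integral_cmult ennreal_Lp_norm_2_power2[OF dL])
  also have "\<dots> \<le> (\<Sum>k. ennreal ((1/4)^k))"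
  proof (rule suminf_le)
    fix k
    have "4^k * (Lp_norm 2 (d k))\<^sup>2 \<le> 4^k * ((1/4)^k)\<^sup>2"
      using dn by (intro mult_left_mono power_mono) auto
    also have "\<dots> = (1/4::real)^k" by (simp add: power2_eq_square power_divide)
    finally show "ennreal (4^k) * ennreal ((Lp_norm 2 (d k))\<^sup>2) \<le> ennreal ((1/4)^k)"
      by (subst ennreal_mult[symmetric]) (auto intro: ennreal_leI)
  qed auto
  also have "\<dots> < \<infinity>"
    by (subst suminf_ennreal2) (auto intro: summable_geometric)
  finally have "AE x in lborel. (\<Sum>k. ennreal (4^k * (norm (d k x))\<^sup>2)) \<noteq> \<infinity>"
    by (intro nn_integral_PInf_AE) auto
  then have conv: "AE x in lborel. convergent (\<lambda>k. f (s k) x)"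
  proof eventually_elim
    case (elim x)
    then have sm: "summable (\<lambda>k. 4^k * (norm (d k x))\<^sup>2)"
      by (intro summable_suminf_not_top) auto
    \<comment> \<open>Arithmetic-geometric mean with the factors \<open>2^k * norm (d k x)\<close>
      and \<open>(1/2)^k\<close>: the weighted squares control the increments themselves. The weight
      \<open>4^k\<close> is affordable because the squared norms of the increments are at most
      \<open>(1/16)^k\<close>.\<close>
    have "summable (\<lambda>k. norm (d k x))"
    proof (rule summable_comparison_test[OF _ summable_add[OF sm summable_geometric[of "1/4::real"]]])
      show "\<exists>N. \<forall>k\<ge>N. norm (norm (d k x)) \<le> 4^k * (norm (d k x))\<^sup>2 + (1/4)^k"
      proof (intro exI allI impI)
        fix k :: nat
        have "2 * (2^k * norm (d k x)) * (1/2)^k \<le> (2^k * norm (d k x))\<^sup>2 + ((1/2)^k)\<^sup>2"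
          by (rule sum_squares_bound)
        moreover have "2 * (2^k * norm (d k x)) * (1/2)^k = 2 * norm (d k x)"
          by (simp add: power_divide)
        moreover have "(2^k * norm (d k x))\<^sup>2 = 4^k * (norm (d k x))\<^sup>2"
          by (simp add: power_mult_distrib power2_eq_square flip: power_mult_distrib)
        moreover have "((1/2::real)^k)\<^sup>2 = (1/4)^k"
          by (simp add: power2_eq_square flip: power_mult_distrib)
        ultimately have "2 * norm (d k x) \<le> 4^k * (norm (d k x))\<^sup>2 + (1/4)^k" by (simp only:)
        then show "norm (norm (d k x)) \<le> 4^k * (norm (d k x))\<^sup>2 + (1/4)^k"
          using norm_ge_zero[of "d k x"] by (simp only: real_norm_def abs_norm_cancel)
      qed
    qed simp
    then have "summable (\<lambda>k. d k x)" by (rule summable_norm_cancel)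
    then have "convergent (\<lambda>n. (\<Sum>k<n. d k x))" by (rule summable_iff_convergent[THEN iffD1])
    moreover have "(\<Sum>k<n. d k x) = f (s n) x - f (s 0) x" for n
      unfolding d_def by (rule sum_lessThan_telescope)
    ultimately show ?case using convergent_diff_const_right_iff[of "\<lambda>n. f (s n) x" "f (s 0) x"] by simp
  qed
  define g where "g x = lim (\<lambda>k. f (s k) x)" for x
  have [measurable]: "g \<in> borel_measurable borel" unfolding g_def by measurable
  have fg: "AE x in lborel. (\<lambda>k. f (s k) x) \<longlonglongrightarrow> g x"
    using conv by eventually_elim (simp add: g_def convergent_LIMSEQ_iff)
  have bound: "(\<integral>\<^sup>+x. ennreal ((norm (f R x - g x))\<^sup>2) \<partial>lborel) \<le> ennreal (e\<^sup>2)"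
    if "e > 0" and R: "\<forall>S\<ge>R. Lp_norm 2 (\<lambda>x. f R x - f S x) \<le> e" for e R
  proof -
    have "(\<integral>\<^sup>+x. ennreal ((norm (f R x - g x))\<^sup>2) \<partial>lborel)
        = (\<integral>\<^sup>+x. liminf (\<lambda>k. ennreal ((norm (f R x - f (s k) x))\<^sup>2)) \<partial>lborel)"
    proof (rule nn_integral_cong_AE, use fg in eventually_elim)
      case (elim x)
      have "(\<lambda>k. ennreal ((norm (f R x - f (s k) x))\<^sup>2)) \<longlonglongrightarrow> ennreal ((norm (f R x - g x))\<^sup>2)"
        by (intro tendsto_intros elim)
      from lim_imp_Liminf[OF _ this] show ?case by simp
    qed
    also have "\<dots> \<le> liminf (\<lambda>k. \<integral>\<^sup>+x. ennreal ((norm (f R x - f (s k) x))\<^sup>2) \<partial>lborel)"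
      by (rule nn_integral_liminf) auto
    also have "\<dots> \<le> liminf (\<lambda>k. ennreal (e\<^sup>2))"
    proof (rule Liminf_mono)
      have "\<forall>\<^sub>F k in sequentially. R \<le> s k" using s_top by (simp add: filterlim_at_top)
      then show "\<forall>\<^sub>F k in sequentially. (\<integral>\<^sup>+x. ennreal ((norm (f R x - f (s k) x))\<^sup>2) \<partial>lborel) \<le> ennreal (e\<^sup>2)"
        by eventually_elim (use R in \<open>auto simp: ennreal_Lp_norm_2_power2[OF Lp_space_2_diff[OF f f], symmetric]
            intro!: ennreal_leI power_mono\<close>)
    qed
    also have "\<dots> = ennreal (e\<^sup>2)" by (simp add: Liminf_const)
    finally show ?thesis .
  qed
  have dg: "(\<lambda>x. f R x - g x) \<in> Lp_space 2 \<and> Lp_norm 2 (\<lambda>x. f R x - g x) \<le> e"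
    if "e > 0" and "\<forall>S\<ge>R. Lp_norm 2 (\<lambda>x. f R x - f S x) \<le> e" for e R
    using bound[OF that] \<open>e > 0\<close> by (auto intro!: Lp_norm_2_leI Lp_space_2_I)
  have "g \<in> Lp_space 2"
    using Lp_space_2_diff[OF f[of "K 0"] conjunct1[OF dg[of 1 "K 0"]]] K[of 0] by simp
  moreover have "L2_tendsto f g at_top"
    unfolding L2_tendsto_def
  proof
    show "\<forall>\<^sub>F R in at_top. (\<lambda>x. f R x - g x) \<in> Lp_space 2"
      using \<open>g \<in> Lp_space 2\<close> f by (auto intro!: always_eventually Lp_space_2_diff)
    show "((\<lambda>R. Lp_norm 2 (\<lambda>x. f R x - g x)) \<longlongrightarrow> 0) at_top"
    proof (rule tendstoI)
      fix e :: real assume "e > 0"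
      then obtain L where "\<forall>R\<ge>L. \<forall>S\<ge>L. Lp_norm 2 (\<lambda>x. f R x - f S x) \<le> e/2"
        using Cauchy[of "e/2"] by auto
      then have "Lp_norm 2 (\<lambda>x. f R x - g x) < e" if "R \<ge> L" for R
        using dg[of "e/2" R] that \<open>e > 0\<close> by force
      then show "\<forall>\<^sub>F R in at_top. dist (Lp_norm 2 (\<lambda>x. f R x - g x)) 0 < e"
        by (auto simp: eventually_at_top_linorder)
    qed
  qed
  ultimately show ?thesis by blast
qed

subsection \<open>Gaussian integrals\<close>

text \<open>The substitution s = x / sqrt e turns the integrand into a multiple of the standard
  normal density times a phase, so the value is read off from the characteristic function of the
  standard normal distribution.\<close>

lemma gaussian_fourier_real:
  assumes "0 < (e::real)"
  shows "integrable lborel (\<lambda>s::real. complex_of_real (exp (- (e/2) * s\<^sup>2)) * cis (\<tau> * s))"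
    and "(LINT s|lborel. complex_of_real (exp (- (e/2) * s\<^sup>2)) * cis (\<tau> * s)) =
           complex_of_real (sqrt (2 * pi / e) * exp (- \<tau>\<^sup>2 / (2 * e)))"
proof -
  define f where "f s = complex_of_real (exp (- (e/2) * s\<^sup>2)) * cis (\<tau> * s)" for s
  define r where "r = sqrt e"
  have r: "r > 0" "r * r = e" using assms by (auto simp: r_def)
  have eq: "complex_of_real (exp (- (s\<^sup>2) / 2)) = complex_of_real (sqrt (2 * pi)) * complex_of_real (std_normal_density s)" for s
    by (simp only: of_real_mult[symmetric]) (simp add: normal_density_def)
  have fr: "f (0 + (1/r) * s) = sqrt (2 * pi) *\<^sub>R (std_normal_density s *\<^sub>R iexp ((\<tau> / r) * s))" for s
  proof -
    have "- (e/2) * (1/r * s)\<^sup>2 = - (s\<^sup>2) / 2"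
      using r assms by (simp add: field_simps power2_eq_square)
    then show ?thesis
      unfolding f_def by (simp only: add_0 eq) (simp add: cis_conv_exp scaleR_conv_of_real)
  qed
  have "integrable lborel (\<lambda>s. std_normal_density s *\<^sub>R iexp ((\<tau> / r) * s))"
    by (rule Bochner_Integration.integrable_bound[OF integrable_normal_density[of 1 0]])
      (auto simp: normal_density_nonneg)
  then have "integrable lborel (\<lambda>s. f (0 + (1/r) * s))" unfolding fr by (rule integrable_scaleR_right)
  then show "integrable lborel (\<lambda>s::real. complex_of_real (exp (- (e/2) * s\<^sup>2)) * cis (\<tau> * s))"
    using lborel_integrable_real_affine_iff[of "1/r" f 0] r unfolding f_def[abs_def] by simp
  have ch: "(LINT s|lborel. std_normal_density s *\<^sub>R iexp ((\<tau> / r) * s)) = complex_of_real (exp (- ((\<tau> / r)\<^sup>2) / 2))"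
    using fun_cong[OF char_std_normal_distribution, of "\<tau> / r"]
    unfolding char_def by (subst (asm) integral_density) auto
  have "(LINT s|lborel. f s) = \<bar>1/r\<bar> *\<^sub>R (LINT s|lborel. f (0 + (1/r) * s))"
    using r by (intro lborel_integral_real_affine) simp
  also have "\<dots> = complex_of_real ((1/r) * (sqrt (2 * pi) * exp (- ((\<tau> / r)\<^sup>2) / 2)))"
    unfolding fr integral_scaleR_right ch using r by (simp add: scaleR_conv_of_real)
  also have "(1/r) * (sqrt (2 * pi) * exp (- ((\<tau> / r)\<^sup>2) / 2)) = sqrt (2 * pi / e) * exp (- \<tau>\<^sup>2 / (2 * e))"
    using r by (simp add: real_sqrt_divide r_def power_divide)
  finally show "(LINT s|lborel. complex_of_real (exp (- (e/2) * s\<^sup>2)) * cis (\<tau> * s)) =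
           complex_of_real (sqrt (2 * pi / e) * exp (- \<tau>\<^sup>2 / (2 * e)))" unfolding f_def .
qed

lemma cis_sum: "finite A \<Longrightarrow> cis (sum f A) = (\<Prod>a\<in>A. cis (f a))"
  by (induction rule: finite_induct) (auto simp flip: cis_mult)

text \<open>Both the Gaussian and the phase factor over the coordinates, and \<open>lborel\<close>
  is the image under \<open>T\<close> of a product of one-dimensional Lebesgue measures. The
  integral is therefore a product of one-dimensional ones.\<close>

lemma gaussian_fourier:
  fixes z :: "'a::euclidean_space"
  assumes "0 < e"
  shows "integrable lborel (\<lambda>\<xi>::'a. exp (- (e/2) * (norm \<xi>)\<^sup>2) *\<^sub>R cis (z \<bullet> \<xi>))"
    and "(LINT \<xi>|lborel. exp (- (e/2) * (norm \<xi>)\<^sup>2) *\<^sub>R cis (z \<bullet> \<xi>)) =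
           complex_of_real ((2 * pi / e) powr (real DIM('a) / 2) * exp (- (norm z)\<^sup>2 / (2 * e)))"
proof -
  interpret product_sigma_finite "\<lambda>_::'a. lborel :: real measure" by standard
  define g where "g b s = complex_of_real (exp (- (e/2) * s\<^sup>2)) * cis (z \<bullet> b * s)" for b :: 'a and s
  define T where "T = (\<lambda>f. \<Sum>b\<in>Basis. f b *\<^sub>R b :: 'a)"
  let ?P = "\<Pi>\<^sub>M b\<in>(Basis::'a set). (lborel :: real measure)"
  have [measurable]: "T \<in> measurable ?P borel"
    unfolding T_def by measurable
  have gi: "integrable lborel (g b)" for b
    unfolding g_def[abs_def] by (rule gaussian_fourier_real[OF assms])
  have prod: "exp (- (e/2) * (norm \<xi>)\<^sup>2) *\<^sub>R cis (z \<bullet> \<xi>) = (\<Prod>b\<in>Basis. g b (\<xi> \<bullet> b))" for \<xi> :: 'a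
  proof -
    have "(norm \<xi>)\<^sup>2 = (\<Sum>b\<in>Basis. (\<xi> \<bullet> b)\<^sup>2)"
      unfolding power2_norm_eq_inner by (subst euclidean_inner) (simp add: power2_eq_square)
    moreover have "z \<bullet> \<xi> = (\<Sum>b\<in>Basis. (z \<bullet> b) * (\<xi> \<bullet> b))" by (rule euclidean_inner)
    ultimately show ?thesis
      by (simp add: g_def prod.distrib cis_sum scaleR_conv_of_real exp_sum sum_distrib_left flip: sum_negf)
  qed
  have Tb: "T f \<bullet> b = f b" if "b \<in> Basis" for f b
    using that unfolding T_def by simp
  have lb: "(lborel :: 'a measure) = distr ?P borel T" unfolding T_def by (rule lborel_eq)
  show "integrable lborel (\<lambda>\<xi>::'a. exp (- (e/2) * (norm \<xi>)\<^sup>2) *\<^sub>R cis (z \<bullet> \<xi>))"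
    unfolding lb
  proof (subst integrable_distr_eq)
    show "integrable ?P (\<lambda>x. exp (- (e/2) * (norm (T x))\<^sup>2) *\<^sub>R cis (z \<bullet> T x))"
      unfolding prod using product_integrable_prod[OF finite_Basis gi] by (simp add: Tb cong: prod.cong)
  qed (measurable, simp add: cis_conv_exp)
  have "(LINT \<xi>|lborel. exp (- (e/2) * (norm \<xi>)\<^sup>2) *\<^sub>R cis (z \<bullet> \<xi>)) =
      (LINT x|?P. exp (- (e/2) * (norm (T x))\<^sup>2) *\<^sub>R cis (z \<bullet> T x))"
    unfolding lb by (subst integral_distr) (auto simp: cis_conv_exp)
  also have "\<dots> = (LINT x|?P. (\<Prod>b\<in>Basis. g b (x b)))"
    unfolding prod by (simp add: Tb cong: prod.cong)
  also have "\<dots> = (\<Prod>b\<in>Basis. LINT s|lborel. g b s)"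
    by (rule product_integral_prod) (auto intro: gi)
  also have "\<dots> = complex_of_real (\<Prod>b\<in>Basis. sqrt (2 * pi / e) * exp (- (z \<bullet> b)\<^sup>2 / (2 * e)))"
    unfolding g_def by (simp only: gaussian_fourier_real(2)[OF assms] of_real_prod)
  also have "(\<Prod>b\<in>Basis. sqrt (2 * pi / e) * exp (- (z \<bullet> b)\<^sup>2 / (2 * e))) =
      sqrt (2 * pi / e) ^ DIM('a) * exp (- (\<Sum>b\<in>Basis. (z \<bullet> b)\<^sup>2) / (2 * e))"
    by (simp add: prod.distrib exp_sum sum_divide_distrib flip: sum_negf)
  also have "(\<Sum>b\<in>Basis. (z \<bullet> b)\<^sup>2) = (norm z)\<^sup>2"
    unfolding power2_norm_eq_inner unfolding power2_eq_square by (rule euclidean_inner[symmetric])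
  also have "sqrt (2 * pi / e) ^ DIM('a) = (2 * pi / e) powr (real DIM('a) / 2)"
    using assms by (simp add: powr_half_sqrt[symmetric] powr_powr flip: powr_realpow)
  finally show "(LINT \<xi>|lborel. exp (- (e/2) * (norm \<xi>)\<^sup>2) *\<^sub>R cis (z \<bullet> \<xi>)) =
           complex_of_real ((2 * pi / e) powr (real DIM('a) / 2) * exp (- (norm z)\<^sup>2 / (2 * e)))" .
qed

text \<open>The centred normal density with covariance \<open>e\<close> times the identity, that is,
  the heat kernel at time e/2. It is what Gaussian damping by exp(-(e/2) |\<xi>|^2) becomes on the
  space side.\<close>

definition heat_kernel :: "real \<Rightarrow> 'a::euclidean_space \<Rightarrow> real" where
  "heat_kernel e z = (2 * pi * e) powr (- (real DIM('a) / 2)) * exp (- (norm z)\<^sup>2 / (2 * e))"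

lemma heat_kernel_pos: "e > 0 \<Longrightarrow> 0 < heat_kernel e z"
  by (simp add: heat_kernel_def)

lemma heat_kernel_measurable [measurable]: "heat_kernel e \<in> borel_measurable borel"
  unfolding heat_kernel_def[abs_def] by measurable

lemma nn_integral_heat_kernel_1: "(\<integral>\<^sup>+z. ennreal (heat_kernel 1 (z::'a::euclidean_space)) \<partial>lborel) = 1"
proof -
  let ?g = "\<lambda>\<xi>::'a. exp (- (1/2) * (norm \<xi>)\<^sup>2)"
  have int: "integrable lborel (\<lambda>\<xi>. complex_of_real (?g \<xi>))"
    using gaussian_fourier(1)[of 1 "0::'a"] by (simp add: scaleR_conv_of_real)
  then have i2: "integrable lborel ?g" using complex_of_real_integrable_eq by blast
  have "complex_of_real (LINT \<xi>|lborel. ?g \<xi>) = complex_of_real ((2 * pi) powr (real DIM('a) / 2))"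
    using gaussian_fourier(2)[of 1 "0::'a"] by (simp add: scaleR_conv_of_real)
  then have val: "(LINT \<xi>|lborel. ?g \<xi>) = (2 * pi) powr (real DIM('a) / 2)" using of_real_eq_iff by blast
  have "(\<integral>\<^sup>+z. ennreal (heat_kernel 1 (z::'a)) \<partial>lborel) =
      ennreal ((2 * pi) powr (- (real DIM('a) / 2))) * (\<integral>\<^sup>+z. ennreal (?g z) \<partial>lborel)"
    by (subst nn_integral_cmult[symmetric]) (auto simp: heat_kernel_def ennreal_mult)
  also have "\<dots> = ennreal ((2 * pi) powr (- (real DIM('a) / 2)) * (2 * pi) powr (real DIM('a) / 2))"
    by (subst nn_integral_eq_integral[OF i2]) (auto simp only: val ennreal_mult powr_ge_zero intro!: AE_I2 exp_ge_zero)
  also have "\<dots> = 1" by (simp flip: powr_add)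
  finally show ?thesis .
qed

lemma nn_integral_lborel_affine:
  fixes x :: "'a::euclidean_space"
  assumes [measurable]: "F \<in> borel_measurable borel" and "c \<noteq> 0"
  shows "(\<integral>\<^sup>+y. F y \<partial>lborel) = ennreal (\<bar>c\<bar> ^ DIM('a)) * (\<integral>\<^sup>+h. F (x + c *\<^sub>R h) \<partial>lborel)"
  by (subst lborel_affine[OF assms(2), of x], simp add: nn_integral_density nn_integral_distr nn_integral_cmult)

text \<open>The substitution y = x + sqrt e h moves the parameter from the kernel into the argument
  of \<open>F\<close>. The kernel on the right does not depend on \<open>e\<close>, so the limit e
  -> 0 can be taken under the integral.\<close>

lemma nn_integral_heat_kernel_shift:
  fixes x :: "'a::euclidean_space"
  assumes [measurable]: "F \<in> borel_measurable borel" and "0 < e"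
  shows "(\<integral>\<^sup>+y. F y * ennreal (heat_kernel e (x - y)) \<partial>lborel) =
           (\<integral>\<^sup>+h. F (x + sqrt e *\<^sub>R h) * ennreal (heat_kernel 1 h) \<partial>lborel)"
proof -
  have "sqrt e ^ DIM('a) * heat_kernel e (- (sqrt e *\<^sub>R h)) = heat_kernel 1 h" for h :: 'a
  proof -
    have "sqrt e ^ DIM('a) = e powr (real DIM('a) / 2)"
      using assms by (simp add: powr_half_sqrt[symmetric] powr_powr flip: powr_realpow)
    moreover have "(2 * pi * e) powr (- (real DIM('a) / 2)) =
        (2 * pi) powr (- (real DIM('a) / 2)) * e powr (- (real DIM('a) / 2))"
      using assms by (simp add: powr_mult)
    moreover have "e powr (real DIM('a) / 2) * e powr (- (real DIM('a) / 2)) = 1"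
      using assms by (simp flip: powr_add)
    ultimately show ?thesis
      using assms by (simp add: heat_kernel_def power_mult_distrib mult_ac)
  qed
  then have *: "ennreal (sqrt e ^ DIM('a)) * ennreal (heat_kernel e (- (sqrt e *\<^sub>R h))) = ennreal (heat_kernel 1 h)" for h :: 'a
    using assms by (subst ennreal_mult[symmetric]) (auto simp: less_imp_le[OF heat_kernel_pos])
  have "(\<integral>\<^sup>+y. F y * ennreal (heat_kernel e (x - y)) \<partial>lborel) =
      ennreal (sqrt e ^ DIM('a)) * (\<integral>\<^sup>+h. F (x + sqrt e *\<^sub>R h) * ennreal (heat_kernel e (- (sqrt e *\<^sub>R h))) \<partial>lborel)"
    using assms by (subst nn_integral_lborel_affine[of _ "sqrt e" x]) auto
  also have "\<dots> = (\<integral>\<^sup>+h. ennreal (sqrt e ^ DIM('a)) * (F (x + sqrt e *\<^sub>R h) * ennreal (heat_kernel e (- (sqrt e *\<^sub>R h)))) \<partial>lborel)"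
    by (rule nn_integral_cmult[symmetric]) measurable
  also have "\<dots> = (\<integral>\<^sup>+h. F (x + sqrt e *\<^sub>R h) * ennreal (heat_kernel 1 h) \<partial>lborel)"
    unfolding *[symmetric] by (simp add: mult_ac)
  finally show ?thesis .
qed

lemma nn_integral_heat_kernel:
  assumes "0 < e"
  shows "(\<integral>\<^sup>+y. ennreal (heat_kernel e (x - y)) \<partial>lborel) = 1"
  using nn_integral_heat_kernel_shift[of "\<lambda>_. 1" e x] assms by (simp add: nn_integral_heat_kernel_1)

subsection \<open>The Fourier integral of integrable functions\<close>

text \<open>Defined pointwise, whereas \<open>fourier\<close> is a choice from an almost-everywhere
  class. Pointwise bounds are proved for this integral and carried over by
  \<open>fourier_eq_fourier_integral\<close>.\<close>

definition fourier_integral :: "(real ^ 'n \<Rightarrow> complex) \<Rightarrow> real ^ 'n \<Rightarrow> complex" where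
  "fourier_integral f \<xi> =
     ((2 * pi) powr (- (real CARD('n) / 2))) *\<^sub>R (LINT x|lborel. cis (- (x \<bullet> \<xi>)) * f x)"

lemma truncated_fourier_eq:
  "truncated_fourier R f = fourier_integral (\<lambda>x. indicator (cball 0 R) x *\<^sub>R f x)"
  by (simp add: fun_eq_iff truncated_fourier_def fourier_integral_def set_lebesgue_integral_def)

lemma integrable_phase:
  assumes "integrable lborel f" and [measurable]: "\<theta> \<in> borel_measurable borel"
  shows "integrable lborel (\<lambda>x. cis (\<theta> x) * f x :: complex)"
  by (rule Bochner_Integration.integrable_bound[OF assms(1)])
    (use borel_measurable_integrable[OF assms(1)] in \<open>auto simp: norm_mult cis_conv_exp\<close>)

lemma fourier_integral_measurable [measurable]:
  assumes "f \<in> borel_measurable borel"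
  shows "fourier_integral f \<in> borel_measurable borel"
proof -
  note [measurable] = assms
  show ?thesis unfolding fourier_integral_def[abs_def] cis_conv_exp by measurable
qed

lemma fourier_integral_diff:
  assumes "integrable lborel f" "integrable lborel g"
  shows "fourier_integral (\<lambda>x. f x - g x) \<xi> = fourier_integral f \<xi> - fourier_integral g \<xi>"
  by (simp add: fourier_integral_def right_diff_distrib scaleR_diff_right integrable_phase assms)

lemma fourier_integral_add:
  assumes "integrable lborel f" "integrable lborel g"
  shows "fourier_integral (\<lambda>x. f x + g x) \<xi> = fourier_integral f \<xi> + fourier_integral g \<xi>"
  by (simp add: fourier_integral_def distrib_left scaleR_add_right integrable_phase assms)

lemma fourier_integral_cmult: "fourier_integral (\<lambda>x. c * f x) \<xi> = c * fourier_integral f \<xi>"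
  by (simp add: fourier_integral_def mult.left_commute[of _ c])

lemma norm_fourier_integral_le:
  assumes "integrable lborel f"
  shows "norm (fourier_integral f \<xi>) \<le>
    ((2 * pi) powr (- (real CARD('n) / 2))) * (LINT x|lborel. norm (f (x :: real ^ 'n)))"
proof -
  have "norm (LINT x|lborel. cis (- (x \<bullet> \<xi>)) * f x) \<le> (LINT x|lborel. norm (cis (- (x \<bullet> \<xi>)) * f x))"
    by (rule integral_norm_bound)
  then show ?thesis by (simp add: fourier_integral_def norm_mult mult_left_mono)
qed

text \<open>The free phase map \<open>\<theta>\<close> lets one exchange serve twice: the identity
  gives the exchange formula for two transforms, and \<open>fst p - snd p\<close> gives the double
  integral for the damped energy.\<close>

lemma phase_Fubini:
  fixes F :: "'b::euclidean_space \<Rightarrow> complex" and g :: "'a::euclidean_space \<Rightarrow> complex"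
  assumes F: "integrable lborel F" and g: "integrable lborel g"
    and [measurable]: "\<theta> \<in> borel_measurable borel"
  shows "(LINT \<xi>|lborel. g \<xi> * (LINT p|lborel. cis (- (\<theta> p \<bullet> \<xi>)) * F p)) =
         (LINT p|lborel. F p * (LINT \<xi>|lborel. cis (- (\<theta> p \<bullet> \<xi>)) * g \<xi>))"
proof -
  have [measurable]: "F \<in> borel_measurable borel" "g \<in> borel_measurable borel"
    using F g by (auto dest: borel_measurable_integrable)
  have "integrable (lborel \<Otimes>\<^sub>M lborel) (\<lambda>(p, \<xi>). cis (- (\<theta> p \<bullet> \<xi>)) * (F p * g \<xi>))"
  proof (rule lborel_pair.Fubini_integrable)
    show "(\<lambda>(p, \<xi>). cis (- (\<theta> p \<bullet> \<xi>)) * (F p * g \<xi>)) \<in> borel_measurable (lborel \<Otimes>\<^sub>M lborel)"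
      unfolding cis_conv_exp by measurable
    show "integrable lborel (\<lambda>p. LINT \<xi>|lborel. norm (case (p, \<xi>) of (p, \<xi>) \<Rightarrow> cis (- (\<theta> p \<bullet> \<xi>)) * (F p * g \<xi>)))"
      using F g by (simp add: norm_mult)
    show "AE p in lborel. integrable lborel (\<lambda>\<xi>. case (p, \<xi>) of (p, \<xi>) \<Rightarrow> cis (- (\<theta> p \<bullet> \<xi>)) * (F p * g \<xi>))"
      using g by (auto intro!: AE_I2 integrable_phase)
  qed
  from lborel_pair.Fubini_integral[OF this] show ?thesis
    by (simp add: mult_ac flip: integral_mult_right_zero)
qed

lemma fourier_integral_exchange:
  assumes "integrable lborel f" "integrable lborel g"
  shows "(LINT \<xi>|lborel. fourier_integral f \<xi> * g \<xi>) = (LINT x|lborel. f x * fourier_integral g x)"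
  using phase_Fubini[OF assms, of "\<lambda>x. x"]
  by (simp add: fourier_integral_def mult_ac inner_commute)

lemma integrable_tensor:
  fixes f g :: "real ^ 'n \<Rightarrow> complex"
  assumes f: "integrable lborel f" and g: "integrable lborel g"
  shows "integrable lborel (\<lambda>p. f (fst p) * g (snd p))"
    and "(LINT p|lborel. f (fst p) * g (snd p)) = (LINT x|lborel. f x) * (LINT y|lborel. g y)"
proof -
  have [measurable]: "f \<in> borel_measurable borel" "g \<in> borel_measurable borel"
    using f g by (auto dest: borel_measurable_integrable)
  have *: "integrable (lborel \<Otimes>\<^sub>M lborel) (\<lambda>p. f (fst p) * g (snd p))"
  proof (rule lborel_pair.Fubini_integrable)
    show "integrable lborel (\<lambda>x. LINT y|lborel. norm (f (fst (x, y)) * g (snd (x, y))))"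
      using f by (simp add: norm_mult)
  qed (use g in auto)
  then show "integrable lborel (\<lambda>p. f (fst p) * g (snd p))" by (simp add: lborel_prod)
  show "(LINT p|lborel. f (fst p) * g (snd p)) = (LINT x|lborel. f x) * (LINT y|lborel. g y)"
    using lborel_pair.integral_fst'[OF *] by (simp add: lborel_prod)
qed

text \<open>Damping the Fourier side by a Gaussian turns its energy into a double integral against the heat
  kernel, where Fubini's theorem applies for every integrable function.\<close>

lemma gaussian_damped_energy:
  fixes f :: "real ^ 'n \<Rightarrow> complex"
  assumes f: "integrable lborel f" and e: "0 < e"
  shows "integrable lborel (\<lambda>\<xi>. exp (- (e/2) * (norm \<xi>)\<^sup>2) * (norm (fourier_integral f \<xi>))\<^sup>2)"
    and "complex_of_real (LINT \<xi>|lborel. exp (- (e/2) * (norm \<xi>)\<^sup>2) * (norm (fourier_integral f \<xi>))\<^sup>2) =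
      (LINT p|lborel. f (fst p) * cnj (f (snd p)) * complex_of_real (heat_kernel e (fst p - snd p)))"
proof -
  have [measurable]: "f \<in> borel_measurable borel"
    using f by (auto dest: borel_measurable_integrable)
  let ?n = "real CARD('n)"
  define c where "c = (2 * pi) powr (- (?n / 2))"
  define g where "g \<xi> = exp (- (e/2) * (norm \<xi>)\<^sup>2) *\<^sub>R cis 0" for \<xi> :: "real ^ 'n"
  have g: "integrable lborel g" unfolding g_def using gaussian_fourier(1)[OF e, of "0::real ^ 'n"] by simp
  have gr: "integrable lborel (\<lambda>\<xi>::real ^ 'n. exp (- (e/2) * (norm \<xi>)\<^sup>2))"
    using integrable_norm[OF g] by (simp add: g_def)
  define M where "M = c * (LINT x|lborel. norm (f x))"
  have M: "norm (fourier_integral f \<xi>) \<le> M" for \<xi>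
    using norm_fourier_integral_le[OF f] by (simp add: M_def c_def)
  show "integrable lborel (\<lambda>\<xi>. exp (- (e/2) * (norm \<xi>)\<^sup>2) * (norm (fourier_integral f \<xi>))\<^sup>2)"
    by (rule Bochner_Integration.integrable_bound[OF integrable_mult_left[OF gr, of "M\<^sup>2"]])
      (auto intro!: AE_I2 mult_left_mono power_mono M)
  define F where "F p = f (fst p) * cnj (f (snd p))" for p
  have F: "integrable lborel F" unfolding F_def using f by (intro integrable_tensor) auto
  \<comment> \<open>The squared modulus of one integral is an integral over pairs (x, y), in which
    the two phases combine into one depending on x - y only.\<close>
  have sq: "complex_of_real ((norm (fourier_integral f \<xi>))\<^sup>2) =
      c\<^sup>2 *\<^sub>R (LINT p|lborel. cis (- ((fst p - snd p) \<bullet> \<xi>)) * F p)" for \<xi>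
  proof -
    let ?a = "\<lambda>x. cis (- (x \<bullet> \<xi>)) * f x"
    have a: "integrable lborel ?a" using f by (intro integrable_phase) auto
    have "complex_of_real ((norm (fourier_integral f \<xi>))\<^sup>2) = fourier_integral f \<xi> * cnj (fourier_integral f \<xi>)"
      by (rule complex_norm_square)
    also have "\<dots> = c\<^sup>2 *\<^sub>R ((LINT x|lborel. ?a x) * (LINT y|lborel. cnj (?a y)))"
      unfolding fourier_integral_def c_def[symmetric] complex_cnj_scaleR
      by (simp only: mult_scaleR_left mult_scaleR_right scaleR_scaleR power2_eq_square Bochner_Integration.integral_cnj)
    also have "(LINT x|lborel. ?a x) * (LINT y|lborel. cnj (?a y)) = (LINT p|lborel. ?a (fst p) * cnj (?a (snd p)))"
      using a integrable_cnj[OF a] by (rule integrable_tensor(2)[symmetric])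
    also have "\<dots> = (LINT p|lborel. cis (- ((fst p - snd p) \<bullet> \<xi>)) * F p)"
    proof (intro Bochner_Integration.integral_cong refl)
      fix p :: "(real ^ 'n) \<times> (real ^ 'n)"
      have "cis (- ((fst p - snd p) \<bullet> \<xi>)) = cis (- (fst p \<bullet> \<xi>)) * cis (snd p \<bullet> \<xi>)"
        by (simp add: cis_mult inner_diff_left)
      then show "?a (fst p) * cnj (?a (snd p)) = cis (- ((fst p - snd p) \<bullet> \<xi>)) * F p"
        by (simp add: F_def cis_cnj mult_ac)
    qed
    finally show ?thesis .
  qed
  have G: "(LINT \<xi>|lborel. cis (- (z \<bullet> \<xi>)) * g \<xi>) =
      complex_of_real ((2 * pi / e) powr (?n / 2) * exp (- (norm z)\<^sup>2 / (2 * e)))" for z :: "real ^ 'n"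
    using gaussian_fourier(2)[OF e, of "- z"] by (simp add: g_def scaleR_conv_of_real mult_ac)
  \<comment> \<open>The two normalisations contribute (2 pi)^(-n) and the Gaussian integral (2 pi /
    e)^(n/2); their product is the normalisation (2 pi e)^(-n/2) of the heat kernel.\<close>
  have cc: "c\<^sup>2 * ((2 * pi / e) powr (?n / 2) * exp (- (norm z)\<^sup>2 / (2 * e))) = heat_kernel e z" for z :: "real ^ 'n"
  proof -
    have "c\<^sup>2 * (2 * pi / e) powr (?n / 2) = (2 * pi * e) powr (- (?n / 2))"
      using e unfolding c_def power2_eq_square
      by (simp add: powr_divide powr_mult powr_minus field_simps)
    then show ?thesis by (simp add: heat_kernel_def mult.assoc[symmetric])
  qed
  have "complex_of_real (LINT \<xi>|lborel. exp (- (e/2) * (norm \<xi>)\<^sup>2) * (norm (fourier_integral f \<xi>))\<^sup>2)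
      = (LINT \<xi>|lborel. complex_of_real (exp (- (e/2) * (norm \<xi>)\<^sup>2) * (norm (fourier_integral f \<xi>))\<^sup>2))"
    by (rule integral_complex_of_real[symmetric])
  also have "\<dots> = (LINT \<xi>|lborel. c\<^sup>2 *\<^sub>R (g \<xi> * (LINT p|lborel. cis (- ((fst p - snd p) \<bullet> \<xi>)) * F p)))"
    unfolding of_real_mult sq by (simp only: g_def scaleR_conv_of_real cis_zero mult_1_right mult.left_commute)
  also have "\<dots> = c\<^sup>2 *\<^sub>R (LINT p|lborel. F p * (LINT \<xi>|lborel. cis (- ((fst p - snd p) \<bullet> \<xi>)) * g \<xi>))"
    by (subst integral_scaleR_right, subst phase_Fubini[OF F g])
      (auto intro!: borel_measurable_continuous_onI continuous_intros)
  also have "\<dots> = (LINT p|lborel. F p * complex_of_real (c\<^sup>2 * ((2 * pi / e) powr (?n / 2) * exp (- (norm (fst p - snd p))\<^sup>2 / (2 * e)))))"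
    unfolding G integral_scaleR_right[symmetric] by (simp add: scaleR_conv_of_real mult_ac)
  finally show "complex_of_real (LINT \<xi>|lborel. exp (- (e/2) * (norm \<xi>)\<^sup>2) * (norm (fourier_integral f \<xi>))\<^sup>2) =
      (LINT p|lborel. f (fst p) * cnj (f (snd p)) * complex_of_real (heat_kernel e (fst p - snd p)))"
    unfolding cc F_def .
qed

subsection \<open>Plancherel's theorem\<close>

lemma Lp_norm_2_parallelogram:
  assumes "f \<in> Lp_space 2" "g \<in> Lp_space 2"
  shows "(Lp_norm 2 (\<lambda>x. f x + g x))\<^sup>2 + (Lp_norm 2 (\<lambda>x. f x - g x))\<^sup>2 =
    2 * (Lp_norm 2 f)\<^sup>2 + 2 * (Lp_norm 2 g)\<^sup>2"
  using Lp_norm_2_diff_power2[OF assms]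
    Lp_norm_2_diff_power2[OF assms(1) Lp_space_2_scaleR[OF assms(2), of "-1"]]
  by (simp only: L2_inner_scaleR_right Lp_norm_2_scaleR) simp

lemma heat_kernel_minus: "heat_kernel e (x - y) = heat_kernel e (y - x)"
  by (simp add: heat_kernel_def norm_minus_commute)

lemma heat_kernel_bound: "heat_kernel e z \<le> (2 * pi * e) powr (- (real DIM('a) / 2))"
  if "e > 0" for z :: "'a::euclidean_space"
  using that by (simp add: heat_kernel_def mult_left_le)

text \<open>Fatou's lemma along e = 1/(k+1): the damping factor tends to 1 pointwise, so a bound
  uniform in \<open>e\<close> survives in the limit.\<close>

lemma nn_integral_fourier_integral_le_damped:
  fixes f :: "real ^ 'n \<Rightarrow> complex"
  assumes f: "integrable lborel f"
    and le: "\<And>e. 0 < e \<Longrightarrow>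
      ennreal (LINT \<xi>|lborel. exp (- (e/2) * (norm \<xi>)\<^sup>2) * (norm (fourier_integral f \<xi>))\<^sup>2) \<le> B"
  shows "(\<integral>\<^sup>+\<xi>. ennreal ((norm (fourier_integral f \<xi>))\<^sup>2) \<partial>lborel) \<le> B"
proof -
  have [measurable]: "f \<in> borel_measurable borel"
    using f by (auto dest: borel_measurable_integrable)
  define e where "e k = inverse (real (Suc k))" for k
  have e: "0 < e k" "e \<longlonglongrightarrow> 0" for k
    using LIMSEQ_inverse_real_of_nat by (auto simp: e_def[abs_def])
  let ?h = "\<lambda>k \<xi>. exp (- (e k/2) * (norm \<xi>)\<^sup>2) * (norm (fourier_integral f \<xi>))\<^sup>2"
  have "(\<lambda>k. ennreal (?h k \<xi>)) \<longlonglongrightarrow> ennreal (exp (- (0/2) * (norm \<xi>)\<^sup>2) * (norm (fourier_integral f \<xi>))\<^sup>2)" for \<xi>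
    by (intro tendsto_intros e) simp
  from lim_imp_Liminf[OF _ this]
  have "(\<integral>\<^sup>+\<xi>. ennreal ((norm (fourier_integral f \<xi>))\<^sup>2) \<partial>lborel) =
      (\<integral>\<^sup>+\<xi>. liminf (\<lambda>k. ennreal (?h k \<xi>)) \<partial>lborel)" by simp
  also have "\<dots> \<le> liminf (\<lambda>k. \<integral>\<^sup>+\<xi>. ennreal (?h k \<xi>) \<partial>lborel)"
    by (rule nn_integral_liminf) auto
  also have "\<dots> \<le> liminf (\<lambda>k::nat. B)"
    using le[OF e(1)] gaussian_damped_energy(1)[OF f e(1)]
    by (intro Liminf_mono) (auto simp: nn_integral_eq_integral)
  finally show ?thesis by (simp add: Liminf_const)
qed

text \<open>Schur's test for the heat kernel: |f(x)| |f(y)| is at most half the sum of the squares,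
  and the kernel is symmetric with integral 1 in each variable. Each half contributes half of the
  energy of \<open>f\<close>, whatever \<open>e\<close> is.\<close>

lemma fourier_integral_contraction:
  fixes f :: "real ^ 'n \<Rightarrow> complex"
  assumes f: "integrable lborel f" and f2: "f \<in> Lp_space 2"
  shows "(\<integral>\<^sup>+\<xi>. ennreal ((norm (fourier_integral f \<xi>))\<^sup>2) \<partial>lborel) \<le> (\<integral>\<^sup>+x. ennreal ((norm (f x))\<^sup>2) \<partial>lborel)"
proof (rule nn_integral_fourier_integral_le_damped[OF f])
  fix e :: real assume e: "0 < e"
  have [measurable]: "f \<in> borel_measurable borel"
    using f by (auto dest: borel_measurable_integrable)
  let ?N = "\<integral>\<^sup>+x. ennreal ((norm (f x))\<^sup>2) \<partial>lborel"
  let ?W = "heat_kernel e :: real ^ 'n \<Rightarrow> real"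
  have W: "0 \<le> ?W z" for z using heat_kernel_pos[OF e] less_imp_le by blast
  let ?J = "\<lambda>p. f (fst p) * cnj (f (snd p)) * complex_of_real (?W (fst p - snd p))"
  have half: "(\<integral>\<^sup>+x. (\<integral>\<^sup>+y. ennreal ((norm (f x))\<^sup>2 / 2) * ennreal (?W (x - y)) \<partial>lborel) \<partial>lborel) = ?N / 2"
    by (simp add: nn_integral_cmult nn_integral_heat_kernel[OF e] ennreal_divide_numeral[symmetric]
      nn_integral_divide[symmetric])
  have J: "norm (?J p) = norm (f (fst p)) * norm (f (snd p)) * ?W (fst p - snd p)" for p
    using W by (simp add: norm_mult)
  have "ennreal (LINT \<xi>|lborel. exp (- (e/2) * (norm \<xi>)\<^sup>2) * (norm (fourier_integral f \<xi>))\<^sup>2) =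
      ennreal (norm (LINT p|lborel. ?J p))"
    unfolding gaussian_damped_energy(2)[OF f e, symmetric] norm_of_real
    by (simp add: abs_of_nonneg integral_nonneg)
  \<comment> \<open>If \<open>?J\<close> were not integrable, its Bochner integral would be 0 by
    convention and the inequality would hold trivially.\<close>
  also have "\<dots> \<le> (\<integral>\<^sup>+p. ennreal (norm (?J p)) \<partial>lborel)"
    by (cases "integrable lborel ?J") (auto intro: integral_norm_bound_ennreal simp: not_integrable_integral_eq)
  also have "\<dots> = (\<integral>\<^sup>+x. (\<integral>\<^sup>+y. ennreal (norm (?J (x, y))) \<partial>lborel) \<partial>lborel)"
    unfolding lborel_prod[symmetric] J by (rule lborel.nn_integral_fst[symmetric]) measurable
  also have "\<dots> \<le> (\<integral>\<^sup>+x. (\<integral>\<^sup>+y. ennreal ((norm (f x))\<^sup>2 / 2) * ennreal (?W (x - y)) +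
      ennreal ((norm (f y))\<^sup>2 / 2) * ennreal (?W (x - y)) \<partial>lborel) \<partial>lborel)"
  proof (intro nn_integral_mono)
    fix x y
    have "norm (?J (x, y)) = norm (f x) * norm (f y) * ?W (x - y)"
      using J[of "(x, y)"] by simp
    also have "\<dots> \<le> ((norm (f x))\<^sup>2 / 2 + (norm (f y))\<^sup>2 / 2) * ?W (x - y)"
      using W sum_squares_bound[of "norm (f x)" "norm (f y)"] by (intro mult_right_mono) auto
    finally show "ennreal (norm (?J (x, y))) \<le> ennreal ((norm (f x))\<^sup>2 / 2) * ennreal (?W (x - y)) +
      ennreal ((norm (f y))\<^sup>2 / 2) * ennreal (?W (x - y))"
      using W by (simp add: ennreal_mult'[symmetric] ennreal_plus[symmetric] distrib_right ennreal_leI del: ennreal_plus)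
  qed
  also have "\<dots> = ?N / 2 + (\<integral>\<^sup>+x. (\<integral>\<^sup>+y. ennreal ((norm (f y))\<^sup>2 / 2) * ennreal (?W (x - y)) \<partial>lborel) \<partial>lborel)"
    by (simp add: nn_integral_add half)
  also have "(\<integral>\<^sup>+x. (\<integral>\<^sup>+y. ennreal ((norm (f y))\<^sup>2 / 2) * ennreal (?W (x - y)) \<partial>lborel) \<partial>lborel) =
      (\<integral>\<^sup>+y. (\<integral>\<^sup>+x. ennreal ((norm (f y))\<^sup>2 / 2) * ennreal (?W (x - y)) \<partial>lborel) \<partial>lborel)"
    by (rule lborel_pair.Fubini') measurable
  also have "\<dots> = ?N / 2" unfolding half[symmetric] by (subst heat_kernel_minus) (rule refl)
  also have "?N / 2 + ?N / 2 = ?N * 2 / 2"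
    by (simp add: add_divide_distrib_ennreal mult_2_right)
  also have "\<dots> = ?N" by (rule mult_divide_eq_ennreal) auto
  finally show "ennreal (LINT \<xi>|lborel. exp (- (e/2) * (norm \<xi>)\<^sup>2) * (norm (fourier_integral f \<xi>))\<^sup>2) \<le> ?N" .
qed

lemma integrable_indicator_complex:
  fixes A :: "(real ^ 'n) set"
  assumes "A \<in> sets borel" "emeasure lborel A < \<infinity>"
  shows "integrable lborel (\<lambda>x. indicator A x :: complex)" "(\<lambda>x. indicator A x :: complex) \<in> Lp_space 2"
    "(Lp_norm 2 (\<lambda>x. indicator A x))\<^sup>2 = measure lborel A"
proof -
  have *: "(norm (indicator A x :: complex))\<^sup>2 = indicator A x" for x by (simp add: indicator_def)
  show "integrable lborel (\<lambda>x. indicator A x :: complex)"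
    using integrable_real_indicator[of A lborel, THEN integrable_of_real[where 'a=complex]] assms
    by (simp add: of_real_indicator)
  show "(\<lambda>x. indicator A x :: complex) \<in> Lp_space 2" "(Lp_norm 2 (\<lambda>x. indicator A x))\<^sup>2 = measure lborel A"
    using assms unfolding Lp_space_2_iff Lp_norm_2_power2 * by auto
qed

text \<open>For an open set the heat flow of its indicator converges back to 1 on the set itself, so Fatou's
  lemma yields the reverse inequality without any continuity of translations.\<close>

lemma fourier_integral_indicator_open:
  fixes U :: "(real ^ 'n) set"
  assumes U: "open U" "emeasure lborel U < \<infinity>"
  shows "emeasure lborel U \<le> (\<integral>\<^sup>+\<xi>. ennreal ((norm (fourier_integral (\<lambda>x. indicator U x) \<xi>))\<^sup>2) \<partial>lborel)"
    (is "_ \<le> ?R")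
proof -
  have [measurable]: "U \<in> sets borel" using U by simp
  let ?f = "\<lambda>x. indicator U x :: complex"
  have f: "integrable lborel ?f" by (rule integrable_indicator_complex) (use U in auto)
  have damped: "(\<integral>\<^sup>+x. indicator U x * (\<integral>\<^sup>+h. indicator U (x + sqrt e *\<^sub>R h) * ennreal (heat_kernel 1 h) \<partial>lborel) \<partial>lborel) \<le> ?R"
    if e: "e > 0" for e
  proof -
    let ?W = "heat_kernel e :: real ^ 'n \<Rightarrow> real"
    have W: "0 \<le> ?W z" for z using heat_kernel_pos[OF e] less_imp_le by blast
    let ?I = "\<lambda>p. indicator U (fst p) * indicator U (snd p) * ?W (fst p - snd p) :: real"
    have tens: "integrable lborel (\<lambda>p. indicator U (fst p) * indicator U (snd p) :: complex)"
      by (rule integrable_tensor(1)[OF f f])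
    have I: "integrable lborel ?I"
    proof (rule Bochner_Integration.integrable_bound[OF integrable_mult_left[OF tens,
            of "complex_of_real ((2 * pi * e) powr (- (real DIM(real ^ 'n) / 2)))"]])
      show "AE p in lborel. norm (?I p) \<le> norm (indicator U (fst p) * indicator U (snd p) *
          complex_of_real ((2 * pi * e) powr (- (real DIM(real ^ 'n) / 2))))"
        using heat_kernel_bound[OF e] W by (auto simp: norm_mult indicator_def split: if_splits simp del: DIM_cart)
    qed (simp flip: lborel_prod)
    have "(\<integral>\<^sup>+x. indicator U x * (\<integral>\<^sup>+h. indicator U (x + sqrt e *\<^sub>R h) * ennreal (heat_kernel 1 h) \<partial>lborel) \<partial>lborel) =
        (\<integral>\<^sup>+x. (\<integral>\<^sup>+y. indicator U x * (indicator U y * ennreal (?W (x - y))) \<partial>lborel) \<partial>lborel)"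
      by (simp add: nn_integral_cmult nn_integral_heat_kernel_shift[OF _ e])
    also have "\<dots> = (\<integral>\<^sup>+x. (\<integral>\<^sup>+y. ennreal (?I (x, y)) \<partial>lborel) \<partial>lborel)"
      by (intro nn_integral_cong) (auto simp: indicator_def)
    also have "\<dots> = (\<integral>\<^sup>+p. ennreal (?I p) \<partial>lborel)"
      unfolding lborel_prod[symmetric] by (rule lborel.nn_integral_fst) measurable
    also have "\<dots> = ennreal (LINT p|lborel. ?I p)"
      by (rule nn_integral_eq_integral[OF I]) (simp add: W)
    also have "(LINT p|lborel. ?I p) = (LINT \<xi>|lborel. exp (- (e/2) * (norm \<xi>)\<^sup>2) * (norm (fourier_integral ?f \<xi>))\<^sup>2)"
    proof -
      have "complex_of_real (LINT p|lborel. ?I p) = (LINT p|lborel. complex_of_real (?I p))"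
        by (rule integral_complex_of_real[symmetric])
      also have "\<dots> = complex_of_real (LINT \<xi>|lborel. exp (- (e/2) * (norm \<xi>)\<^sup>2) * (norm (fourier_integral ?f \<xi>))\<^sup>2)"
        unfolding gaussian_damped_energy(2)[OF f e]
        by (intro Bochner_Integration.integral_cong refl) (simp add: indicator_def)
      finally show ?thesis using of_real_eq_iff by blast
    qed
    also have "ennreal \<dots> = (\<integral>\<^sup>+\<xi>. ennreal (exp (- (e/2) * (norm \<xi>)\<^sup>2) * (norm (fourier_integral ?f \<xi>))\<^sup>2) \<partial>lborel)"
      by (rule nn_integral_eq_integral[symmetric, OF gaussian_damped_energy(1)[OF f e]]) simp
    also have "\<dots> \<le> ?R"
      using e by (intro nn_integral_mono ennreal_leI mult_left_le_one_le) auto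
    finally show ?thesis .
  qed
  define e where "e k = inverse (real (Suc k))" for k
  have e: "0 < e k" "e \<longlonglongrightarrow> 0" for k
    using LIMSEQ_inverse_real_of_nat by (auto simp: e_def[abs_def])
  have inner: "1 \<le> liminf (\<lambda>k. \<integral>\<^sup>+h. indicator U (x + sqrt (e k) *\<^sub>R h) * ennreal (heat_kernel 1 h) \<partial>lborel)"
    if "x \<in> U" for x
  proof -
    \<comment> \<open>For each fixed \<open>h\<close> the point x + sqrt (e k) h eventually lies in
      the open set \<open>U\<close>, so the limit inferior of the integrand is the full kernel, of
      mass 1.\<close>
    have "1 = (\<integral>\<^sup>+h. liminf (\<lambda>k. indicator U (x + sqrt (e k) *\<^sub>R h) * ennreal (heat_kernel 1 h)) \<partial>lborel)"
      unfolding nn_integral_heat_kernel_1[where 'a="real ^ 'n", symmetric]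
    proof (intro nn_integral_cong)
      fix h :: "real ^ 'n"
      have "(\<lambda>k. x + sqrt (e k) *\<^sub>R h) \<longlonglongrightarrow> x + sqrt 0 *\<^sub>R h" by (intro tendsto_intros e)
      then have "\<forall>\<^sub>F k in sequentially. x + sqrt (e k) *\<^sub>R h \<in> U"
        using U that by (intro topological_tendstoD) auto
      then have "(\<lambda>k. indicator U (x + sqrt (e k) *\<^sub>R h) * ennreal (heat_kernel 1 h)) \<longlonglongrightarrow> ennreal (heat_kernel 1 h)"
        by (intro tendsto_eventually) (auto elim: eventually_mono)
      from lim_imp_Liminf[OF _ this]
      show "ennreal (heat_kernel 1 h) = liminf (\<lambda>k. indicator U (x + sqrt (e k) *\<^sub>R h) * ennreal (heat_kernel 1 h))"
        by simp
    qed
    also have "\<dots> \<le> liminf (\<lambda>k. \<integral>\<^sup>+h. indicator U (x + sqrt (e k) *\<^sub>R h) * ennreal (heat_kernel 1 h) \<partial>lborel)"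
      by (rule nn_integral_liminf) measurable
    finally show ?thesis .
  qed
  have "emeasure lborel U = (\<integral>\<^sup>+x. indicator U x \<partial>lborel)" by simp
  also have "\<dots> \<le> (\<integral>\<^sup>+x. liminf (\<lambda>k. indicator U x *
      (\<integral>\<^sup>+h. indicator U (x + sqrt (e k) *\<^sub>R h) * ennreal (heat_kernel 1 h) \<partial>lborel)) \<partial>lborel)"
    using inner by (intro nn_integral_mono) (simp add: indicator_def)
  also have "\<dots> \<le> liminf (\<lambda>k. \<integral>\<^sup>+x. indicator U x *
      (\<integral>\<^sup>+h. indicator U (x + sqrt (e k) *\<^sub>R h) * ennreal (heat_kernel 1 h) \<partial>lborel) \<partial>lborel)"
    by (rule nn_integral_liminf) measurable
  also have "\<dots> \<le> liminf (\<lambda>k::nat. ?R)"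
    by (intro Liminf_mono always_eventually allI damped e)
  finally show ?thesis by (simp add: Liminf_const)
qed

text \<open>The defect is a nonnegative quadratic form, so its null vectors form a subspace.\<close>

definition plancherel_defect :: "(real ^ 'n \<Rightarrow> complex) \<Rightarrow> real" where
  "plancherel_defect f = (Lp_norm 2 f)\<^sup>2 - (Lp_norm 2 (fourier_integral f))\<^sup>2"

context
  fixes f :: "real ^ 'n \<Rightarrow> complex"
  assumes f: "integrable lborel f" "f \<in> Lp_space 2"
begin

lemma fourier_integral_Lp_space: "fourier_integral f \<in> Lp_space 2"
  using fourier_integral_contraction[OF f] f(2) order_le_less_trans
  unfolding Lp_space_2_iff_nn_integral by auto

lemma plancherel_defect_nonneg: "0 \<le> plancherel_defect f"
  using fourier_integral_contraction[OF f]
  by (simp add: plancherel_defect_def ennreal_Lp_norm_2_power2[symmetric] f fourier_integral_Lp_space)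

lemma plancherel_defect_le: "plancherel_defect f \<le> (Lp_norm 2 f)\<^sup>2"
  by (simp add: plancherel_defect_def)

end

lemma plancherel_defect_add_diff:
  assumes f: "integrable lborel f" "f \<in> Lp_space 2" and g: "integrable lborel g" "g \<in> Lp_space 2"
  shows "plancherel_defect (\<lambda>x. f x + g x) + plancherel_defect (\<lambda>x. f x - g x) =
    2 * plancherel_defect f + 2 * plancherel_defect g"
proof -
  have "fourier_integral (\<lambda>x. f x + g x) = (\<lambda>\<xi>. fourier_integral f \<xi> + fourier_integral g \<xi>)"
    "fourier_integral (\<lambda>x. f x - g x) = (\<lambda>\<xi>. fourier_integral f \<xi> - fourier_integral g \<xi>)"
    using f g by (auto simp: fourier_integral_add fourier_integral_diff)
  then show ?thesis
    using Lp_norm_2_parallelogram[OF f(2) g(2)]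
      Lp_norm_2_parallelogram[OF fourier_integral_Lp_space[OF f] fourier_integral_Lp_space[OF g]]
    by (simp add: plancherel_defect_def)
qed

text \<open>The parallelogram identity with one nonnegative term dropped. Together with
  \<open>plancherel_defect_le\<close> it also shows that a limit in L^2 of functions without defect
  has no defect.\<close>

lemma plancherel_defect_add_le:
  assumes f: "integrable lborel f" "f \<in> Lp_space 2" and g: "integrable lborel g" "g \<in> Lp_space 2"
  shows "plancherel_defect (\<lambda>x. f x + g x) \<le> 2 * plancherel_defect f + 2 * plancherel_defect g"
    and "plancherel_defect (\<lambda>x. f x - g x) \<le> 2 * plancherel_defect f + 2 * plancherel_defect g"
  using plancherel_defect_add_diff[OF assms]
    plancherel_defect_nonneg[of "\<lambda>x. f x + g x"] plancherel_defect_nonneg[of "\<lambda>x. f x - g x"]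
    Lp_space_2_add[OF f(2) g(2)] Lp_space_2_diff[OF f(2) g(2)] f g
  by auto

lemma plancherel_defect_cmult: "plancherel_defect (\<lambda>x. c * f x) = (norm c)\<^sup>2 * plancherel_defect f"
proof -
  have "fourier_integral (\<lambda>x. c * f x) = (\<lambda>\<xi>. c * fourier_integral f \<xi>)"
    by (simp add: fun_eq_iff fourier_integral_cmult)
  then show ?thesis
    by (simp add: plancherel_defect_def Lp_norm_2_power2 norm_mult power_mult_distrib right_diff_distrib)
qed

text \<open>Outer regularity reduces to open sets: \<open>E\<close> is an open \<open>U\<close>
  minus a set of small measure. \<open>U\<close> has no defect, and the defect of the small set is
  at most its measure.\<close>

lemma plancherel_defect_indicator:
  fixes E :: "(real ^ 'n) set"
  assumes E: "E \<in> sets borel" "emeasure lborel E < \<infinity>"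
  shows "plancherel_defect (\<lambda>x. indicator E x) = 0"
proof (rule antisym)
  show "plancherel_defect (\<lambda>x. indicator E x) \<le> 0"
  proof (rule field_le_epsilon)
    fix e :: real assume "e > 0"
    \<comment> \<open>The tolerance \<open>e/2\<close> compensates the factor 2 in
      \<open>plancherel_defect_add_le\<close>.\<close>
    then obtain U where U: "open U" "E \<subseteq> U" "emeasure lborel (U - E) \<le> ennreal (e/2)"
      using outer_regular_lborel_le[OF E(1), of "e/2"] by auto
    have [measurable]: "U \<in> sets borel" using U by simp
    have "emeasure lborel U = emeasure lborel E + emeasure lborel (U - E)"
      using U E by (subst plus_emeasure) (auto simp: Un_absorb1)
    also have "\<dots> < \<infinity>" using E(2) U(3) by (auto simp: less_top[symmetric] top_unique)
    finally have Ufin: "emeasure lborel U < \<infinity>" .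
    have D: "emeasure lborel (U - E) < \<infinity>" using U(3) by (auto simp: less_top[symmetric] top_unique)
    note iU = integrable_indicator_complex[OF _ Ufin, simplified] and iD = integrable_indicator_complex[OF _ D]
    have 0: "plancherel_defect (\<lambda>x. indicator U x) \<le> 0"
    proof -
      have "ennreal ((Lp_norm 2 (\<lambda>x. indicator U x :: complex))\<^sup>2) \<le>
          ennreal ((Lp_norm 2 (fourier_integral (\<lambda>x. indicator U x)))\<^sup>2)"
        using fourier_integral_indicator_open[OF U(1) Ufin]
        by (simp only: iU ennreal_Lp_norm_2_power2[OF fourier_integral_Lp_space[OF iU(1,2)]]
          emeasure_eq_ennreal_measure[OF Ufin[THEN less_imp_neq, unfolded infinity_ennreal_def]])
      then show ?thesis by (simp add: plancherel_defect_def)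
    qed
    have "(\<lambda>x. indicator E x :: complex) = (\<lambda>x. indicator U x - indicator (U - E) x)"
      using U by (auto simp: indicator_def fun_eq_iff)
    then have "plancherel_defect (\<lambda>x. indicator E x) \<le>
        2 * plancherel_defect (\<lambda>x. indicator U x) + 2 * plancherel_defect (\<lambda>x. indicator (U - E) x)"
      using plancherel_defect_add_le(2)[OF iU(1,2) iD(1,2)] E by simp
    also have "\<dots> \<le> 2 * measure lborel (U - E)"
      using 0 plancherel_defect_le[OF iD(1,2)] E by (simp add: iD(3))
    also have "\<dots> \<le> e"
      using U(3) \<open>e > 0\<close>
      unfolding emeasure_eq_ennreal_measure[OF D[THEN less_imp_neq, unfolded infinity_ennreal_def]] by simp
    finally show "plancherel_defect (\<lambda>x. indicator E x) \<le> 0 + e" by simp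
  qed
qed (intro plancherel_defect_nonneg integrable_indicator_complex assms)

lemma plancherel_defect_sum:
  fixes c :: "'b \<Rightarrow> complex"
  assumes "finite I" "\<And>i. i \<in> I \<Longrightarrow> A i \<in> sets borel \<and> emeasure lborel (A i :: (real ^ 'n) set) < \<infinity>"
  shows "integrable lborel (\<lambda>x. \<Sum>i\<in>I. c i * indicator (A i) x) \<and>
    (\<lambda>x. \<Sum>i\<in>I. c i * indicator (A i) x) \<in> Lp_space 2 \<and>
    plancherel_defect (\<lambda>x. \<Sum>i\<in>I. c i * indicator (A i) x) = 0"
  using assms
proof (induction I rule: finite_induct)
  case empty
  then show ?case
    using plancherel_defect_cmult[of 0 "\<lambda>_. 0"] by (simp add: Lp_space_2_iff)
next
  case (insert i I)
  let ?s = "\<lambda>x. \<Sum>i\<in>I. c i * indicator (A i) x" and ?a = "\<lambda>x. c i * indicator (A i) x :: complex"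
  have A: "A i \<in> sets borel" "emeasure lborel (A i) < \<infinity>" using insert.prems by auto
  note ind = integrable_indicator_complex[OF A]
  have a: "integrable lborel ?a" "?a \<in> Lp_space 2" "plancherel_defect ?a = 0"
    using ind by (auto simp: plancherel_defect_cmult plancherel_defect_indicator[OF A] Lp_space_2_iff norm_mult power_mult_distrib)
  have s: "integrable lborel ?s" "?s \<in> Lp_space 2" "plancherel_defect ?s = 0"
    using insert by auto
  have "plancherel_defect (\<lambda>x. ?a x + ?s x) = 0"
    using plancherel_defect_add_le(1)[OF a(1,2) s(1,2)] a s
      plancherel_defect_nonneg[of "\<lambda>x. ?a x + ?s x"] Lp_space_2_add[OF a(2) s(2)] by simp
  moreover have "(\<lambda>x. \<Sum>i\<in>insert i I. c i * indicator (A i) x) = (\<lambda>x. ?a x + ?s x)"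
    using insert.hyps by (simp only: sum.insert not_False_eq_True)
  ultimately show ?case using a s Lp_space_2_add[OF a(2) s(2)]
    by (simp only: Bochner_Integration.integrable_add simp_thms)
qed

lemma Lp_space_2_approx_zero:
  fixes s :: "nat \<Rightarrow> real ^ 'n \<Rightarrow> complex"
  assumes f: "f \<in> Lp_space 2" and [measurable]: "\<And>i. s i \<in> borel_measurable borel"
    and lim: "\<And>x. (\<lambda>i. s i x) \<longlonglongrightarrow> f x" and le: "\<And>i x. norm (s i x) \<le> 2 * norm (f x)"
  shows "(\<lambda>i. Lp_norm 2 (\<lambda>x. f x - s i x)) \<longlonglongrightarrow> 0"
proof -
  have [measurable]: "f \<in> borel_measurable borel" using f by (simp add: Lp_space_def)
  have "(\<lambda>i. LINT x|lborel. (norm (f x - s i x))\<^sup>2) \<longlonglongrightarrow> (LINT x|(lborel::(real ^ 'n) measure). 0)"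
  proof (rule integral_dominated_convergence)
    show "integrable lborel (\<lambda>x. 9 * (norm (f x))\<^sup>2)" using f by (simp add: Lp_space_2_iff)
    have "(norm (f x - s i x))\<^sup>2 \<le> (3 * norm (f x))\<^sup>2" for x i
      using norm_triangle_ineq4[of "f x" "s i x"] le[of i x] by (intro power_mono) auto
    then show "AE x in lborel. norm ((norm (f x - s i x))\<^sup>2) \<le> 9 * (norm (f x))\<^sup>2" for i
      by (simp add: power_mult_distrib)
    have "(\<lambda>i. (norm (f x - s i x))\<^sup>2) \<longlonglongrightarrow> (norm (f x - f x))\<^sup>2" for x
      by (intro tendsto_intros lim)
    then show "AE x in lborel. (\<lambda>i. (norm (f x - s i x))\<^sup>2) \<longlonglongrightarrow> 0" by simp
  qed auto
  then have "(\<lambda>i. sqrt (LINT x|lborel. (norm (f x - s i x))\<^sup>2)) \<longlonglongrightarrow> sqrt 0"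
    by (intro tendsto_intros) simp
  then show ?thesis by (simp add: Lp_norm_2_eq)
qed

text \<open>Simple functions whose nonzero level sets have finite measure have no defect, and the
  defect of \<open>f\<close> is at most twice the squared distance to such an approximation.\<close>

lemma plancherel_L1_L2:
  assumes f: "integrable lborel f" "f \<in> Lp_space 2"
  shows "Lp_norm 2 (fourier_integral f) = Lp_norm 2 f"
proof -
  have [measurable]: "f \<in> borel_measurable borel" using f by (simp add: Lp_space_def)
  obtain s where s: "\<And>i. simple_function borel (s i)" "\<And>x. (\<lambda>i. s i x) \<longlonglongrightarrow> f x"
      "\<And>i x. norm (s i x) \<le> 2 * norm (f x)"
    using borel_measurable_implies_sequence_metric[of f borel 0] by auto
  have [measurable]: "s i \<in> borel_measurable borel" for i using s(1) by (rule borel_measurable_simple_function)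
  have si: "integrable lborel (s i)" for i
    by (rule Bochner_Integration.integrable_bound[OF integrable_mult_right[OF integrable_norm[OF f(1)], of 2]]) (use s(3) in auto)
  have s2: "s i \<in> Lp_space 2" for i
    by (rule Lp_space_2_bound(1)[OF Lp_space_2_scaleR[OF f(2), of 2]]) (use s(3) in auto)
  have s0: "plancherel_defect (s i) = 0" for i
  proof -
    \<comment> \<open>The value 0 is left out, since its level set may have infinite
      measure.\<close>
    let ?Y = "range (s i) - {0}"
    have fin: "finite (range (s i))" using s(1)[of i] by (simp add: simple_function_def)
    have "(\<Sum>y\<in>?Y. y * indicator (s i -` {y}) x) = s i x" for x
    proof -
      have "(\<Sum>y\<in>?Y. y * indicator (s i -` {y}) x) = (\<Sum>y\<in>?Y. if y = s i x then y else 0)"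
        by (intro sum.cong) (auto simp: indicator_def)
      also have "\<dots> = s i x" using fin by (simp add: sum.delta)
      finally show ?thesis .
    qed
    then have eq: "(\<lambda>x. \<Sum>y\<in>?Y. y * indicator (s i -` {y}) x) = s i" by (simp add: fun_eq_iff)
    have "s i -` {y} \<in> sets borel \<and> emeasure lborel (s i -` {y}) < \<infinity>" if "y \<in> ?Y" for y
    proof
      show *: "s i -` {y} \<in> sets borel" using measurable_sets[of "s i" borel borel "{y}"] by simp
      \<comment> \<open>Chebyshev's argument: on the level set the integrable function
        \<open>s i\<close> has the constant modulus \<open>norm y\<close>, which is
        positive.\<close>
      have "integrable lborel (\<lambda>x. indicator (s i -` {y}) x :: real)"
      proof (rule Bochner_Integration.integrable_bound[OF integrable_mult_right[OF integrable_norm[OF si[of i]], of "1 / norm y"]])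
        show "AE x in lborel. norm (indicator (s i -` {y}) x :: real) \<le> norm (1 / norm y * norm (s i x))"
          using that by (auto simp: indicator_def)
      qed (use * in measurable)
      then show "emeasure lborel (s i -` {y}) < \<infinity>"
        using * by (simp add: integrable_indicator_iff)
    qed
    then show ?thesis using plancherel_defect_sum[of ?Y "\<lambda>y. s i -` {y}" "\<lambda>y. y"] fin unfolding eq by simp
  qed
  have "plancherel_defect f \<le> 2 * (Lp_norm 2 (\<lambda>x. f x - s i x))\<^sup>2" for i
    using plancherel_defect_add_le(1)[OF si[of i] s2[of i], of "\<lambda>x. f x - s i x"]
      plancherel_defect_le[of "\<lambda>x. f x - s i x"] f si s2 s0 Lp_space_2_diff[OF f(2) s2[of i]] by simp
  then have le: "\<forall>i\<ge>0. plancherel_defect f \<le> 2 * (Lp_norm 2 (\<lambda>x. f x - s i x))\<^sup>2" by blast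
  have "(\<lambda>i. 2 * (Lp_norm 2 (\<lambda>x. f x - s i x))\<^sup>2) \<longlonglongrightarrow> 2 * 0\<^sup>2"
    by (intro tendsto_intros Lp_space_2_approx_zero f s) measurable
  then have "plancherel_defect f \<le> 2 * 0\<^sup>2"
    using le by (intro LIMSEQ_le_const exI)
  then have "(Lp_norm 2 f)\<^sup>2 = (Lp_norm 2 (fourier_integral f))\<^sup>2"
    using plancherel_defect_nonneg[OF f] by (simp add: plancherel_defect_def)
  then show ?thesis by simp
qed

subsection \<open>The Fourier transform on square-integrable functions\<close>

abbreviation ball_cutoff :: "real \<Rightarrow> (real ^ 'n \<Rightarrow> complex) \<Rightarrow> real ^ 'n \<Rightarrow> complex" where
  "ball_cutoff R f x \<equiv> indicator (cball 0 R) x *\<^sub>R f x"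

lemma integrable_L2_finite_measure:
  assumes f: "f \<in> Lp_space 2" and A: "A \<in> sets borel" "emeasure lborel A < \<infinity>"
  shows "integrable lborel (\<lambda>x. indicator A x *\<^sub>R f x)" "(\<lambda>x. indicator A x *\<^sub>R f x) \<in> Lp_space 2"
proof -
  have [measurable]: "f \<in> borel_measurable borel" "A \<in> sets borel" using f A by (auto simp: Lp_space_def)
  have "integrable lborel (\<lambda>x. indicator A x + (norm (f x))\<^sup>2 :: real)"
    using f A by (auto simp: Lp_space_2_iff)
  then show "integrable lborel (\<lambda>x. indicator A x *\<^sub>R f x)"
  proof (rule Bochner_Integration.integrable_bound)
    have "norm (f x) \<le> 1 + (norm (f x))\<^sup>2" for x
      using sum_squares_bound[of "norm (f x)" 1] by simp (smt (verit) norm_ge_zero)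
    then show "AE x in lborel. norm (indicator A x *\<^sub>R f x) \<le> norm (indicator A x + (norm (f x))\<^sup>2)"
      by (auto simp: indicator_def)
  qed measurable
  show "(\<lambda>x. indicator A x *\<^sub>R f x) \<in> Lp_space 2"
    by (rule Lp_space_2_bound(1)[OF f]) (auto simp: indicator_def)
qed

lemma ball_cutoff_spaces:
  assumes "f \<in> Lp_space 2"
  shows "integrable lborel (ball_cutoff R f)" "ball_cutoff R f \<in> Lp_space 2"
  using integrable_L2_finite_measure[OF assms, of "cball 0 R"] emeasure_bounded_finite[of "cball 0 R"]
  by auto

lemma L2_tendsto_ball_cutoff:
  fixes f :: "real ^ 'n \<Rightarrow> complex"
  assumes f: "f \<in> Lp_space 2"
  shows "L2_tendsto (\<lambda>R. ball_cutoff R f) f at_top"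
proof -
  have [measurable]: "f \<in> borel_measurable borel" "cball 0 R \<in> sets (borel :: (real ^ 'n) measure)" for R
    using f by (simp_all add: Lp_space_def)
  have "((\<lambda>R. LINT x|lborel. (norm (ball_cutoff R f x - f x))\<^sup>2) \<longlongrightarrow> (LINT x|(lborel::(real ^ 'n) measure). 0)) at_top"
  proof (rule integral_dominated_convergence_at_top)
    show "integrable lborel (\<lambda>x. (norm (f x))\<^sup>2)" using f by (simp add: Lp_space_2_iff)
    show "\<forall>\<^sub>F R in at_top. AE x in lborel. norm ((norm (ball_cutoff R f x - f x))\<^sup>2) \<le> (norm (f x))\<^sup>2"
      by (auto simp: indicator_def intro!: always_eventually)
    have "((\<lambda>R. (norm (ball_cutoff R f x - f x))\<^sup>2) \<longlongrightarrow> 0) at_top" for x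
    proof (rule tendsto_eventually)
      show "\<forall>\<^sub>F R in at_top. (norm (ball_cutoff R f x - f x))\<^sup>2 = 0"
        using eventually_ge_at_top[of "norm x"] by eventually_elim (simp add: indicator_def)
    qed
    then show "AE x in lborel. ((\<lambda>R. (norm (ball_cutoff R f x - f x))\<^sup>2) \<longlongrightarrow> 0) at_top" by simp
  qed measurable
  then have "((\<lambda>R. sqrt (LINT x|lborel. (norm (ball_cutoff R f x - f x))\<^sup>2)) \<longlongrightarrow> sqrt 0) at_top"
    by (intro tendsto_intros) simp
  then show ?thesis
    unfolding L2_tendsto_def Lp_norm_2_eq
    by (auto intro!: always_eventually Lp_space_2_diff ball_cutoff_spaces f)
qed

lemma fourier_integral_L2_diff:
  assumes f: "integrable lborel f" "f \<in> Lp_space 2" and g: "integrable lborel g" "g \<in> Lp_space 2"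
  shows "Lp_norm 2 (\<lambda>\<xi>. fourier_integral f \<xi> - fourier_integral g \<xi>) = Lp_norm 2 (\<lambda>x. f x - g x)"
proof -
  have "fourier_integral (\<lambda>x. f x - g x) = (\<lambda>\<xi>. fourier_integral f \<xi> - fourier_integral g \<xi>)"
    using f g by (simp add: fun_eq_iff fourier_integral_diff)
  then show ?thesis using plancherel_L1_L2[of "\<lambda>x. f x - g x"] f g by (simp add: Lp_space_2_diff)
qed

text \<open>By Plancherel for integrable functions the distance of two truncated transforms is the
  distance of the two cutoffs, and the cutoffs converge to \<open>f\<close> in L^2.\<close>

lemma fourier_exists:
  fixes f :: "real ^ 'n \<Rightarrow> complex"
  assumes f: "f \<in> Lp_space 2"
  shows "\<exists>g \<in> Lp_space 2. L2_tendsto (\<lambda>R. truncated_fourier R f) g at_top"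
proof (rule L2_complete)
  note cut = ball_cutoff_spaces[OF f]
  show "truncated_fourier R f \<in> Lp_space 2" for R
    unfolding truncated_fourier_eq by (intro fourier_integral_Lp_space cut)
  fix e :: real assume "0 < e"
  then have "\<forall>\<^sub>F R in at_top. Lp_norm 2 (\<lambda>x. ball_cutoff R f x - f x) < e/2"
    using L2_tendsto_ball_cutoff[OF f] by (intro order_tendstoD(2)) (auto simp: L2_tendsto_def)
  then obtain K where K: "\<And>R. K \<le> R \<Longrightarrow> Lp_norm 2 (\<lambda>x. ball_cutoff R f x - f x) < e/2"
    by (auto simp: eventually_at_top_linorder)
  show "\<exists>K. \<forall>R\<ge>K. \<forall>S\<ge>K. Lp_norm 2 (\<lambda>\<xi>. truncated_fourier R f \<xi> - truncated_fourier S f \<xi>) \<le> e"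
  proof (intro exI allI impI)
    fix R S assume "K \<le> R" "K \<le> S"
    then show "Lp_norm 2 (\<lambda>\<xi>. truncated_fourier R f \<xi> - truncated_fourier S f \<xi>) \<le> e"
      using Lp_norm_2_triangle[OF cut(2)[of R] f cut(2)[of S]] K[of R] K[of S]
      unfolding truncated_fourier_eq fourier_integral_L2_diff[OF cut[of R] cut[of S]]
      by (simp add: Lp_norm_2_diff_commute[of f])
  qed
qed

lemma fourier_Lp_space: "f \<in> Lp_space 2 \<Longrightarrow> fourier f \<in> Lp_space 2"
  and fourier_tendsto: "f \<in> Lp_space 2 \<Longrightarrow> L2_tendsto (\<lambda>R. truncated_fourier R f) (fourier f) at_top"
  using someI_ex[of "\<lambda>g. g \<in> Lp_space 2 \<and> L2_tendsto (\<lambda>R. truncated_fourier R f) g at_top"] fourier_exists[of f]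
  unfolding fourier_def by auto

lemma fourier_measurable: "f \<in> Lp_space 2 \<Longrightarrow> fourier f \<in> borel_measurable borel"
  using fourier_Lp_space by (rule Lp_space_borel_measurable)

lemma fourier_eqI:
  assumes "f \<in> Lp_space 2" "g \<in> Lp_space 2" "L2_tendsto (\<lambda>R. truncated_fourier R f) g at_top"
  shows "AE \<xi> in lborel. fourier f \<xi> = g \<xi>"
  using L2_tendsto_unique[OF fourier_tendsto[OF assms(1)] assms(3) _ fourier_Lp_space[OF assms(1)] assms(2)]
  by simp

lemma plancherel:
  assumes f: "f \<in> Lp_space 2"
  shows "Lp_norm 2 (fourier f) = Lp_norm 2 f"
proof (rule tendsto_unique)
  show "((\<lambda>R. Lp_norm 2 (truncated_fourier R f)) \<longlongrightarrow> Lp_norm 2 (fourier f)) at_top"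
    by (intro L2_tendsto_Lp_norm fourier_tendsto fourier_Lp_space f)
  show "((\<lambda>R. Lp_norm 2 (truncated_fourier R f)) \<longlongrightarrow> Lp_norm 2 f) at_top"
    unfolding truncated_fourier_eq plancherel_L1_L2[OF ball_cutoff_spaces[OF f]]
    by (intro L2_tendsto_Lp_norm L2_tendsto_ball_cutoff f)
qed simp

text \<open>This transfers the supremum bound of the integral to the chosen representative, as the
  L^1 part of a split datum requires.\<close>

lemma fourier_eq_fourier_integral:
  assumes f: "integrable lborel f" "f \<in> Lp_space 2"
  shows "AE \<xi> in lborel. fourier f \<xi> = fourier_integral f \<xi>"
proof (rule fourier_eqI[OF f(2) fourier_integral_Lp_space[OF f]])
  note cut = ball_cutoff_spaces[OF f(2)]
  show "L2_tendsto (\<lambda>R. truncated_fourier R f) (fourier_integral f) at_top"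
    using L2_tendsto_ball_cutoff[OF f(2)]
    unfolding L2_tendsto_def truncated_fourier_eq fourier_integral_L2_diff[OF cut f]
    by (auto intro!: always_eventually Lp_space_2_diff fourier_integral_Lp_space cut f)
qed

lemma fourier_diff:
  assumes f: "f \<in> Lp_space 2" and g: "g \<in> Lp_space 2"
  shows "AE \<xi> in lborel. fourier (\<lambda>x. f x - g x) \<xi> = fourier f \<xi> - fourier g \<xi>"
proof (rule fourier_eqI)
  have "truncated_fourier R (\<lambda>x. f x - g x) = (\<lambda>\<xi>. truncated_fourier R f \<xi> - truncated_fourier R g \<xi>)" for R
    using ball_cutoff_spaces(1)[OF f] ball_cutoff_spaces(1)[OF g]
    by (simp add: fun_eq_iff truncated_fourier_eq scaleR_diff_right fourier_integral_diff)
  then show "L2_tendsto (\<lambda>R. truncated_fourier R (\<lambda>x. f x - g x)) (\<lambda>\<xi>. fourier f \<xi> - fourier g \<xi>) at_top"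
    using L2_tendsto_diff[OF fourier_tendsto[OF f] fourier_tendsto[OF g]] by simp
qed (intro Lp_space_2_diff fourier_Lp_space f g)+

lemma fourier_scaleR:
  assumes f: "f \<in> Lp_space 2"
  shows "AE \<xi> in lborel. fourier (\<lambda>x. c *\<^sub>R f x) \<xi> = c *\<^sub>R fourier f \<xi>"
proof (rule fourier_eqI)
  have "truncated_fourier R (\<lambda>x. c *\<^sub>R f x) = (\<lambda>\<xi>. c *\<^sub>R truncated_fourier R f \<xi>)" for R
    using fourier_integral_cmult[of "complex_of_real c" "ball_cutoff R f"]
    by (simp add: fun_eq_iff truncated_fourier_eq scaleR_conv_of_real mult.left_commute)
  then show "L2_tendsto (\<lambda>R. truncated_fourier R (\<lambda>x. c *\<^sub>R f x)) (\<lambda>\<xi>. c *\<^sub>R fourier f \<xi>) at_top"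
    using L2_tendsto_scaleR[OF fourier_tendsto[OF f]] by simp
qed (intro Lp_space_2_scaleR fourier_Lp_space f)+

section \<open>Reflection, the adjoint of the Fourier transform, and inversion\<close>

lemma lborel_distr_uminus_euclidean: "distr lborel borel uminus = (lborel :: 'a::euclidean_space measure)"
  using lborel_affine[of "-1" "0::'a"] by (simp add: density_1)

lemma integral_reflect:
  fixes f :: "'a::euclidean_space \<Rightarrow> 'b::{banach, second_countable_topology}"
  assumes [measurable]: "f \<in> borel_measurable borel"
  shows "(LINT x|lborel. f (- x)) = (LINT x|lborel. f x)"
    and "integrable lborel (\<lambda>x. f (- x)) \<longleftrightarrow> integrable lborel f"
proof -
  have "(LINT x|distr lborel borel uminus. f x) = (LINT x|lborel. f (- x))"
    by (rule integral_distr) measurable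
  then show "(LINT x|lborel. f (- x)) = (LINT x|lborel. f x)"
    unfolding lborel_distr_uminus_euclidean by simp
  have "integrable (distr lborel borel uminus) f \<longleftrightarrow> integrable lborel (\<lambda>x. f (- x))"
    by (rule integrable_distr_eq) measurable
  then show "integrable lborel (\<lambda>x. f (- x)) \<longleftrightarrow> integrable lborel f"
    unfolding lborel_distr_uminus_euclidean by simp
qed

lemma Lp_reflect:
  assumes "f \<in> Lp_space 2"
  shows "(\<lambda>x. f (- x)) \<in> Lp_space 2" "Lp_norm 2 (\<lambda>x. f (- x)) = Lp_norm 2 f"
proof -
  have [measurable]: "f \<in> borel_measurable borel" using assms by (simp add: Lp_space_def)
  show "(\<lambda>x. f (- x)) \<in> Lp_space 2" "Lp_norm 2 (\<lambda>x. f (- x)) = Lp_norm 2 f"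
    using assms integral_reflect[of "\<lambda>x. (norm (f x))\<^sup>2"] by (auto simp: Lp_space_2_iff Lp_norm_2_eq)
qed

lemma L2_tendsto_reflect:
  assumes "L2_tendsto f g F"
  shows "L2_tendsto (\<lambda>i x. f i (- x)) (\<lambda>x. g (- x)) F"
proof -
  have ev: "\<forall>\<^sub>F i in F. (\<lambda>x. f i x - g x) \<in> Lp_space 2" using assms by (simp add: L2_tendsto_def)
  show ?thesis
    unfolding L2_tendsto_def
  proof
    show "\<forall>\<^sub>F i in F. (\<lambda>x. f i (- x) - g (- x)) \<in> Lp_space 2"
      using ev by eventually_elim (auto dest: Lp_reflect(1))
    have "\<forall>\<^sub>F i in F. Lp_norm 2 (\<lambda>x. f i (- x) - g (- x)) = Lp_norm 2 (\<lambda>x. f i x - g x)"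
      using ev by eventually_elim (auto dest: Lp_reflect(2))
    then show "((\<lambda>i. Lp_norm 2 (\<lambda>x. f i (- x) - g (- x))) \<longlongrightarrow> 0) F"
      using assms by (simp add: L2_tendsto_def tendsto_cong)
  qed
qed

text \<open>The exchange formula applied to \<open>f\<close> and the conjugate of \<open>g\<close>:
  conjugating the input conjugates the transform and reflects it. Hence the adjoint is the transform
  followed by a reflection.\<close>

lemma fourier_integral_adjoint:
  fixes f g :: "real ^ 'n \<Rightarrow> complex"
  assumes f: "integrable lborel f" "f \<in> Lp_space 2" and g: "integrable lborel g" "g \<in> Lp_space 2"
  shows "L2_inner (fourier_integral f) g = L2_inner f (\<lambda>x. fourier_integral g (- x))"
proof -
  have dot: "a \<bullet> b = Re (a * cnj b)" for a b :: complex by (simp add: inner_complex_def)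
  have refl: "fourier_integral (\<lambda>x. cnj (g x)) x = cnj (fourier_integral g (- x))" for x
    unfolding fourier_integral_def complex_cnj_scaleR Bochner_Integration.integral_cnj[symmetric]
    by (simp add: cis_cnj)
  have int: "integrable lborel (\<lambda>x. F x * cnj (G x))" if "F \<in> Lp_space 2" "G \<in> Lp_space 2" for F G :: "real ^ 'n \<Rightarrow> complex"
  proof -
    have [measurable]: "F \<in> borel_measurable borel" "(\<lambda>x. cnj (G x)) \<in> borel_measurable borel"
      using that by (auto simp: Lp_space_def intro!: borel_measurable_continuous_on[of cnj] continuous_intros)
    have "integrable lborel (\<lambda>x. (norm (F x))\<^sup>2 + (norm (G x))\<^sup>2)" using that by (simp add: Lp_space_2_iff)
    then show ?thesis
    proof (rule Bochner_Integration.integrable_bound)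
      show "AE x in lborel. norm (F x * cnj (G x)) \<le> norm ((norm (F x))\<^sup>2 + (norm (G x))\<^sup>2)"
      proof (rule AE_I2)
        fix x
        show "norm (F x * cnj (G x)) \<le> norm ((norm (F x))\<^sup>2 + (norm (G x))\<^sup>2)"
          using sum_squares_bound[of "norm (F x)" "norm (G x)"]
            mult_nonneg_nonneg[OF norm_ge_zero[of "F x"] norm_ge_zero[of "G x"]]
          unfolding norm_mult complex_mod_cnj real_norm_def by linarith
      qed
    qed measurable
  qed
  have "L2_inner (fourier_integral f) g = Re (LINT \<xi>|lborel. fourier_integral f \<xi> * cnj (g \<xi>))"
    unfolding L2_inner_def dot
    by (intro integral_Re int fourier_integral_Lp_space f g)
  also have "\<dots> = Re (LINT x|lborel. f x * cnj (fourier_integral g (- x)))"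
    using fourier_integral_exchange[OF f(1), of "\<lambda>x. cnj (g x)"] g by (simp add: refl)
  also have "\<dots> = L2_inner f (\<lambda>x. fourier_integral g (- x))"
    unfolding L2_inner_def dot
    by (intro integral_Re[symmetric] int f Lp_reflect(1) fourier_integral_Lp_space g)
  finally show ?thesis .
qed

text \<open>Two successive limits, in the cutoff radius of \<open>f\<close> and in that of
  \<open>g\<close>, since the formula for Fourier integrals asks both functions to be
  integrable.\<close>

lemma fourier_adjoint:
  assumes f: "f \<in> Lp_space 2" and g: "g \<in> Lp_space 2"
  shows "L2_inner (fourier f) g = L2_inner f (\<lambda>x. fourier g (- x))"
proof -
  note fc = ball_cutoff_spaces[OF f] and gc = ball_cutoff_spaces[OF g]
  note fF = fourier_Lp_space[OF f] and gF = fourier_Lp_space[OF g]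
  have trunc: "truncated_fourier S h \<in> Lp_space 2" if "h \<in> Lp_space 2" for S and h :: "real ^ 'n \<Rightarrow> complex"
    unfolding truncated_fourier_eq by (intro fourier_integral_Lp_space ball_cutoff_spaces that)
  have 1: "L2_inner (fourier f) (ball_cutoff S g) = L2_inner f (\<lambda>x. truncated_fourier S g (- x))" for S
  proof (rule tendsto_unique)
    show "((\<lambda>R. L2_inner (truncated_fourier R f) (ball_cutoff S g)) \<longlongrightarrow> L2_inner (fourier f) (ball_cutoff S g)) at_top"
      by (intro L2_tendsto_inner fourier_tendsto f fF gc)
    show "((\<lambda>R. L2_inner (truncated_fourier R f) (ball_cutoff S g)) \<longlongrightarrow> L2_inner f (\<lambda>x. truncated_fourier S g (- x))) at_top"
      unfolding truncated_fourier_eq fourier_integral_adjoint[OF fc gc]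
      unfolding truncated_fourier_eq[symmetric]
      by (intro L2_tendsto_inner L2_tendsto_ball_cutoff f Lp_reflect trunc g)
  qed simp
  show ?thesis
  proof (rule tendsto_unique)
    show "((\<lambda>S. L2_inner (ball_cutoff S g) (fourier f)) \<longlongrightarrow> L2_inner (fourier f) g) at_top"
      unfolding L2_inner_commute[of "fourier f"] by (intro L2_tendsto_inner L2_tendsto_ball_cutoff g fF)
    show "((\<lambda>S. L2_inner (ball_cutoff S g) (fourier f)) \<longlongrightarrow> L2_inner f (\<lambda>x. fourier g (- x))) at_top"
      unfolding L2_inner_commute[of _ "fourier f"] 1 L2_inner_commute[of f]
      by (intro L2_tendsto_inner L2_tendsto_reflect fourier_tendsto g f Lp_reflect gF)
  qed simp
qed

text \<open>Expand the squared norm of \<open>fourier ?h - g\<close>. By adjointness the inner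
  product of \<open>fourier ?h\<close> with \<open>g\<close> is the squared norm of
  \<open>?h\<close>; by Plancherel all three terms are multiples of the squared norm of
  \<open>g\<close>, with coefficients 1, -2 and 1.\<close>

lemma fourier_inversion:
  assumes g: "g \<in> Lp_space 2"
  shows "AE \<xi> in lborel. fourier (\<lambda>x. fourier g (- x)) \<xi> = g \<xi>"
proof -
  let ?h = "\<lambda>x. fourier g (- x)"
  have h: "?h \<in> Lp_space 2" "Lp_norm 2 ?h = Lp_norm 2 g"
    using Lp_reflect[OF fourier_Lp_space[OF g]] plancherel[OF g] by auto
  have "(Lp_norm 2 (\<lambda>\<xi>. fourier ?h \<xi> - g \<xi>))\<^sup>2 = 0"
    using Lp_norm_2_diff_power2[OF fourier_Lp_space[OF h(1)] g] fourier_adjoint[OF h(1) g] h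
    by (simp add: plancherel L2_inner_self)
  then have "Lp_norm 2 (\<lambda>\<xi>. fourier ?h \<xi> - g \<xi>) = 0" by simp
  from Lp_norm_2_zero_AE[OF Lp_space_2_diff[OF fourier_Lp_space[OF h(1)] g] this] show ?thesis by simp
qed

text \<open>The way back from frequency space: the solution, its time derivative and its fractional
  Laplacian are all built on the frequency side and pulled back by this lemma.\<close>

lemma fourier_surj:
  assumes "g \<in> Lp_space 2"
  obtains f where "f \<in> Lp_space 2" "AE \<xi> in lborel. fourier f \<xi> = g \<xi>" "Lp_norm 2 f = Lp_norm 2 g"
  using that[OF Lp_reflect(1)[OF fourier_Lp_space[OF assms]] fourier_inversion[OF assms]]
    Lp_reflect(2)[OF fourier_Lp_space[OF assms]] plancherel[OF assms] by auto

subsection \<open>Growth on balls and dyadic decomposition\<close>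

lemma dyadic_shell:
  assumes "0 < y" "y \<le> (1::real)"
  obtains k :: nat where "(1/2)^(Suc k) < y" "y \<le> (1/2)^k"
proof -
  have ex: "\<exists>n. (1/2::real)^n < y" using real_arch_pow_inv[of y "1/2"] assms by simp
  define n where "n = (LEAST n. (1/2::real)^n < y)"
  have n: "(1/2)^n < y" unfolding n_def using ex by (rule LeastI_ex)
  then obtain k where k: "n = Suc k" using assms by (cases n) auto
  have "\<not> (1/2)^k < y" using not_less_Least[of k "\<lambda>n. (1/2::real)^n < y"] k by (simp add: n_def)
  then show ?thesis using that n k by auto
qed

lemma le_suminf_ennreal: "f k \<le> (\<Sum>i. f i :: ennreal)"
  using sum_le_suminf[of f "{k}"] by simp

lemma half_power_powr: "((1/2)^k) powr a = (2 powr (- a))^k" for a :: real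
  by (simp add: powr_minus powr_power power_one_over powr_divide inverse_eq_divide flip: powr_realpow)
    (simp add: powr_powr mult.commute)

text \<open>The constant \<open>A\<close> is a parameter because it later carries the squared norms
  of the data, on which estimates must depend linearly. For \<open>p = 0\<close> the condition is a
  bound on the total mass.\<close>

definition ball_growth :: "('a::euclidean_space \<Rightarrow> ennreal) \<Rightarrow> real \<Rightarrow> real \<Rightarrow> bool" where
  "ball_growth h A p \<longleftrightarrow> h \<in> borel_measurable borel \<and> 0 \<le> A \<and>
     (\<forall>R>0. (\<integral>\<^sup>+x. h x * indicator (cball 0 R) x \<partial>lborel) \<le> ennreal (A * R powr p))"

text \<open>Every nonzero point of the ball lies in a shell R/2^(k+1) < |x| \<le> R/2^k, on which
  the weight is at most \<open>W k\<close>. Enlarging the shell to the full ball of radius R/2^k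
  only increases the integral and leaves quantities that \<open>ball_growth\<close>
  controls.\<close>

lemma nn_integral_dyadic:
  fixes h :: "'a::euclidean_space \<Rightarrow> ennreal"
  assumes [measurable]: "h \<in> borel_measurable borel" and "0 < R"
    and w: "\<And>x k. x \<noteq> 0 \<Longrightarrow> R * (1/2)^(Suc k) < norm x \<Longrightarrow> norm x \<le> R * (1/2)^k \<Longrightarrow> w x \<le> W k"
  shows "(\<integral>\<^sup>+x. w x * h x * indicator (cball 0 R) x \<partial>lborel) \<le>
     (\<Sum>k. W k * (\<integral>\<^sup>+x. h x * indicator (cball 0 (R * (1/2)^k)) x \<partial>lborel))"
proof -
  have [measurable]: "cball 0 s \<in> sets (borel :: 'a measure)" for s by simp
  have "(\<integral>\<^sup>+x. w x * h x * indicator (cball 0 R) x \<partial>lborel) \<le>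
      (\<integral>\<^sup>+x. (\<Sum>k. W k * (h x * indicator (cball 0 (R * (1/2)^k)) x)) \<partial>lborel)"
  \<comment> \<open>The origin belongs to no shell, hence the passage to almost every point.\<close>
  proof (rule nn_integral_mono_AE, use AE_lborel_singleton[of "0::'a"] in eventually_elim)
    case (elim x)
    show ?case
    proof (cases "norm x \<le> R")
      case True
      then obtain k where k: "(1/2)^(Suc k) < norm x / R" "norm x / R \<le> (1/2)^k"
        using dyadic_shell[of "norm x / R"] elim \<open>0 < R\<close> by auto
      then have "R * (1/2)^(Suc k) < norm x" "norm x \<le> R * (1/2)^k"
        using \<open>0 < R\<close> by (auto simp: field_simps)
      then have "w x * h x * indicator (cball 0 R) x \<le> W k * (h x * indicator (cball 0 (R * (1/2)^k)) x)"
        using w[OF elim] True by (simp add: mult_right_mono)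
      also have "\<dots> \<le> (\<Sum>k. W k * (h x * indicator (cball 0 (R * (1/2)^k)) x))"
        by (rule le_suminf_ennreal)
      finally show ?thesis .
    qed simp
  qed
  also have "\<dots> = (\<Sum>k. \<integral>\<^sup>+x. W k * (h x * indicator (cball 0 (R * (1/2)^k)) x) \<partial>lborel)"
    by (rule nn_integral_suminf) measurable
  also have "\<dots> = (\<Sum>k. W k * (\<integral>\<^sup>+x. h x * indicator (cball 0 (R * (1/2)^k)) x \<partial>lborel))"
    by (simp add: nn_integral_cmult)
  finally show ?thesis .
qed

lemma suminf_geometric_le:
  assumes "\<And>k. f k \<le> ennreal (c * r^k)" "0 \<le> c" "0 \<le> r" "r < 1"
  shows "(\<Sum>k. f k) \<le> ennreal (c / (1 - r))"
proof -
  have s: "(\<lambda>k. c * r^k) sums (c * (1 / (1 - r)))"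
    using assms by (intro sums_mult geometric_sums) auto
  have "(\<Sum>k. f k) \<le> (\<Sum>k. ennreal (c * r^k))" by (rule suminf_le) (use assms in auto)
  also have "\<dots> = ennreal (\<Sum>k. c * r^k)"
    using assms s by (intro suminf_ennreal2) (auto simp: sums_iff)
  also have "(\<Sum>k. c * r^k) = c / (1 - r)" using s by (simp add: sums_iff)
  finally show ?thesis .
qed

text \<open>On a shell of radius y the weight |x|^q is comparable to y^q, also for negative
  \<open>q\<close>. The shell contributions then form a geometric series of ratio 2^(-(p+q)), which
  converges because \<open>p + q\<close> is positive.\<close>

lemma ball_growth_weight:
  fixes h :: "'a::euclidean_space \<Rightarrow> ennreal"
  assumes h: "ball_growth h A p" and pq: "0 < p + q"
  shows "ball_growth (\<lambda>x. ennreal (norm x powr q) * h x) ((1 + 2 powr (- q)) / (1 - 2 powr (- (p + q))) * A) (p + q)"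
proof -
  have [measurable]: "h \<in> borel_measurable borel" and A: "0 \<le> A" using h by (auto simp: ball_growth_def)
  \<comment> \<open>The summand 1 covers \<open>0 \<le> q\<close>, where |x| is at most the shell
    radius; the other covers negative \<open>q\<close>, where |x| exceeds half of that
    radius.\<close>
  let ?M = "1 + 2 powr (- q)" and ?r = "2 powr (- (p + q))"
  have r: "?r < 1" using pq powr_less_mono[of "- (p + q)" 0 2] by simp
  have "(\<integral>\<^sup>+x. ennreal (norm x powr q) * h x * indicator (cball 0 R) x \<partial>lborel)
      \<le> ennreal (?M / (1 - ?r) * A * R powr (p + q))" if R: "0 < R" for R
  proof -
    have "(\<integral>\<^sup>+x. ennreal (norm x powr q) * h x * indicator (cball 0 R) x \<partial>lborel) \<le>
        (\<Sum>k. ennreal (?M * (R * (1/2)^k) powr q) * (\<integral>\<^sup>+x. h x * indicator (cball 0 (R * (1/2)^k)) x \<partial>lborel))"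
    proof (rule nn_integral_dyadic[OF _ R])
      fix x :: 'a and k
      assume x: "x \<noteq> 0" "R * (1/2)^(Suc k) < norm x" "norm x \<le> R * (1/2)^k"
      let ?y = "R * (1/2)^k"
      have y: "0 < ?y" using R by simp
      have "norm x powr q \<le> ?M * ?y powr q"
      proof (cases "0 \<le> q")
        case True
        then have "norm x powr q \<le> ?y powr q" using x by (intro powr_mono2) auto
        also have "\<dots> \<le> ?M * ?y powr q" by (simp add: distrib_right)
        finally show ?thesis .
      next
        case False
        then have "norm x powr q \<le> (?y * (1/2)) powr q" using x R by (intro powr_mono2') auto
        also have "\<dots> = 2 powr (- q) * ?y powr q"
          using y by (subst powr_mult) (auto simp: powr_minus powr_divide field_simps)
        also have "\<dots> \<le> ?M * ?y powr q" by (simp add: distrib_right)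
        finally show ?thesis .
      qed
      then show "ennreal (norm x powr q) \<le> ennreal (?M * ?y powr q)" by (rule ennreal_leI)
    qed measurable
    also have "\<dots> \<le> ennreal (?M * A * R powr (p + q) / (1 - ?r))"
    proof (rule suminf_geometric_le)
      fix k
      let ?y = "R * (1/2)^k"
      have y: "0 < ?y" using R by simp
      have "ennreal (?M * ?y powr q) * (\<integral>\<^sup>+x. h x * indicator (cball 0 ?y) x \<partial>lborel)
          \<le> ennreal (?M * ?y powr q) * ennreal (A * ?y powr p)"
        using h y by (intro mult_left_mono) (auto simp: ball_growth_def)
      also have "\<dots> = ennreal (?M * A * ?y powr (p + q))"
        using A by (simp add: ennreal_mult'[symmetric] powr_add mult_ac)
      also have "?y powr (p + q) = R powr (p + q) * ?r^k"
        using R by (simp add: powr_mult half_power_powr)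
      finally show "ennreal (?M * ?y powr q) * (\<integral>\<^sup>+x. h x * indicator (cball 0 ?y) x \<partial>lborel)
          \<le> ennreal (?M * A * R powr (p + q) * ?r^k)" by (simp add: mult_ac)
    qed (use A r in auto)
    also have "?M * A * R powr (p + q) / (1 - ?r) = ?M / (1 - ?r) * A * R powr (p + q)" by simp
    finally show ?thesis .
  qed
  then show ?thesis using A r by (auto simp: ball_growth_def)
qed

text \<open>Here the weight is at most R^q on the whole ball, so \<open>A\<close> is preserved and
  the case \<open>p + q = 0\<close>, in which the dyadic series diverges, is included.\<close>

lemma ball_growth_weight_nonneg:
  assumes h: "ball_growth h A p" and q: "0 \<le> q"
  shows "ball_growth (\<lambda>x. ennreal (norm x powr q) * h x) A (p + q)"
proof -
  have [measurable]: "h \<in> borel_measurable borel" using h by (auto simp: ball_growth_def)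
  have [measurable]: "cball 0 s \<in> sets (borel :: 'a measure)" for s by simp
  have "(\<integral>\<^sup>+x. ennreal (norm x powr q) * h x * indicator (cball 0 R) x \<partial>lborel) \<le> ennreal (A * R powr (p + q))"
    if R: "0 < R" for R
  proof -
    have "(\<integral>\<^sup>+x. ennreal (norm x powr q) * h x * indicator (cball 0 R) x \<partial>lborel) \<le>
      (\<integral>\<^sup>+x. ennreal (R powr q) * (h x * indicator (cball 0 R) x) \<partial>lborel)"
      using q by (intro nn_integral_mono) (auto simp: indicator_def intro!: mult_right_mono ennreal_leI powr_mono2)
    also have "\<dots> = ennreal (R powr q) * (\<integral>\<^sup>+x. h x * indicator (cball 0 R) x \<partial>lborel)"
      by (rule nn_integral_cmult) measurable
    also have "\<dots> \<le> ennreal (R powr q) * ennreal (A * R powr p)"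
      using h R by (intro mult_left_mono) (auto simp: ball_growth_def)
    also have "\<dots> = ennreal (A * R powr (p + q))"
      using h by (simp add: ball_growth_def ennreal_mult'[symmetric] powr_add mult_ac)
    finally show ?thesis .
  qed
  then show ?thesis using h by (auto simp: ball_growth_def)
qed

section \<open>Exponential damping of functions with polynomial growth on balls\<close>

lemma powr_le_exp:
  assumes "0 < a" "0 < \<kappa>" "0 \<le> (x::real)"
  shows "x powr a \<le> (a / \<kappa>) powr a * exp (\<kappa> * x)"
proof -
  \<comment> \<open>The bound y \<le> exp y at y = \<kappa> x / a; its \<open>a\<close>-th power is
    the claim.\<close>
  have "\<kappa> * x / a \<le> exp (\<kappa> * x / a)" using exp_ge_add_one_self[of "\<kappa> * x / a"] by linarith
  then have "x \<le> (a / \<kappa>) * exp (\<kappa> * x / a)" using assms by (simp add: field_simps)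
  then have "x powr a \<le> ((a / \<kappa>) * exp (\<kappa> * x / a)) powr a" using assms by (intro powr_mono2) auto
  also have "\<dots> = (a / \<kappa>) powr a * exp (\<kappa> * x)"
    using assms by (subst powr_mult) (auto simp: exp_powr_real)
  finally show ?thesis .
qed

lemma exp_decay_le:
  assumes "0 < (\<kappa>::real)" "0 \<le> a"
  obtains K where "0 < K" "\<And>t. 0 \<le> t \<Longrightarrow> exp (- (\<kappa> * t)) \<le> K * (1 + t) powr (- a)"
proof -
  \<comment> \<open>The exponent is raised from \<open>a\<close> to \<open>a + 1\<close> so that
    \<open>powr_le_exp\<close>, which wants a positive exponent, also covers \<open>a = 0\<close>.
    The factor \<open>exp \<kappa>\<close> comes from replacing t by 1 + t.\<close>
  let ?K = "((a + 1) / \<kappa>) powr (a + 1) * exp \<kappa>"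
  have "exp (- (\<kappa> * t)) \<le> ?K * (1 + t) powr (- a)" if "0 \<le> t" for t
  proof -
    have "(1 + t) powr a \<le> (1 + t) powr (a + 1)" using that by (intro powr_mono) auto
    also have "\<dots> \<le> ((a + 1) / \<kappa>) powr (a + 1) * exp (\<kappa> * (1 + t))"
      using assms that by (intro powr_le_exp) auto
    also have "\<dots> = ?K * exp (\<kappa> * t)" by (simp add: distrib_left exp_add)
    finally show ?thesis using that by (simp add: powr_minus exp_minus field_simps)
  qed
  moreover have "0 < ?K" using assms by simp
  ultimately show ?thesis using that by blast
qed

text \<open>The exponential confines \<open>x\<close> to the scale 1/s with s = (1+t)^(1/q). The
  ball of radius 2^k / s has mass at most A 2^(kp) s^(-p), while the exponential is of order
  2^(-k(p+1)) where that ball is first reached. The series has ratio 1/2 and leaves s^(-p) =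
  (1+t)^(-p/q).\<close>

lemma nn_integral_exp_decay:
  fixes p q \<kappa> :: real
  assumes p: "0 \<le> p" and q: "0 < q" and \<kappa>: "0 < \<kappa>"
  obtains C where "0 < C" and "\<And>(h :: 'a::euclidean_space \<Rightarrow> ennreal) A t. ball_growth h A p \<Longrightarrow> 0 \<le> t \<Longrightarrow>
    (\<integral>\<^sup>+x. ennreal (exp (- (\<kappa> * norm x powr q * t))) * h x * indicator (cball 0 1) x \<partial>lborel)
      \<le> ennreal (C * A * (1 + t) powr (- (p / q)))"
proof -
  \<comment> \<open>Chosen so that the \<open>a\<close>-th power of \<rho>^q is \<rho>^(p+1), one
    power more than the growth of the mass.\<close>
  define a where "a = (p + 1) / q"
  have a: "0 < a" using p q by (simp add: a_def)
  \<comment> \<open>The 1 serves the region \<rho> \<le> 1. The factor 2^(p+1) pays for rounding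
    \<rho> from 2^j up to 2^(j+1).\<close>
  define K where "K = 1 + 2 powr (p + 1) * (a / \<kappa>) powr a"
  have K: "1 \<le> K" by (simp add: K_def)
  define C where "C = exp \<kappa> * K * 2"
  have "(\<integral>\<^sup>+x. ennreal (exp (- (\<kappa> * norm x powr q * t))) * h x * indicator (cball 0 1) x \<partial>lborel)
      \<le> ennreal (C * A * (1 + t) powr (- (p / q)))"
    if h: "ball_growth h A p" and t: "0 \<le> t" for h :: "'a \<Rightarrow> ennreal" and A t
  proof -
    have [measurable]: "h \<in> borel_measurable borel" and A: "0 \<le> A" using h by (auto simp: ball_growth_def)
    have [measurable]: "cball 0 s \<in> sets (borel :: 'a measure)" for s by simp
    define s where "s = (1 + t) powr (1 / q)"
    have s: "0 < s" using t by (simp add: s_def)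
    have sq: "s powr q = 1 + t" using t q by (simp add: s_def powr_powr)
    let ?W = "\<lambda>k. exp \<kappa> * K * (2 powr (- (p + 1)))^k"
    have "(\<integral>\<^sup>+x. ennreal (exp (- (\<kappa> * norm x powr q * t))) * h x * indicator (cball 0 1) x \<partial>lborel) \<le>
        (\<integral>\<^sup>+x. (\<Sum>k. ennreal (?W k) * (h x * indicator (cball 0 (2^k / s)) x)) \<partial>lborel)"
    proof (rule nn_integral_mono)
      fix x :: 'a
      show "ennreal (exp (- (\<kappa> * norm x powr q * t))) * h x * indicator (cball 0 1) x \<le>
          (\<Sum>k. ennreal (?W k) * (h x * indicator (cball 0 (2^k / s)) x))"
      proof (cases "norm x \<le> 1")
        case True
        define \<rho> where "\<rho> = s * norm x"
        have \<rho>: "0 \<le> \<rho>" "norm x powr q * (1 + t) = \<rho> powr q"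
          using s by (auto simp: \<rho>_def powr_mult sq)
        have "norm x powr q \<le> 1" using True q by (simp add: powr_le1)
        \<comment> \<open>Replacing t by 1 + t costs at most \<open>\<kappa>\<close> in the
          exponent, because |x| \<le> 1.\<close>
        then have "- (\<kappa> * norm x powr q * t) \<le> \<kappa> + - (\<kappa> * \<rho> powr q)"
          using \<kappa> unfolding \<rho>(2)[symmetric] by (simp add: distrib_left mult.assoc)
        then have e1: "exp (- (\<kappa> * norm x powr q * t)) \<le> exp \<kappa> * exp (- (\<kappa> * \<rho> powr q))"
          by (simp flip: exp_add)
        obtain k where k: "\<rho> \<le> 2^k" "exp (- (\<kappa> * \<rho> powr q)) \<le> K * (2 powr (- (p + 1)))^k"
        proof (cases "\<rho> \<le> 1")
          case True
          have "exp (- (\<kappa> * \<rho> powr q)) \<le> 1" using \<kappa> by simp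
          then have "exp (- (\<kappa> * \<rho> powr q)) \<le> K" using K by linarith
          then show ?thesis using that[of 0] True by simp
        next
          case False
          then obtain j where j: "(1/2)^(Suc j) < 1 / \<rho>" "1 / \<rho> \<le> (1/2)^j"
            using dyadic_shell[of "1 / \<rho>"] by auto
          then have j': "\<rho> \<le> 2^(Suc j)" "2^j \<le> \<rho>"
            using False by (auto simp: field_simps)
          have "(\<rho> powr q) powr a \<le> (a / \<kappa>) powr a * exp (\<kappa> * \<rho> powr q)"
            using a \<kappa> by (intro powr_le_exp) auto
          moreover have "(\<rho> powr q) powr a = \<rho> powr (p + 1)" using q by (simp add: powr_powr a_def)
          ultimately have le: "\<rho> powr (p + 1) \<le> (a / \<kappa>) powr a * exp (\<kappa> * \<rho> powr q)" by simp
          have "exp (- (\<kappa> * \<rho> powr q)) = exp (- (\<kappa> * \<rho> powr q)) * (\<rho> powr (p + 1) * \<rho> powr (- (p + 1)))"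
            using False by (simp flip: powr_add)
          also have "\<dots> \<le> exp (- (\<kappa> * \<rho> powr q)) * ((a / \<kappa>) powr a * exp (\<kappa> * \<rho> powr q) * \<rho> powr (- (p + 1)))"
            using le by (intro mult_left_mono mult_right_mono) auto
          also have "\<dots> = exp (- (\<kappa> * \<rho> powr q)) * exp (\<kappa> * \<rho> powr q) * ((a / \<kappa>) powr a * \<rho> powr (- (p + 1)))"
            by (simp only: mult_ac)
          also have "\<dots> = (a / \<kappa>) powr a * \<rho> powr (- (p + 1))" by (simp flip: exp_add)
          also have "\<rho> powr (- (p + 1)) \<le> (2^j) powr (- (p + 1))"
            using j' p by (intro powr_mono2') auto
          also have "(2^j) powr (- (p + 1)) = 2 powr (p + 1) * (2 powr (- (p + 1)))^(Suc j)"
            by (simp add: powr_power powr_powr mult.commute flip: powr_realpow powr_add)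
          finally have "exp (- (\<kappa> * \<rho> powr q)) \<le> 2 powr (p + 1) * (a / \<kappa>) powr a * (2 powr (- (p + 1)))^(Suc j)"
            using a \<kappa> by (simp add: mult_left_mono mult_ac)
          also have "\<dots> \<le> K * (2 powr (- (p + 1)))^(Suc j)" by (intro mult_right_mono) (auto simp: K_def)
          finally show ?thesis using that j' by blast
        qed
        have x: "x \<in> cball 0 (2^k / s)" using k s by (simp add: \<rho>_def field_simps)
        have "exp (- (\<kappa> * norm x powr q * t)) \<le> ?W k"
          using order_trans[OF e1 mult_left_mono[OF k(2) exp_ge_zero]] by (simp only: mult.assoc)
        then have "ennreal (exp (- (\<kappa> * norm x powr q * t))) * h x * indicator (cball 0 1) x
            \<le> ennreal (?W k) * (h x * indicator (cball 0 (2^k / s)) x)"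
          using x by (auto simp: indicator_def intro!: mult_right_mono ennreal_leI)
        also have "\<dots> \<le> (\<Sum>k. ennreal (?W k) * (h x * indicator (cball 0 (2^k / s)) x))"
          by (rule le_suminf_ennreal)
        finally show ?thesis .
      qed simp
    qed
    also have "\<dots> = (\<Sum>k. ennreal (?W k) * (\<integral>\<^sup>+x. h x * indicator (cball 0 (2^k / s)) x \<partial>lborel))"
      by (subst nn_integral_suminf) (auto simp: nn_integral_cmult)
    also have "\<dots> \<le> ennreal (exp \<kappa> * K * A * s powr (- p) / (1 - 1/2))"
    proof (rule suminf_geometric_le)
      fix k
      have "ennreal (?W k) * (\<integral>\<^sup>+x. h x * indicator (cball 0 (2^k / s)) x \<partial>lborel) \<le>
          ennreal (?W k) * ennreal (A * (2^k / s) powr p)"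
        using h s by (intro mult_left_mono) (auto simp: ball_growth_def)
      also have "\<dots> = ennreal (?W k * (A * (2^k / s) powr p))"
        using A K by (intro ennreal_mult'[symmetric]) auto
      also have "(2^k / s) powr p = (2^k) powr p * s powr (- p)"
        using s by (subst powr_divide) (auto simp: powr_minus divide_inverse)
      also have "?W k * (A * ((2^k) powr p * s powr (- p))) =
          exp \<kappa> * K * A * s powr (- p) * ((2 powr (- (p + 1)))^k * (2^k) powr p)" by (simp add: mult_ac)
      also have "(2 powr (- (p + 1)))^k * (2^k) powr p = (1/2)^k"
      proof -
        have "(2^k) powr p = (2 powr p)^k" by (simp add: powr_power powr_powr mult.commute flip: powr_realpow)
        then show ?thesis by (simp add: powr_diff powr_minus flip: power_mult_distrib powr_add)
      qed
      finally show "ennreal (?W k) * (\<integral>\<^sup>+x. h x * indicator (cball 0 (2^k / s)) x \<partial>lborel) \<le>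
          ennreal (exp \<kappa> * K * A * s powr (- p) * (1/2)^k)" .
    qed (use A K in auto)
    also have "exp \<kappa> * K * A * s powr (- p) / (1 - 1/2) = C * A * (1 + t) powr (- (p / q))"
      using t by (simp add: C_def s_def powr_powr)
    finally show ?thesis .
  qed
  moreover have "0 < C" using K by (simp add: C_def)
  ultimately show ?thesis using that by blast
qed

lemma ball_growth_one: "ball_growth (\<lambda>x::'a::euclidean_space. 1) (unit_ball_vol (real DIM('a))) (real DIM('a))"
  by (auto simp: ball_growth_def emeasure_cball powr_realpow)

lemma ball_growth_cong_le:
  assumes "ball_growth h A p" "g \<in> borel_measurable borel" "AE x in lborel. g x \<le> h x"
  shows "ball_growth g A p"
  unfolding ball_growth_def
proof (intro conjI allI impI)
  fix R :: real assume "0 < R"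
  have "(\<integral>\<^sup>+x. g x * indicator (cball 0 R) x \<partial>lborel) \<le> (\<integral>\<^sup>+x. h x * indicator (cball 0 R) x \<partial>lborel)"
    by (rule nn_integral_mono_AE, use assms(3) in eventually_elim) (rule mult_right_mono, auto)
  also have "\<dots> \<le> ennreal (A * R powr p)" using assms \<open>0 < R\<close> by (auto simp: ball_growth_def)
  finally show "(\<integral>\<^sup>+x. g x * indicator (cball 0 R) x \<partial>lborel) \<le> ennreal (A * R powr p)" .
qed (use assms in \<open>auto simp: ball_growth_def\<close>)

subsection \<open>Low-frequency bounds for the Fourier transform\<close>

text \<open>The factor 2 stems from (x + y)^2 \<le> 2 x^2 + 2 y^2, the square from the supremum
  bound on the transform of the L^1 part, and the volume from integrating that bound over a
  ball.\<close>

definition split_const :: "'n::finite itself \<Rightarrow> real" where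
  "split_const _ = 2 * ((2 * pi) powr (- (real CARD('n) / 2)))\<^sup>2 * unit_ball_vol (real CARD('n))"

lemma split_const_nonneg: "0 \<le> split_const TYPE('n::finite)"
  by (simp add: split_const_def)

text \<open>This replaces the Hausdorff--Young inequality: the transform of the part of \<open>f\<close> on \<open>S\<close> is bounded
  by its \<open>L\<^sup>1\<close> norm, the rest is controlled by Plancherel's theorem, and \<open>S\<close> is chosen depending on \<open>R\<close>.\<close>

lemma fourier_ball_split:
  fixes f :: "real ^ 'n \<Rightarrow> complex"
  assumes f: "f \<in> Lp_space 2" and S: "S \<in> sets borel" and R: "0 < R" and a: "0 \<le> a"
    and f1: "(\<integral>\<^sup>+x. ennreal (norm (f x)) * indicator S x \<partial>lborel) \<le> ennreal a"
  shows "(\<integral>\<^sup>+\<xi>. ennreal ((norm (fourier f \<xi>))\<^sup>2) * indicator (cball 0 R) \<xi> \<partial>lborel) \<le>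
    ennreal (split_const TYPE('n) * R powr real CARD('n) * a\<^sup>2) + 2 * (\<integral>\<^sup>+x. ennreal ((norm (f x))\<^sup>2) * indicator (- S) x \<partial>lborel)"
proof -
  let ?c = "(2 * pi) powr (- (real CARD('n) / 2))"
  have [measurable]: "f \<in> borel_measurable borel" "S \<in> sets borel" "cball 0 R \<in> sets (borel :: (real ^ 'n) measure)"
    using f S by (auto simp: Lp_space_def)
  define g where "g x = indicator S x *\<^sub>R f x" for x
  have [measurable]: "g \<in> borel_measurable borel" unfolding g_def by measurable
  have ng: "(\<integral>\<^sup>+x. ennreal (norm (g x)) \<partial>lborel) \<le> ennreal a"
  proof -
    have "ennreal (norm (g x)) = ennreal (norm (f x)) * indicator S x" for x by (simp add: g_def indicator_def)
    then show ?thesis using f1 by simp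
  qed
  then have gi: "integrable lborel g"
    by (intro integrableI_bounded) (auto intro: order_le_less_trans)
  have ga: "(LINT x|lborel. norm (g x)) \<le> a"
    using ng nn_integral_eq_integral[OF integrable_norm[OF gi]] a by simp
  have g2: "g \<in> Lp_space 2" by (rule Lp_space_2_bound(1)[OF f]) (auto simp: g_def indicator_def)
  define k where "k x = f x - g x" for x
  have k2: "k \<in> Lp_space 2" unfolding k_def by (intro Lp_space_2_diff f g2)
  have [measurable]: "fourier k \<in> borel_measurable borel" "fourier f \<in> borel_measurable borel"
    using k2 f by (auto intro: fourier_measurable)
  have bound: "norm (fourier_integral g \<xi>) \<le> ?c * a" for \<xi>
    using norm_fourier_integral_le[OF gi, of \<xi>] ga by (auto intro: order_trans mult_left_mono)
  have "(\<integral>\<^sup>+\<xi>. ennreal ((norm (fourier f \<xi>))\<^sup>2) * indicator (cball 0 R) \<xi> \<partial>lborel) \<le>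
     (\<integral>\<^sup>+\<xi>. ennreal (2 * (?c * a)\<^sup>2) * indicator (cball 0 R) \<xi> + 2 * ennreal ((norm (fourier k \<xi>))\<^sup>2) \<partial>lborel)"
  proof (rule nn_integral_mono_AE, use fourier_diff[OF f g2] fourier_eq_fourier_integral[OF gi g2] in eventually_elim)
    case (elim \<xi>)
    then have eq: "fourier f \<xi> = fourier k \<xi> + fourier_integral g \<xi>" by (simp add: k_def[abs_def])
    have "(norm (fourier f \<xi>))\<^sup>2 \<le> (norm (fourier k \<xi>) + norm (fourier_integral g \<xi>))\<^sup>2"
      unfolding eq by (intro power_mono norm_triangle_ineq) simp
    also have "\<dots> \<le> 2 * (norm (fourier_integral g \<xi>))\<^sup>2 + 2 * (norm (fourier k \<xi>))\<^sup>2"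
      using sum_squares_bound[of "norm (fourier k \<xi>)" "norm (fourier_integral g \<xi>)"] by (simp add: power2_sum)
    also have "\<dots> \<le> 2 * (?c * a)\<^sup>2 + 2 * (norm (fourier k \<xi>))\<^sup>2"
      using bound by (intro add_right_mono mult_left_mono power_mono) auto
    finally have "ennreal ((norm (fourier f \<xi>))\<^sup>2) \<le> ennreal (2 * (?c * a)\<^sup>2 + 2 * (norm (fourier k \<xi>))\<^sup>2)"
      by (rule ennreal_leI)
    also have "\<dots> = ennreal (2 * (?c * a)\<^sup>2) + ennreal (2 * (norm (fourier k \<xi>))\<^sup>2)"
      by (rule ennreal_plus) auto
    also have "ennreal (2 * (norm (fourier k \<xi>))\<^sup>2) = 2 * ennreal ((norm (fourier k \<xi>))\<^sup>2)"
      by (subst ennreal_mult') auto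
    finally have "ennreal ((norm (fourier f \<xi>))\<^sup>2) \<le> ennreal (2 * (?c * a)\<^sup>2) + 2 * ennreal ((norm (fourier k \<xi>))\<^sup>2)" .
    then show ?case by (auto simp: indicator_def)
  qed
  also have "\<dots> = ennreal (2 * (?c * a)\<^sup>2) * emeasure lborel (cball 0 R :: (real ^ 'n) set) +
      2 * (\<integral>\<^sup>+\<xi>. ennreal ((norm (fourier k \<xi>))\<^sup>2) \<partial>lborel)"
    by (subst nn_integral_add) (auto simp: nn_integral_cmult nn_integral_cmult_indicator)
  also have "(\<integral>\<^sup>+\<xi>. ennreal ((norm (fourier k \<xi>))\<^sup>2) \<partial>lborel) = (\<integral>\<^sup>+x. ennreal ((norm (k x))\<^sup>2) \<partial>lborel)"
    using plancherel[OF k2] by (simp add: ennreal_Lp_norm_2_power2[symmetric] k2 fourier_Lp_space)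
  also have "\<dots> = (\<integral>\<^sup>+x. ennreal ((norm (f x))\<^sup>2) * indicator (- S) x \<partial>lborel)"
    by (intro nn_integral_cong) (auto simp: k_def g_def indicator_def)
  also have "ennreal (2 * (?c * a)\<^sup>2) * emeasure lborel (cball 0 R :: (real ^ 'n) set) =
      ennreal (split_const TYPE('n) * R powr real CARD('n) * a\<^sup>2)"
    using R a by (simp add: emeasure_cball ennreal_mult'[symmetric] split_const_def powr_realpow
        power_mult_distrib mult_ac)
  finally show ?thesis .
qed

lemma weighted_Lp_norm_powr:
  assumes "f \<in> weighted_Lp_space a m" "0 < m"
  shows "(\<integral>\<^sup>+x. ennreal ((norm x powr a * norm (f x)) powr m) \<partial>lborel) = ennreal (weighted_Lp_norm a m f powr m)"
proof -
  have i: "integrable lborel (\<lambda>x. norm ((norm x powr a) *\<^sub>R f x) powr m)"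
    using assms by (simp add: weighted_Lp_space_def Lp_space_def)
  have "(\<integral>\<^sup>+x. ennreal (norm ((norm x powr a) *\<^sub>R f x) powr m) \<partial>lborel) =
      ennreal (LINT x|lborel. norm ((norm x powr a) *\<^sub>R f x) powr m)"
    by (rule nn_integral_eq_integral[OF i]) simp
  also have "(LINT x|lborel. norm ((norm x powr a) *\<^sub>R f x) powr m) = weighted_Lp_norm a m f powr m"
    using assms(2) by (simp add: weighted_Lp_norm_def Lp_norm_def powr_powr integral_nonneg)
  finally show ?thesis by simp
qed

lemma weighted_Lp_norm_nonneg [simp]: "0 \<le> weighted_Lp_norm a m f"
  by (simp add: weighted_Lp_norm_def)

text \<open>The set \<open>S\<close> is the ball of radius 1/R together with the points where |f|
  exceeds a level \<open>l\<close>. On the ball, Hoelder's inequality with |x|^(-a) in L^m' bounds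
  the L^1 norm, which is where the condition on n enters. Outside it the weight is at least R^(-a),
  so \<open>f\<close> is in unweighted L^m there and the cut at \<open>l\<close> separates an L^1
  part from an L^2 part. The growth exponent is the one dictated by scaling. The lemma is applied
  with a = 0 to \<open>u0\<close> and with a = 2\<delta> to \<open>u1\<close>.\<close>

lemma weighted_low_frequency_bound:
  fixes a m :: real
  assumes a: "0 \<le> a" and m: "1 < m" "m < 2" and n: "a * m / (m - 1) < real CARD('n::finite)"
  obtains C where "0 < C" and "\<And>f. f \<in> Lp_space 2 \<Longrightarrow> f \<in> weighted_Lp_space a m \<Longrightarrow>
    ball_growth (\<lambda>\<xi>::real ^ 'n. ennreal ((norm (fourier f \<xi>))\<^sup>2)) (C * (weighted_Lp_norm a m f)\<^sup>2)
      (2 * a + (2 * real CARD('n) / m - real CARD('n)))"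
proof -
  let ?n = "real CARD('n)"
  define m' where "m' = m / (m - 1)"
  have m': "1 < m'" "1/m + 1/m' = 1" using m by (auto simp: m'_def field_simps)
  have nm': "?n / m' = ?n - ?n / m" using m by (simp add: m'_def field_simps)
  have am': "0 < ?n - a * m'" using n by (simp add: m'_def)
  let ?q = "2 * a + (2 * ?n / m - ?n)"
  define CV where "CV = (1 + 2 powr (- (- (a * m')))) / (1 - 2 powr (- (?n + - (a * m')))) * unit_ball_vol ?n"
  have V: "ball_growth (\<lambda>x::real ^ 'n. ennreal (norm x powr (- (a * m'))) * 1) CV (?n - a * m')"
    using ball_growth_weight[OF ball_growth_one[where 'a="real ^ 'n"], of "- (a * m')"] am'
    by (simp add: CV_def)
  then have CV: "0 \<le> CV" by (simp add: ball_growth_def)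
  define C where "C = split_const TYPE('n) * (2 + CV)\<^sup>2 + 2"
  have C: "0 < C" using split_const_nonneg[where 'n='n] by (simp add: C_def add_nonneg_pos)
  have main: "(\<integral>\<^sup>+\<xi>. ennreal ((norm (fourier f \<xi>))\<^sup>2) * indicator (cball 0 R) \<xi> \<partial>lborel) \<le>
      ennreal (C * (weighted_Lp_norm a m f)\<^sup>2 * R powr ?q)"
    if f: "f \<in> Lp_space 2" and fw: "f \<in> weighted_Lp_space a m" and R: "0 < R"
    for f :: "real ^ 'n \<Rightarrow> complex" and R
  proof -
    have [measurable]: "f \<in> borel_measurable borel" "cball 0 s \<in> sets (borel :: (real ^ 'n) measure)" for s
      using f by (auto simp: Lp_space_def)
    define G where "G = weighted_Lp_norm a m f"
    define g where "g x = norm x powr a * norm (f x)" for x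
    have [measurable]: "g \<in> borel_measurable borel" unfolding g_def by measurable
    have gG: "(\<integral>\<^sup>+x. ennreal (g x powr m) \<partial>lborel) = ennreal (G powr m)"
      using weighted_Lp_norm_powr[OF fw] m by (simp add: g_def G_def)
    have g0: "0 \<le> g x" for x by (simp add: g_def)
    show ?thesis
    proof (cases "G = 0")
      case True
      then have "AE x in lborel. ennreal (g x powr m) = 0"
        using gG by (intro nn_integral_0_iff_AE[THEN iffD1]) auto
      then have "AE x in lborel. f x = 0"
        using AE_lborel_singleton[of "0::real ^ 'n"] by eventually_elim (auto simp: g_def)
      then have "Lp_norm 2 f = Lp_norm 2 (\<lambda>x::real ^ 'n. 0)" by (intro Lp_norm_cong_AE) auto
      then have "Lp_norm 2 (fourier f) = 0" using plancherel[OF f] by (simp add: Lp_norm_2_eq)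
      from Lp_norm_2_zero_AE[OF fourier_Lp_space[OF f] this]
      have "(\<integral>\<^sup>+\<xi>. ennreal ((norm (fourier f \<xi>))\<^sup>2) * indicator (cball 0 R) \<xi> \<partial>lborel) = (\<integral>\<^sup>+\<xi>. 0 \<partial>(lborel :: (real ^ 'n) measure))"
        by (intro nn_integral_cong_AE) (auto elim: eventually_mono)
      then show ?thesis by simp
    next
      case False
      then have G: "0 < G" using weighted_Lp_norm_nonneg[of a m f] unfolding G_def by linarith
      \<comment> \<open>The size of the L^m' norm of |x|^(-a) on the ball of radius 1/R, up to a
        factor depending on \<open>CV\<close>.\<close>
      define W where "W = R powr (a - ?n / m')"
      have W: "0 < W" using R by (simp add: W_def)
      \<comment> \<open>The level balances the parts: the tail above \<open>l\<close> has L^1 norm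
        of the same order G W as the part on the ball, and the remainder has squared L^2 norm of the
        order of the claimed bound. Both identities are \<open>lG\<close>.\<close>
      define l where "l = G * R powr (a + ?n / m)"
      have l: "0 < l" using G R by (simp add: l_def)
      define S where "S = cball 0 (1 / R) \<union> {x. l < norm (f x)}"
      have [measurable]: "{x. l < norm (f x)} \<in> sets borel" by measurable
      have [measurable]: "S \<in> sets borel" unfolding S_def by measurable
      have lG: "l powr (1 - m) * R powr (a * m) * G powr m = G * W"
        "l powr (2 - m) * R powr (a * m) * G powr m = G\<^sup>2 * R powr ?q"
      proof -
        have 1: "(a + ?n / m) * (1 - m) + a * m = a - ?n / m'" "(a + ?n / m) * (2 - m) + a * m = ?q"
          unfolding nm' using m by (auto simp: field_simps)
        have "l powr (1 - m) * R powr (a * m) * G powr m = (G powr (1 - m) * G powr m) * (R powr ((a + ?n / m) * (1 - m)) * R powr (a * m))"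
          using G R by (simp add: l_def powr_mult powr_powr)
        then show "l powr (1 - m) * R powr (a * m) * G powr m = G * W"
          using G R 1 by (simp add: W_def flip: powr_add)
        have "l powr (2 - m) * R powr (a * m) * G powr m = (G powr (2 - m) * G powr m) * (R powr ((a + ?n / m) * (2 - m)) * R powr (a * m))"
          using G R by (simp add: l_def powr_mult powr_powr)
        then show "l powr (2 - m) * R powr (a * m) * G powr m = G\<^sup>2 * R powr ?q"
          using G R unfolding powr_add[symmetric] 1 by simp
      qed
      have fg: "norm (f x) powr m \<le> R powr (a * m) * g x powr m" if "1 / R \<le> norm x" for x
      proof -
        have x: "0 < norm x" using that R by (smt (verit) divide_pos_pos)
        have "1 \<le> (R * norm x) powr (a * m)"
          using that R a m by (intro ge_one_powr_ge_zero) (auto simp: field_simps)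
        then have "1 * norm (f x) powr m \<le> (R * norm x) powr (a * m) * norm (f x) powr m"
          by (intro mult_right_mono) auto
        also have "\<dots> = R powr (a * m) * g x powr m"
          using R x by (simp add: g_def powr_mult powr_powr)
        finally show ?thesis by simp
      qed
      \<comment> \<open>Hoelder's inequality in pointwise form: Young's inequality after dividing
        the two factors by \<open>G\<close> and \<open>W\<close>.\<close>
      have pt1: "norm (f x) * indicator S x \<le> G * W * ((g x / G) powr m + (norm x powr (- a) / W) powr m' * indicator (cball 0 (1 / R)) x)
          + l powr (1 - m) * R powr (a * m) * g x powr m" if x0: "x \<noteq> 0" for x
      proof (cases "norm x \<le> 1 / R")
        case True
        have "norm (f x) = G * W * ((g x / G) * (norm x powr (- a) / W))"
          using G W x0 by (simp add: g_def powr_minus)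
        also have "\<dots> \<le> G * W * ((g x / G) powr m / m + (norm x powr (- a) / W) powr m' / m')"
          using m m' G W g0[of x] by (intro mult_left_mono Youngs_inequality) auto
        also have "\<dots> \<le> G * W * ((g x / G) powr m + (norm x powr (- a) / W) powr m')"
          using m m' G W by (intro mult_left_mono add_mono) (auto simp: divide_le_eq mult_le_cancel_left1)
        finally show ?thesis using True by (simp add: indicator_def S_def add_increasing2)
      next
        case False
        then have fm: "norm (f x) powr m \<le> R powr (a * m) * g x powr m" by (intro fg) simp
        have "norm (f x) * indicator S x \<le> l powr (1 - m) * R powr (a * m) * g x powr m"
        proof (cases "l < norm (f x)")
          case True
          \<comment> \<open>The exponent 1 - m is negative, so |f| > l gives |f|^(1-m) \<le>
            l^(1-m). In \<open>pt2\<close> the exponent 2 - m is positive and |f| \<le> l is used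
            instead.\<close>
          then have "norm (f x) = norm (f x) powr (1 - m) * norm (f x) powr m"
            using l by (simp flip: powr_add)
          also have "\<dots> \<le> l powr (1 - m) * (R powr (a * m) * g x powr m)"
            using True l m fm by (intro mult_mono powr_mono2') auto
          finally show ?thesis using False True by (simp add: indicator_def S_def mult_ac)
        qed (use False in \<open>simp add: indicator_def S_def\<close>)
        then show ?thesis using G W by (simp add: add_increasing)
      qed
      have pt2: "(norm (f x))\<^sup>2 * indicator (- S) x \<le> l powr (2 - m) * R powr (a * m) * g x powr m" for x
      proof (cases "x \<in> S \<or> f x = 0")
        case False
        then have x: "1 / R < norm x" "norm (f x) \<le> l" "0 < norm (f x)" by (auto simp: S_def)
        then have "(norm (f x))\<^sup>2 = norm (f x) powr (2 - m) * norm (f x) powr m"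
          by (simp flip: powr_add)
        also have "\<dots> \<le> l powr (2 - m) * (R powr (a * m) * g x powr m)"
          using x l m fg[of x] by (intro mult_mono powr_mono2) auto
        finally show ?thesis using False by (simp add: mult_ac)
      qed auto
      have V1: "(\<integral>\<^sup>+x. ennreal ((norm x powr (- a) / W) powr m') * indicator (cball 0 (1 / R)) x \<partial>(lborel :: (real ^ 'n) measure)) \<le> ennreal CV"
      proof -
        have "(\<integral>\<^sup>+x. ennreal ((norm x powr (- a) / W) powr m') * indicator (cball 0 (1 / R)) x \<partial>(lborel :: (real ^ 'n) measure))
            = (\<integral>\<^sup>+x. ennreal (W powr (- m')) * (ennreal (norm x powr (- (a * m'))) * 1 * indicator (cball 0 (1 / R)) x) \<partial>(lborel :: (real ^ 'n) measure))"
        proof (intro nn_integral_cong)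
          fix x :: "real ^ 'n"
          have "(norm x powr (- a) / W) powr m' = W powr (- m') * norm x powr (- (a * m'))"
            using W by (subst powr_divide) (auto simp: powr_powr powr_minus[of _ m'] divide_inverse)
          then show "ennreal ((norm x powr (- a) / W) powr m') * indicator (cball 0 (1 / R)) x =
              ennreal (W powr (- m')) * (ennreal (norm x powr (- (a * m'))) * 1 * indicator (cball 0 (1 / R)) x)"
            by (simp add: ennreal_mult' mult.assoc)
        qed
        also have "\<dots> = ennreal (W powr (- m')) * (\<integral>\<^sup>+x. ennreal (norm x powr (- (a * m'))) * 1 * indicator (cball 0 (1 / R)) x \<partial>(lborel :: (real ^ 'n) measure))"
          by (rule nn_integral_cmult) measurable
        also have "\<dots> \<le> ennreal (W powr (- m')) * ennreal (CV * (1 / R) powr (?n - a * m'))"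
          using V R by (intro mult_left_mono) (auto simp: ball_growth_def)
        also have "\<dots> = ennreal (W powr (- m') * (CV * (1 / R) powr (?n - a * m')))"
          using CV by (intro ennreal_mult[symmetric]) auto
        also have "W powr (- m') * (CV * (1 / R) powr (?n - a * m')) = CV"
        proof -
          have "W powr (- m') = R powr (?n - a * m')"
          proof -
            have "(a - ?n / m') * (- m') = ?n - a * m'" using m'(1) by (simp add: left_diff_distrib)
            then show ?thesis unfolding W_def powr_powr by simp
          qed
          moreover have "R powr (?n - a * m') * (1 / R) powr (?n - a * m') = 1"
            using R by (simp flip: powr_mult)
          ultimately show ?thesis by simp
        qed
        finally show ?thesis .
      qed
      have "(\<integral>\<^sup>+x. ennreal (norm (f x)) * indicator S x \<partial>lborel) \<le>
          (\<integral>\<^sup>+x. (ennreal (G * W) * ennreal (G powr (- m)) * ennreal (g x powr m) +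
             ennreal (G * W) * (ennreal ((norm x powr (- a) / W) powr m') * indicator (cball 0 (1 / R)) x))
            + ennreal (l powr (1 - m) * R powr (a * m)) * ennreal (g x powr m) \<partial>lborel)"
      proof (rule nn_integral_mono_AE, use AE_lborel_singleton[of "0::real ^ 'n"] in eventually_elim)
        case (elim x)
        have gp: "(g x / G) powr m = G powr (- m) * g x powr m"
          using G g0[of x] by (subst powr_divide) (auto simp: powr_minus divide_inverse)
        from ennreal_leI[OF pt1[OF elim]] show ?case
          unfolding gp using G W l R
          by (simp add: ennreal_mult'[symmetric] ennreal_plus[symmetric] indicator_def distrib_left mult_ac del: ennreal_plus)
            (auto split: if_splits)
      qed
      also have "\<dots> = (ennreal (G * W) * ennreal (G powr (- m)) * ennreal (G powr m) +
             ennreal (G * W) * (\<integral>\<^sup>+x. ennreal ((norm x powr (- a) / W) powr m') * indicator (cball 0 (1 / R)) x \<partial>(lborel :: (real ^ 'n) measure)))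
            + ennreal (l powr (1 - m) * R powr (a * m)) * ennreal (G powr m)"
        by (simp add: nn_integral_add nn_integral_cmult gG)
      also have "\<dots> \<le> (ennreal (G * W) * ennreal (G powr (- m)) * ennreal (G powr m) +
             ennreal (G * W) * ennreal CV) + ennreal (l powr (1 - m) * R powr (a * m)) * ennreal (G powr m)"
        by (intro add_mono mult_left_mono V1) auto
      also have "\<dots> = ennreal (G * W * (G powr (- m) * G powr m) + G * W * CV + l powr (1 - m) * R powr (a * m) * G powr m)"
        using G W CV by (simp add: ennreal_mult'[symmetric] ennreal_plus[symmetric] mult_ac del: ennreal_plus)
      also have "G * W * (G powr (- m) * G powr m) + G * W * CV + l powr (1 - m) * R powr (a * m) * G powr m = G * W * (2 + CV)"
        unfolding lG(1) using G by (simp add: algebra_simps flip: powr_add)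
      finally have L1: "(\<integral>\<^sup>+x. ennreal (norm (f x)) * indicator S x \<partial>lborel) \<le> ennreal (G * W * (2 + CV))" .
      have "(\<integral>\<^sup>+x. ennreal ((norm (f x))\<^sup>2) * indicator (- S) x \<partial>lborel) \<le>
          (\<integral>\<^sup>+x. ennreal (l powr (2 - m) * R powr (a * m)) * ennreal (g x powr m) \<partial>lborel)"
      proof (rule nn_integral_mono)
        fix x show "ennreal ((norm (f x))\<^sup>2) * indicator (- S) x \<le>
            ennreal (l powr (2 - m) * R powr (a * m)) * ennreal (g x powr m)"
          using ennreal_leI[OF pt2[of x]] l R by (cases "x \<in> S") (auto simp: ennreal_mult'[symmetric])
      qed
      also have "\<dots> = ennreal (l powr (2 - m) * R powr (a * m) * G powr m)"
        by (simp add: nn_integral_cmult gG ennreal_mult')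
      finally have L2: "(\<integral>\<^sup>+x. ennreal ((norm (f x))\<^sup>2) * indicator (- S) x \<partial>lborel) \<le> ennreal (G\<^sup>2 * R powr ?q)"
        unfolding lG(2) .
      have "(\<integral>\<^sup>+\<xi>. ennreal ((norm (fourier f \<xi>))\<^sup>2) * indicator (cball 0 R) \<xi> \<partial>lborel) \<le>
          ennreal (split_const TYPE('n) * R powr ?n * (G * W * (2 + CV))\<^sup>2) +
          2 * (\<integral>\<^sup>+x. ennreal ((norm (f x))\<^sup>2) * indicator (- S) x \<partial>lborel)"
        using G W CV by (intro fourier_ball_split f R L1) auto
      also have "\<dots> \<le> ennreal (split_const TYPE('n) * R powr ?n * (G * W * (2 + CV))\<^sup>2) +
          2 * ennreal (G\<^sup>2 * R powr ?q)" by (intro add_left_mono mult_left_mono L2) simp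
      also have "\<dots> = ennreal (split_const TYPE('n) * R powr ?n * (G * W * (2 + CV))\<^sup>2 + 2 * (G\<^sup>2 * R powr ?q))"
        using split_const_nonneg[where 'n='n] by (simp add: ennreal_mult' ennreal_numeral[symmetric] del: ennreal_numeral)
      also have "split_const TYPE('n) * R powr ?n * (G * W * (2 + CV))\<^sup>2 + 2 * (G\<^sup>2 * R powr ?q) = C * G\<^sup>2 * R powr ?q"
      proof -
        \<comment> \<open>The volume factor R^n and the squared L^1 norm, of order (G W)^2, combine
          to the same power of R as the L^2 part.\<close>
        have "R powr ?n * W\<^sup>2 = R powr ?q"
          unfolding W_def power2_eq_square powr_add[symmetric] nm' by (simp add: algebra_simps)
        then have "split_const TYPE('n) * R powr ?n * (G * W * (2 + CV))\<^sup>2 = split_const TYPE('n) * (2 + CV)\<^sup>2 * G\<^sup>2 * R powr ?q"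
          by (simp add: power_mult_distrib mult_ac)
        then show ?thesis by (simp add: C_def algebra_simps)
      qed
      finally show ?thesis unfolding G_def .
    qed
  qed
  show ?thesis
  proof (rule that[OF C])
    fix f :: "real ^ 'n \<Rightarrow> complex" assume f: "f \<in> Lp_space 2" "f \<in> weighted_Lp_space a m"
    have [measurable]: "fourier f \<in> borel_measurable borel" by (intro fourier_measurable f)
    show "ball_growth (\<lambda>\<xi>. ennreal ((norm (fourier f \<xi>))\<^sup>2)) (C * (weighted_Lp_norm a m f)\<^sup>2) ?q"
      unfolding ball_growth_def using main[OF f] C by auto
  qed
qed

section \<open>A Hardy inequality on the Fourier side\<close>

lemma powr_square: "((x::real) powr c)\<^sup>2 = x powr (2 * c)"
  by (simp add: power2_eq_square flip: powr_add)

text \<open>The nonzero terms start at the least k with y \<le> 2^k, where the term is at most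
  y^(-s), and decrease geometrically from there.\<close>

lemma sum_tail_geometric:
  fixes s y :: real
  assumes s: "0 < s" and y: "0 < y"
  shows "(\<Sum>k. ennreal ((2 powr (- s))^k * of_bool (y \<le> 2^k))) \<le> ennreal (y powr (- s) / (1 - 2 powr (- s)))"
proof -
  define r where "r = 2 powr (- s)"
  have r: "0 < r" "r < 1" using s powr_less_mono[of "- s" 0 2] by (auto simp: r_def)
  have rk: "r^k = (2^k) powr (- s)" for k :: nat
    by (simp add: r_def powr_power powr_powr mult.commute flip: powr_realpow)
  have le_iff: "r^k \<le> y powr (- s)" if "y \<le> 2^k" for k
    unfolding rk using s y that by (intro powr_mono2') auto
  \<comment> \<open>The subtracted \<open>r^N\<close> makes the induction close. The
    \<open>max 0\<close> is for the indices with 2^N < y, where the sum is 0 but the fraction is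
    negative.\<close>
  have part: "(\<Sum>k<N. r^k * of_bool (y \<le> 2^k)) \<le> max 0 ((y powr (- s) - r^N) / (1 - r))" for N
  proof (induction N)
    case (Suc N)
    show ?case
    proof (cases "y \<le> 2^N")
      case True
      then have "0 \<le> (y powr (- s) - r^N) / (1 - r)" using le_iff[of N] r by simp
      then have "(\<Sum>k<Suc N. r^k * of_bool (y \<le> 2^k)) \<le> (y powr (- s) - r^N) / (1 - r) + r^N"
        using Suc True by simp
      also have "\<dots> = (y powr (- s) - r^Suc N) / (1 - r)" using r by (simp add: field_simps)
      finally show ?thesis by simp
    next
      case False
      have "(\<Sum>k<Suc N. r^k * of_bool (y \<le> 2^k)) = 0"
      proof (rule sum.neutral, clarify)
        fix k assume "k < Suc N"
        then have "(2::real)^k \<le> 2^N" by simp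
        then have "\<not> y \<le> 2^k" using False by linarith
        then show "r^k * of_bool (y \<le> 2^k) = 0" by simp
      qed
      then show ?thesis by simp
    qed
  qed simp
  have "(\<Sum>k. ennreal (r^k * of_bool (y \<le> 2^k))) \<le> ennreal (y powr (- s) / (1 - r))"
    unfolding suminf_eq_SUP
  proof (rule SUP_least)
    fix N
    have "(y powr (- s) - r^N) / (1 - r) \<le> y powr (- s) / (1 - r)"
      using r by (intro divide_right_mono) auto
    moreover have "0 \<le> y powr (- s) / (1 - r)" using r by simp
    ultimately have "(\<Sum>k<N. r^k * of_bool (y \<le> 2^k)) \<le> y powr (- s) / (1 - r)"
      using part[of N] by linarith
    then show "(\<Sum>k<N. ennreal (r^k * of_bool (y \<le> 2^k))) \<le> ennreal (y powr (- s) / (1 - r))"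
      using r by (simp add: ennreal_leI)
  qed
  then show ?thesis by (simp add: r_def)
qed

text \<open>An increasing geometric sum is comparable to its last term, here at the last k with 2^k
  < y, where the term is below y^s.\<close>

lemma sum_head_geometric:
  fixes s y :: real
  assumes s: "0 < s" and y: "0 < y"
  shows "(\<Sum>k. ennreal ((2 powr s)^k * of_bool (2^k < y))) \<le> ennreal (2 powr s / (2 powr s - 1) * y powr s)"
proof -
  define d where "d = 2 powr s"
  have d: "1 < d" using s powr_less_mono[of 0 s 2] by (auto simp: d_def)
  have dk: "d^k = (2^k) powr s" for k :: nat
    by (simp add: d_def powr_power powr_powr mult.commute flip: powr_realpow)
  have part: "(\<Sum>k<N. d^k * of_bool (2^k < y)) \<le> d / (d - 1) * y powr s" for N
  proof (induction N)
    case 0 show ?case using d by simp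
  next
    case (Suc N)
    show ?case
    proof (cases "2^N < y")
      case True
      have "(\<Sum>k<Suc N. d^k * of_bool (2^k < y)) \<le> (\<Sum>k<Suc N. d^k)" using d by (intro sum_mono) auto
      also have "\<dots> = (d^Suc N - 1) / (d - 1)" using d by (subst geometric_sum) auto
      also have "\<dots> \<le> d^Suc N / (d - 1)" using d by (intro divide_right_mono) auto
      also have "d^Suc N = d * (2^N) powr s" by (simp add: dk[symmetric])
      also have "d * (2^N) powr s / (d - 1) \<le> d * y powr s / (d - 1)"
        using True d s by (intro divide_right_mono mult_left_mono powr_mono2) auto
      finally show ?thesis by simp
    qed (use Suc in simp)
  qed
  have "(\<Sum>k. ennreal (d^k * of_bool (2^k < y))) \<le> ennreal (d / (d - 1) * y powr s)"
    unfolding suminf_eq_SUP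
    by (rule SUP_least) (use part d in \<open>simp add: ennreal_leI\<close>)
  then show ?thesis by (simp add: d_def)
qed

text \<open>In each frequency shell of radius \<open>2\<^sup>-\<^sup>k\<close> the function is
  split at \<open>|x| = 2\<^sup>k\<close>; an auxiliary weight exponent \<open>b\<close> strictly between \<open>a\<close> and \<open>n/2\<close> makes both resulting
  sums over \<open>k\<close> geometric.\<close>

lemma hardy_low_frequency:
  fixes a :: real
  assumes a: "0 < a" "2 * a < real CARD('n::finite)"
  obtains C where "0 < C" and "\<And>f :: real ^ 'n \<Rightarrow> complex. f \<in> Lp_space 2 \<Longrightarrow> f \<in> weighted_Lp_space a 2 \<Longrightarrow>
    (\<integral>\<^sup>+\<xi>. ennreal (norm \<xi> powr (- (2 * a))) * ennreal ((norm (fourier f \<xi>))\<^sup>2) * indicator (cball 0 1) \<xi> \<partial>lborel)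
      \<le> ennreal (C * (weighted_Lp_norm a 2 f)\<^sup>2)"
proof -
  let ?n = "real CARD('n)"
  \<comment> \<open>The condition b < n/2 makes |x|^(-2b) locally integrable for Cauchy-Schwarz on
    balls; b > a makes the ratio \<open>r\<close> less than 1.\<close>
  obtain b where b: "a < b" "2 * b < ?n" using dense[of a "?n / 2"] a by auto
  define CV where "CV = (1 + 2 powr (- (- (2 * b)))) / (1 - 2 powr (- (?n + - (2 * b)))) * unit_ball_vol ?n"
  have V: "ball_growth (\<lambda>x::real ^ 'n. ennreal (norm x powr (- (2 * b))) * 1) CV (?n - 2 * b)"
    using ball_growth_weight[OF ball_growth_one[where 'a="real ^ 'n"], of "- (2 * b)"] b by (simp add: CV_def)
  then have CV: "0 \<le> CV" by (simp add: ball_growth_def)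
  define K where "K = split_const TYPE('n) * CV"
  have K: "0 \<le> K" using CV split_const_nonneg[where 'n='n] by (simp add: K_def)
  define M where "M = 2 powr (2 * a)"
  define r where "r = 2 powr (- (2 * (b - a)))"
  have r: "0 < r" "r < 1" using b powr_less_mono[of "- (2 * (b - a))" 0 2] by (auto simp: r_def)
  have M: "1 < M" using a powr_less_mono[of 0 "2 * a" 2] by (simp add: M_def)
  define C where "C = 1 + M * (K / (1 - r) + 2 * (M / (M - 1)))"
  have C: "0 < C" using K M r by (auto simp: C_def intro!: add_pos_nonneg mult_nonneg_nonneg)
  have "(\<integral>\<^sup>+\<xi>. ennreal (norm \<xi> powr (- (2 * a))) * ennreal ((norm (fourier f \<xi>))\<^sup>2) * indicator (cball 0 1) \<xi> \<partial>lborel)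
      \<le> ennreal (C * (weighted_Lp_norm a 2 f)\<^sup>2)"
    if f: "f \<in> Lp_space 2" and fw: "f \<in> weighted_Lp_space a 2" for f :: "real ^ 'n \<Rightarrow> complex"
  proof -
    have [measurable]: "f \<in> borel_measurable borel" "fourier f \<in> borel_measurable borel"
        "cball 0 s \<in> sets (borel :: (real ^ 'n) measure)" for s
      using f fourier_measurable[OF f] by (auto simp: Lp_space_def)
    define B where "B k = (\<integral>\<^sup>+x. ennreal (norm x powr (2 * b) * (norm (f x))\<^sup>2) * indicator (cball 0 (2^k)) x \<partial>lborel)" for k :: nat
    define T where "T k = (\<integral>\<^sup>+x. ennreal ((norm (f x))\<^sup>2) * indicator (- cball 0 (2^k)) x \<partial>lborel)" for k :: nat
    let ?E = "\<lambda>k. \<integral>\<^sup>+\<xi>. ennreal ((norm (fourier f \<xi>))\<^sup>2) * indicator (cball 0 (1 * (1/2)^k)) \<xi> \<partial>lborel"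
    \<comment> \<open>The inner part enters through its L^1 norm, which Cauchy-Schwarz bounds by the
      norms of |x|^b f and |x|^(-b) on the ball of radius 2^k. The volume 2^(-kn) of the frequency
      ball leaves the factor 2^(-2bk).\<close>
    have E: "?E k \<le> ennreal (K * (2 powr (- (2 * b)))^k) * B k + 2 * T k" for k :: nat
    proof -
      let ?S = "cball 0 (2^k) :: (real ^ 'n) set"
      define u where "u x = complex_of_real (norm x powr b * norm (f x) * indicator ?S x)" for x
      define v where "v x = complex_of_real (norm x powr (- b) * indicator ?S x)" for x :: "real ^ 'n"
      have [measurable]: "u \<in> borel_measurable borel" "v \<in> borel_measurable borel"
        unfolding u_def v_def by measurable
      have u: "u \<in> Lp_space 2"
      proof (rule Lp_space_2_bound(1)[OF Lp_space_2_scaleR[OF f, of "(2^k) powr b"]])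
        show "AE x in lborel. norm (u x) \<le> norm ((2^k) powr b *\<^sub>R f x)"
          using a b by (auto simp: u_def norm_mult indicator_def intro!: AE_I2 mult_right_mono powr_mono2)
      qed measurable
      have u2: "ennreal ((Lp_norm 2 u)\<^sup>2) = B k"
        unfolding ennreal_Lp_norm_2_power2[OF u] B_def
        by (intro nn_integral_cong)
          (auto simp: u_def norm_mult indicator_def power_mult_distrib powr_square)
      have v2: "(\<integral>\<^sup>+x. ennreal ((norm (v x))\<^sup>2) \<partial>lborel) \<le> ennreal (CV * (2^k) powr (?n - 2 * b))"
      proof -
        have "(\<integral>\<^sup>+x. ennreal ((norm (v x))\<^sup>2) \<partial>lborel) =
            (\<integral>\<^sup>+x. ennreal (norm x powr (- (2 * b))) * 1 * indicator ?S x \<partial>lborel)"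
          by (intro nn_integral_cong)
            (auto simp: v_def norm_mult indicator_def power_mult_distrib powr_square)
        also have "\<dots> \<le> ennreal (CV * (2^k) powr (?n - 2 * b))" using V by (auto simp: ball_growth_def)
        finally show ?thesis .
      qed
      then have v: "v \<in> Lp_space 2" by (intro Lp_space_2_I[of v]) auto
      have vn: "(Lp_norm 2 v)\<^sup>2 \<le> CV * (2^k) powr (?n - 2 * b)"
        using v2 CV by (simp add: ennreal_Lp_norm_2_power2[OF v, symmetric])
      define L where "L = L2_inner u v"
      have uv: "AE x in lborel. norm (f x) * indicator ?S x = u x \<bullet> v x"
        using AE_lborel_singleton[of "0::real ^ 'n"]
      proof eventually_elim
        case (elim x)
        have 1: "norm x powr b * norm x powr (- b) = 1" using elim by (simp flip: powr_add)
        have "norm x powr b * norm (f x) * norm x powr (- b) = norm (f x) * (norm x powr b * norm x powr (- b))"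
          by (simp only: mult_ac)
        then show ?case unfolding 1 by (cases "x \<in> ?S") (auto simp: u_def v_def inner_complex_def)
      qed
      have uvL: "(\<integral>\<^sup>+x. ennreal (u x \<bullet> v x) \<partial>lborel) = ennreal L"
        unfolding L_def L2_inner_def
        by (intro nn_integral_eq_integral integrable_inner_L2 u v) (auto simp: u_def v_def inner_complex_def)
      have L0: "0 \<le> L" unfolding L_def L2_inner_def
        by (intro Bochner_Integration.integral_nonneg) (auto simp: u_def v_def inner_complex_def)
      have "(\<integral>\<^sup>+x. ennreal (norm (f x)) * indicator ?S x \<partial>lborel) = (\<integral>\<^sup>+x. ennreal (norm (f x) * indicator ?S x) \<partial>lborel)"
        by (intro nn_integral_cong) (auto simp: indicator_def)
      also have "\<dots> = ennreal L"
        unfolding uvL[symmetric] by (rule nn_integral_cong_AE, use uv in eventually_elim) simp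
      finally have "(\<integral>\<^sup>+x. ennreal (norm (f x)) * indicator ?S x \<partial>lborel) \<le> ennreal L" by simp
      then have "?E k \<le> ennreal (split_const TYPE('n) * (1 * (1/2)^k) powr ?n * L\<^sup>2) + 2 * T k"
        unfolding T_def using L0 by (intro fourier_ball_split f) auto
      also have "split_const TYPE('n) * (1 * (1/2)^k) powr ?n * L\<^sup>2 \<le>
          split_const TYPE('n) * (1 * (1/2)^k) powr ?n * (CV * (2^k) powr (?n - 2 * b) * (Lp_norm 2 u)\<^sup>2)"
      proof (intro mult_left_mono)
        have "L\<^sup>2 \<le> (Lp_norm 2 u * Lp_norm 2 v)\<^sup>2"
          using L2_Cauchy_Schwarz[OF u v] L0 by (intro power_mono) (auto simp: L_def)
        also have "\<dots> \<le> CV * (2^k) powr (?n - 2 * b) * (Lp_norm 2 u)\<^sup>2"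
          using mult_right_mono[OF vn, of "(Lp_norm 2 u)\<^sup>2"] by (simp add: power_mult_distrib mult_ac)
        finally show "L\<^sup>2 \<le> CV * (2^k) powr (?n - 2 * b) * (Lp_norm 2 u)\<^sup>2" .
      qed (auto simp: split_const_nonneg)
      also have "\<dots> = K * (((1/2)^k) powr ?n * (2^k) powr (?n - 2 * b)) * (Lp_norm 2 u)\<^sup>2"
        by (simp add: K_def mult_ac)
      also have "((1/2)^k) powr ?n * (2^k) powr (?n - 2 * b) = (2 powr (- (2 * b)))^k"
      proof -
        have "(2^k) powr (?n - 2 * b) = (2 powr (?n - 2 * b))^k"
          by (simp add: powr_power powr_powr mult.commute flip: powr_realpow)
        then show ?thesis by (simp add: half_power_powr flip: power_mult_distrib powr_add)
      qed
      also have "ennreal (K * (2 powr (- (2 * b)))^k * (Lp_norm 2 u)\<^sup>2) = ennreal (K * (2 powr (- (2 * b)))^k) * B k"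
        using K by (simp add: ennreal_mult' u2[symmetric])
      finally show ?thesis by (simp add: ennreal_leI add_right_mono)
    qed
    have "(\<integral>\<^sup>+\<xi>. ennreal (norm \<xi> powr (- (2 * a))) * ennreal ((norm (fourier f \<xi>))\<^sup>2) * indicator (cball 0 1) \<xi> \<partial>lborel)
        \<le> (\<Sum>k. ennreal (M * M^k) * ?E k)"
    proof (rule nn_integral_dyadic)
      fix x :: "real ^ 'n" and k
      assume x: "x \<noteq> 0" "1 * (1/2)^(Suc k) < norm x"
      have "norm x powr (- (2 * a)) \<le> ((1/2)^(Suc k)) powr (- (2 * a))"
        using x a by (intro powr_mono2') auto
      also have "\<dots> = M * M^k" unfolding half_power_powr by (simp add: M_def)
      finally show "ennreal (norm x powr (- (2 * a))) \<le> ennreal (M * M^k)" by (rule ennreal_leI)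
    qed auto
    also have "\<dots> \<le> (\<Sum>k. ennreal (M * M^k) * (ennreal (K * (2 powr (- (2 * b)))^k) * B k + 2 * T k))"
      by (intro suminf_le mult_left_mono E) auto
    also have "\<dots> = (\<Sum>k. \<integral>\<^sup>+x. ennreal (M * (K * (r^k * (norm x powr (2 * b) * (norm (f x))\<^sup>2 * of_bool (norm x \<le> 2^k)))
        + 2 * (M^k * ((norm (f x))\<^sup>2 * of_bool (2^k < norm x))))) \<partial>lborel)"
    proof (intro suminf_cong)
      fix k
      \<comment> \<open>The frequency weight grows like 2^(2ak) on the k-th shell and turns the
        decay 2^(-2bk) into r^k with r = 2^(-2(b-a)).\<close>
      have rM: "M^k * (2 powr (- (2 * b)))^k = r^k"
        by (simp add: M_def r_def right_diff_distrib flip: power_mult_distrib powr_add)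
      have "ennreal (M * M^k) * (ennreal (K * (2 powr (- (2 * b)))^k) * B k + 2 * T k) =
          (\<integral>\<^sup>+x. ennreal (M * M^k) * (ennreal (K * (2 powr (- (2 * b)))^k) *
             (ennreal (norm x powr (2 * b) * (norm (f x))\<^sup>2) * indicator (cball 0 (2^k)) x) +
             2 * (ennreal ((norm (f x))\<^sup>2) * indicator (- cball 0 (2^k)) x)) \<partial>lborel)"
        unfolding B_def T_def by (simp add: nn_integral_cmult nn_integral_add)
      also have "\<dots> = (\<integral>\<^sup>+x. ennreal (M * (K * (r^k * (norm x powr (2 * b) * (norm (f x))\<^sup>2 * of_bool (norm x \<le> 2^k)))
        + 2 * (M^k * ((norm (f x))\<^sup>2 * of_bool (2^k < norm x))))) \<partial>lborel)"
      proof (intro nn_integral_cong)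
        fix x :: "real ^ 'n"
        show "ennreal (M * M^k) * (ennreal (K * (2 powr (- (2 * b)))^k) *
             (ennreal (norm x powr (2 * b) * (norm (f x))\<^sup>2) * indicator (cball 0 (2^k)) x) +
             2 * (ennreal ((norm (f x))\<^sup>2) * indicator (- cball 0 (2^k)) x)) =
          ennreal (M * (K * (r^k * (norm x powr (2 * b) * (norm (f x))\<^sup>2 * of_bool (norm x \<le> 2^k)))
            + 2 * (M^k * ((norm (f x))\<^sup>2 * of_bool (2^k < norm x)))))"
          unfolding rM[symmetric] using M K
          by (cases "norm x \<le> 2^k")
            (auto simp: ennreal_mult'[symmetric] ennreal_numeral[symmetric] mult_ac simp del: ennreal_numeral)
      qed
      finally show "ennreal (M * M^k) * (ennreal (K * (2 powr (- (2 * b)))^k) * B k + 2 * T k) =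
          (\<integral>\<^sup>+x. ennreal (M * (K * (r^k * (norm x powr (2 * b) * (norm (f x))\<^sup>2 * of_bool (norm x \<le> 2^k)))
        + 2 * (M^k * ((norm (f x))\<^sup>2 * of_bool (2^k < norm x))))) \<partial>lborel)" .
    qed
    also have "\<dots> = (\<integral>\<^sup>+x. (\<Sum>k. ennreal (M * (K * (r^k * (norm x powr (2 * b) * (norm (f x))\<^sup>2 * of_bool (norm x \<le> 2^k)))
        + 2 * (M^k * ((norm (f x))\<^sup>2 * of_bool (2^k < norm x)))))) \<partial>lborel)"
      by (rule nn_integral_suminf[symmetric]) measurable
    also have "\<dots> \<le> (\<integral>\<^sup>+x. ennreal C * ennreal ((norm x powr a * norm (f x)) powr 2) \<partial>lborel)"
    proof (rule nn_integral_mono_AE, use AE_lborel_singleton[of "0::real ^ 'n"] in eventually_elim)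
      case (elim x)
      define y where "y = norm x"
      define F where "F = (norm (f x))\<^sup>2"
      have y: "0 < y" and F: "0 \<le> F" using elim by (auto simp: y_def F_def)
      have "(\<Sum>k. ennreal (M * (K * (r^k * (y powr (2 * b) * F * of_bool (y \<le> 2^k))) + 2 * (M^k * (F * of_bool (2^k < y))))))
        = (\<Sum>k. ennreal (M * K * y powr (2 * b) * F) * ennreal (r^k * of_bool (y \<le> 2^k)) +
              ennreal (2 * M * F) * ennreal (M^k * of_bool (2^k < y)))"
        using M K F r by (intro suminf_cong)
          (simp add: ennreal_mult'[symmetric] ennreal_plus[symmetric] algebra_simps del: ennreal_plus)
      also have "\<dots> = ennreal (M * K * y powr (2 * b) * F) * (\<Sum>k. ennreal (r^k * of_bool (y \<le> 2^k))) +
              ennreal (2 * M * F) * (\<Sum>k. ennreal (M^k * of_bool (2^k < y)))"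
        by (simp add: suminf_add[symmetric] ennreal_suminf_cmult)
      \<comment> \<open>For fixed \<open>x\<close> the inner parts sum over 2^k \<ge> |x| with a
        ratio below 1, the outer parts over 2^k < |x| with a ratio above 1. Both sums are governed
        by the indices with 2^k near |x| and produce |x|^(2a) |f|^2.\<close>
      also have "\<dots> \<le> ennreal (M * K * y powr (2 * b) * F) * ennreal (y powr (- (2 * (b - a))) / (1 - r)) +
              ennreal (2 * M * F) * ennreal (M / (M - 1) * y powr (2 * a))"
        unfolding r_def M_def
        by (intro add_mono mult_left_mono sum_tail_geometric sum_head_geometric) (use a b y in simp_all)
      also have "\<dots> = ennreal (M * K * y powr (2 * b) * F * (y powr (- (2 * (b - a))) / (1 - r)) + 2 * M * F * (M / (M - 1) * y powr (2 * a)))"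
        using M K F r by (simp add: ennreal_mult'[symmetric] ennreal_plus[symmetric] del: ennreal_plus)
      also have "\<dots> \<le> ennreal (C * (y powr (2 * a) * F))"
      proof (rule ennreal_leI)
        have "y powr (2 * b) * y powr (- (2 * (b - a))) = y powr (2 * a)"
          using y by (simp add: algebra_simps flip: powr_add)
        then have "M * (K / (1 - r)) * ((y powr (2 * b) * y powr (- (2 * (b - a)))) * F) + M * (2 * (M / (M - 1))) * (y powr (2 * a) * F)
            = (C - 1) * (y powr (2 * a) * F)"
          by (simp add: C_def distrib_left distrib_right)
        moreover have "M * K * y powr (2 * b) * F * (y powr (- (2 * (b - a))) / (1 - r)) + 2 * M * F * (M / (M - 1) * y powr (2 * a))
            = M * (K / (1 - r)) * ((y powr (2 * b) * y powr (- (2 * (b - a)))) * F) + M * (2 * (M / (M - 1))) * (y powr (2 * a) * F)"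
          by (simp only: times_divide_eq_right times_divide_eq_left mult_ac)
        ultimately have "M * K * y powr (2 * b) * F * (y powr (- (2 * (b - a))) / (1 - r)) + 2 * M * F * (M / (M - 1) * y powr (2 * a))
            = (C - 1) * (y powr (2 * a) * F)" by simp
        also have "\<dots> \<le> C * (y powr (2 * a) * F)" using F by (intro mult_right_mono) auto
        finally show "M * K * y powr (2 * b) * F * (y powr (- (2 * (b - a))) / (1 - r)) + 2 * M * F * (M / (M - 1) * y powr (2 * a))
            \<le> C * (y powr (2 * a) * F)" .
      qed
      also have "\<dots> = ennreal C * ennreal ((norm x powr a * norm (f x)) powr 2)"
        using C by (simp add: ennreal_mult' y_def F_def power_mult_distrib powr_square)
      finally show ?case by (simp only: y_def F_def)
    qed
    also have "\<dots> = ennreal C * (\<integral>\<^sup>+x. ennreal ((norm x powr a * norm (f x)) powr 2) \<partial>lborel)"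
      by (rule nn_integral_cmult) measurable
    also have "\<dots> = ennreal C * ennreal (weighted_Lp_norm a 2 f powr 2)"
      by (subst weighted_Lp_norm_powr[OF fw]) auto
    also have "\<dots> = ennreal (C * (weighted_Lp_norm a 2 f)\<^sup>2)" using C by (simp add: ennreal_mult')
    finally show ?thesis .
  qed
  then show ?thesis using that C by blast
qed

subsection \<open>The damped oscillator\<close>

text \<open>Instantiated with b = |\<xi>|^(2\<delta>) and c = |\<xi>|^(2\<sigma>). Derivatives are
  taken within \<open>{0..}\<close>, hence one-sided at 0 as in \<open>is_solution\<close>. All
  estimates concern an arbitrary trajectory rather than a formula.\<close>

locale damped_oscillator =
  fixes b c :: real and z z' z'' :: "real \<Rightarrow> complex"
  assumes b: "0 \<le> b" and c: "0 \<le> c"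
    and z: "\<And>t. 0 \<le> t \<Longrightarrow> (z has_vector_derivative z' t) (at t within {0..})"
    and z': "\<And>t. 0 \<le> t \<Longrightarrow> (z' has_vector_derivative z'' t) (at t within {0..})"
    and ode: "\<And>t. 0 \<le> t \<Longrightarrow> z'' t + b *\<^sub>R z' t + c *\<^sub>R z t = 0"

lemma has_real_derivative_inner:
  fixes p q :: "real \<Rightarrow> complex"
  assumes "(p has_vector_derivative p') (at t within S)" "(q has_vector_derivative q') (at t within S)"
  shows "((\<lambda>t. p t \<bullet> q t) has_real_derivative (p t \<bullet> q' + p' \<bullet> q t)) (at t within S)"
  unfolding has_real_derivative_iff_has_vector_derivative
  by (rule bounded_bilinear.has_vector_derivative[OF bounded_bilinear_inner assms])

text \<open>The function exp(k t) \<phi>(t) has a nonpositive derivative. With k = 0 this is plain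
  monotonicity, as used in \<open>energy_le\<close>.\<close>

lemma gronwall_decay:
  fixes \<phi> D :: "real \<Rightarrow> real"
  assumes \<phi>: "\<And>t. 0 \<le> t \<Longrightarrow> (\<phi> has_real_derivative D t) (at t within {0..})"
    and D: "\<And>t. 0 \<le> t \<Longrightarrow> D t \<le> - k * \<phi> t" and t: "0 \<le> t"
  shows "\<phi> t \<le> exp (- (k * t)) * \<phi> 0"
proof -
  let ?\<psi> = "\<lambda>t. exp (k * t) * \<phi> t"
  have \<psi>: "(?\<psi> has_real_derivative (exp (k * s) * D s + exp (k * s) * k * \<phi> s)) (at s within {0..})"
    if "0 \<le> s" for s
    using \<phi>[OF that] by (auto intro!: derivative_eq_intros)
  have "?\<psi> t \<le> ?\<psi> 0"
  proof (rule DERIV_nonpos_imp_decreasing_open[OF t])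
    show "continuous_on {0..t} ?\<psi>"
      by (rule DERIV_continuous_on[OF DERIV_subset[OF \<psi>]]) auto
    fix s assume s: "0 < s" "s < t"
    have "exp (k * s) * D s + exp (k * s) * k * \<phi> s = exp (k * s) * (D s + k * \<phi> s)"
      by (simp add: algebra_simps)
    also have "\<dots> \<le> 0" using D[of s] s by (intro mult_nonneg_nonpos) auto
    finally show "\<exists>y. (?\<psi> has_real_derivative y) (at s) \<and> y \<le> 0"
      using \<psi>[of s] s at_within_interior[of s "{0..}"] by (auto simp: interior_real_atLeast)
  qed
  then have "exp (- (k * t)) * (exp (k * t) * \<phi> t) \<le> exp (- (k * t)) * \<phi> 0"
    by (intro mult_left_mono) auto
  then show ?thesis by (simp add: mult.assoc[symmetric] flip: exp_add)
qed

context damped_oscillator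
begin

lemma z''_eq: "0 \<le> t \<Longrightarrow> z'' t = - (b *\<^sub>R z' t + c *\<^sub>R z t)"
  using ode[of t] unfolding eq_neg_iff_add_eq_0 by (simp only: add.assoc)

lemma deriv_z_z: "0 \<le> t \<Longrightarrow> ((\<lambda>t. z t \<bullet> z t) has_real_derivative 2 * (z t \<bullet> z' t)) (at t within {0..})"
  using has_real_derivative_inner[OF z z, of t] by (simp add: inner_commute)

lemma deriv_z_z': "0 \<le> t \<Longrightarrow> ((\<lambda>t. z t \<bullet> z' t) has_real_derivative
    z' t \<bullet> z' t - b * (z t \<bullet> z' t) - c * (z t \<bullet> z t)) (at t within {0..})"
  using has_real_derivative_inner[OF z z', of t]
  by (simp add: z''_eq inner_simps algebra_simps)

lemma deriv_z'_z': "0 \<le> t \<Longrightarrow> ((\<lambda>t. z' t \<bullet> z' t) has_real_derivative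
    - 2 * b * (z' t \<bullet> z' t) - 2 * c * (z t \<bullet> z' t)) (at t within {0..})"
  using has_real_derivative_inner[OF z' z', of t]
  by (simp add: z''_eq inner_simps inner_commute algebra_simps)

lemma energy_le:
  assumes "0 \<le> t"
  shows "(norm (z' t))\<^sup>2 + c * (norm (z t))\<^sup>2 \<le> (norm (z' 0))\<^sup>2 + c * (norm (z 0))\<^sup>2"
proof -
  have "z' t \<bullet> z' t + c * (z t \<bullet> z t) \<le> exp (- (0 * t)) * (z' 0 \<bullet> z' 0 + c * (z 0 \<bullet> z 0))"
  proof (rule gronwall_decay[OF _ _ assms])
    fix t :: real assume t: "0 \<le> t"
    show "((\<lambda>t. z' t \<bullet> z' t + c * (z t \<bullet> z t)) has_real_derivative - 2 * b * (z' t \<bullet> z' t)) (at t within {0..})"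
      using deriv_z'_z'[OF t] deriv_z_z[OF t] by (auto intro!: derivative_eq_intros)
    show "- 2 * b * (z' t \<bullet> z' t) \<le> - 0 * (z' t \<bullet> z' t + c * (z t \<bullet> z t))" using b by simp
  qed
  then show ?thesis by (simp add: power2_norm_eq_inner)
qed

text \<open>The energy bounds the velocity for all times. The resulting Lipschitz bound dominates
  the difference quotients when the time derivative is built in L^2.\<close>

lemma norm_diff_le:
  assumes "0 \<le> s" "0 \<le> t"
  shows "norm (z s - z t) \<le> sqrt ((norm (z' 0))\<^sup>2 + c * (norm (z 0))\<^sup>2) * \<bar>s - t\<bar>"
proof -
  let ?M = "sqrt ((norm (z' 0))\<^sup>2 + c * (norm (z 0))\<^sup>2)"
  have z'_le: "norm (z' t) \<le> ?M" if "0 \<le> t" for t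
  proof (rule real_le_rsqrt)
    show "(norm (z' t))\<^sup>2 \<le> (norm (z' 0))\<^sup>2 + c * (norm (z 0))\<^sup>2"
      using energy_le[OF that] c by (smt (verit) mult_nonneg_nonneg zero_le_power2)
  qed
  have "norm (z s - z t) \<le> ?M * norm (s - t)"
  proof (rule differentiable_bound[where S="{0..}"])
    fix x :: real assume x: "x \<in> {0..}"
    show "(z has_derivative (\<lambda>h. h *\<^sub>R z' x)) (at x within {0..})"
      using z[of x] x by (simp add: has_vector_derivative_def)
    show "onorm (\<lambda>h. h *\<^sub>R z' x) \<le> ?M"
      using z'_le[of x] x by (intro onorm_le) (simp add: mult.commute[of ?M] mult_left_mono)
  qed (use assms in auto)
  then show ?thesis by simp
qed

text \<open>A bound that grows in time but contains no division by \<open>b\<close>, so it stays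
  useful at low frequency for data without a weight.\<close>

lemma norm_le_linear:
  assumes "0 \<le> t"
  shows "norm (z t) \<le> norm (z 0) + t * sqrt ((norm (z' 0))\<^sup>2 + c * (norm (z 0))\<^sup>2)"
  using norm_diff_le[OF assms, of 0] norm_triangle_sub[of "z t" "z 0"] assms by (simp add: mult.commute)

text \<open>The functional \<open>L = |z'|\<^sup>2 + c |z|\<^sup>2 + b z \<bullet> z'\<close> satisfies \<open>L' = - b L\<close> exactly.\<close>

lemma energy_decay_oscillating:
  assumes bc: "b\<^sup>2 \<le> c" and "0 \<le> t"
  shows "(norm (z' t))\<^sup>2 + c * (norm (z t))\<^sup>2 \<le> 3 * exp (- (b * t)) * ((norm (z' 0))\<^sup>2 + c * (norm (z 0))\<^sup>2)"
proof -
  let ?L = "\<lambda>t. z' t \<bullet> z' t + c * (z t \<bullet> z t) + b * (z t \<bullet> z' t)"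
  have L: "?L t \<le> exp (- (b * t)) * ?L 0"
  proof (rule gronwall_decay[OF _ _ \<open>0 \<le> t\<close>])
    fix t :: real assume t: "0 \<le> t"
    show "(?L has_real_derivative (- b * ?L t)) (at t within {0..})"
      using deriv_z'_z'[OF t] deriv_z_z[OF t] deriv_z_z'[OF t]
      by (auto intro!: derivative_eq_intros simp: algebra_simps)
  qed simp
  \<comment> \<open>Because \<open>b\<^sup>2 \<le> c\<close>, the mixed term is at most half of the
    energy, so \<open>?L\<close> lies between 1/2 and 3/2 of it. This explains the constant 3 = 2 *
    (3/2).\<close>
  have ip: "\<bar>b * (z t \<bullet> z' t)\<bar> \<le> (z' t \<bullet> z' t + c * (z t \<bullet> z t)) / 2" for t
  proof -
    have "\<bar>b * (z t \<bullet> z' t)\<bar> \<le> b * (norm (z t) * norm (z' t))"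
      using b Cauchy_Schwarz_ineq2[of "z t" "z' t"] by (simp add: abs_mult mult_left_mono)
    moreover have "2 * (b * norm (z t)) * norm (z' t) \<le> (b * norm (z t))\<^sup>2 + (norm (z' t))\<^sup>2"
      by (rule sum_squares_bound)
    moreover have "b\<^sup>2 * (norm (z t))\<^sup>2 \<le> c * (norm (z t))\<^sup>2" using bc by (intro mult_right_mono) auto
    ultimately show ?thesis by (simp add: power_mult_distrib power2_norm_eq_inner mult.assoc)
  qed
  have aux: "E \<le> 2 * X" if "E + x \<le> X" "\<bar>x\<bar> \<le> E / 2" for E x X :: real using that by linarith
  have le: "exp (- (b * t)) * ?L 0 \<le> exp (- (b * t)) * (3/2 * (z' 0 \<bullet> z' 0 + c * (z 0 \<bullet> z 0)))"
    using ip[of 0] by (intro mult_left_mono) auto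
  have "z' t \<bullet> z' t + c * (z t \<bullet> z t) \<le> 2 * (exp (- (b * t)) * (3/2 * (z' 0 \<bullet> z' 0 + c * (z 0 \<bullet> z 0))))"
    using order_trans[OF L le] ip[of t] by (rule aux)
  then show ?thesis unfolding power2_norm_eq_inner by (simp add: algebra_simps)
qed

text \<open>The functional \<open>?G\<close> is |z' + b z|^2 + |z'|^2 + 2 c |z|^2; in its derivative
  all mixed terms cancel and -2b (|z'|^2 + c |z|^2) remains. For \<open>c \<le> b\<^sup>2\<close>
  this dissipation dominates c/(2b) times \<open>?G\<close>, and taking the square root halves the
  rate to c/(4b), the order c/b of the slow root.\<close>

lemma norm_decay_overdamped:
  assumes b0: "0 < b" and bc: "c \<le> b\<^sup>2" and "0 \<le> t"
  shows "norm (z t) \<le> 3 * exp (- (c / (4 * b) * t)) * (norm (z 0) + norm (z' 0) / b)"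
proof -
  let ?G = "\<lambda>t. 2 * (z' t \<bullet> z' t) + 2 * b * (z t \<bullet> z' t) + (b\<^sup>2 + 2 * c) * (z t \<bullet> z t)"
  let ?D = "\<lambda>t. - 2 * b * (z' t \<bullet> z' t + c * (z t \<bullet> z t))"
  have cross: "2 * b * \<bar>z t \<bullet> z' t\<bar> \<le> b\<^sup>2 * (z t \<bullet> z t) + z' t \<bullet> z' t" for t
  proof -
    have "2 * b * \<bar>z t \<bullet> z' t\<bar> \<le> 2 * b * (norm (z t) * norm (z' t))"
      using b Cauchy_Schwarz_ineq2[of "z t" "z' t"] by (intro mult_left_mono) auto
    also have "\<dots> = 2 * (b * norm (z t)) * norm (z' t)" by simp
    also have "\<dots> \<le> (b * norm (z t))\<^sup>2 + (norm (z' t))\<^sup>2" by (rule sum_squares_bound)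
    finally show ?thesis by (simp add: power_mult_distrib power2_norm_eq_inner)
  qed
  have cb: "c * (z t \<bullet> z t) \<le> b\<^sup>2 * (z t \<bullet> z t)" for t using bc by (intro mult_right_mono) auto
  have ab: "2 * b * (z t \<bullet> z' t) \<le> 2 * b * \<bar>z t \<bullet> z' t\<bar>" for t using b by (intro mult_left_mono) auto
  have Gle: "?G t \<le> 3 * (z' t \<bullet> z' t) + 4 * b\<^sup>2 * (z t \<bullet> z t)" for t
    using cross[of t] cb[of t] ab[of t] unfolding distrib_right by linarith
  have G: "?G t \<le> exp (- (c / (2 * b) * t)) * ?G 0"
  proof (rule gronwall_decay[OF _ _ \<open>0 \<le> t\<close>])
    fix t :: real assume t: "0 \<le> t"
    show "(?G has_real_derivative ?D t) (at t within {0..})"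
      using deriv_z'_z'[OF t] deriv_z_z[OF t] deriv_z_z'[OF t]
      by (auto intro!: derivative_eq_intros simp: algebra_simps power2_eq_square)
    \<comment> \<open>The |z|^2 terms match exactly. For |z'|^2 the coefficient 3c/(2b) is absorbed
      into 2b by c/b \<le> b.\<close>
    have "c / (2 * b) * ?G t \<le> c / (2 * b) * (3 * (z' t \<bullet> z' t) + 4 * b\<^sup>2 * (z t \<bullet> z t))"
      using b c Gle by (intro mult_left_mono) auto
    also have "\<dots> = 3 / 2 * (c / b * (z' t \<bullet> z' t)) + 2 * b * (c * (z t \<bullet> z t))"
      using b0 by (simp add: field_simps power2_eq_square)
    also have "\<dots> \<le> 3 / 2 * (b * (z' t \<bullet> z' t)) + 2 * b * (c * (z t \<bullet> z t))"
      using b0 bc by (intro add_right_mono mult_left_mono mult_right_mono) (auto simp: field_simps power2_eq_square)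
    also have "\<dots> \<le> 2 * (b * (z' t \<bullet> z' t)) + 2 * b * (c * (z t \<bullet> z t))"
      using b0 by (intro add_right_mono mult_right_mono) auto
    finally show "?D t \<le> - (c / (2 * b)) * ?G t" by (simp add: distrib_left)
  qed
  have "b\<^sup>2 * (z t \<bullet> z t) \<le> 2 * ?G t"
  proof -
    \<comment> \<open>Completing the square: \<open>2 * ?G t\<close> is |2 z' + b z|^2 plus b^2
      |z|^2 + 4 c |z|^2.\<close>
    have "0 \<le> (2 *\<^sub>R z' t + b *\<^sub>R z t) \<bullet> (2 *\<^sub>R z' t + b *\<^sub>R z t)" by (rule inner_ge_zero)
    then have "0 \<le> 4 * (z' t \<bullet> z' t) + 4 * b * (z t \<bullet> z' t) + b\<^sup>2 * (z t \<bullet> z t)"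
      by (simp add: inner_simps inner_commute[of "z' t" "z t"] power2_eq_square algebra_simps)
    moreover have "0 \<le> c * (z t \<bullet> z t)" using c by simp
    ultimately show ?thesis by (simp add: algebra_simps)
  qed
  also have "\<dots> \<le> 2 * (exp (- (c / (2 * b) * t)) * (3 * (z' 0 \<bullet> z' 0) + 4 * b\<^sup>2 * (z 0 \<bullet> z 0)))"
    using G Gle[of 0] by (smt (verit) mult_left_mono exp_ge_zero)
  also have "\<dots> \<le> exp (- (c / (2 * b) * t)) * (9 * (norm (z' 0) + b * norm (z 0))\<^sup>2)"
  proof -
    have "0 \<le> norm (z' 0) * (b * norm (z 0))" using b by simp
    moreover have "0 \<le> (norm (z' 0))\<^sup>2" "0 \<le> b\<^sup>2 * (norm (z 0))\<^sup>2" by auto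
    ultimately have "2 * (3 * (norm (z' 0))\<^sup>2 + 4 * b\<^sup>2 * (norm (z 0))\<^sup>2) \<le> 9 * (norm (z' 0) + b * norm (z 0))\<^sup>2"
      by (simp add: power2_sum power_mult_distrib)
    then show ?thesis by (simp add: power2_norm_eq_inner mult.left_commute[of 2])
  qed
  also have "\<dots> = (3 * exp (- (c / (4 * b) * t)) * (norm (z' 0) + b * norm (z 0)))\<^sup>2"
  proof -
    have "exp (- (c / (2 * b) * t)) = (exp (- (c / (4 * b) * t)))\<^sup>2"
      by (simp add: power2_eq_square flip: exp_add)
    then show ?thesis by (simp add: power_mult_distrib)
  qed
  finally have "(b * norm (z t))\<^sup>2 \<le> (3 * exp (- (c / (4 * b) * t)) * (norm (z' 0) + b * norm (z 0)))\<^sup>2"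
    by (simp add: power_mult_distrib power2_norm_eq_inner)
  then have "b * norm (z t) \<le> 3 * exp (- (c / (4 * b) * t)) * (norm (z' 0) + b * norm (z 0))"
    using b by (intro power2_le_imp_le[of "b * norm (z t)"]) auto
  also have "\<dots> = b * (3 * exp (- (c / (4 * b) * t)) * (norm (z 0) + norm (z' 0) / b))"
    using b0 by (simp add: field_simps)
  finally show ?thesis using b0 by simp
qed

text \<open>Duhamel's formula for \<open>z'' + b z' = - c z\<close> gives the velocity the additional factor \<open>c / b\<close>.\<close>

lemma velocity_decay_overdamped:
  assumes b0: "0 < b" and bc: "c \<le> b\<^sup>2" and t: "0 \<le> t"
  shows "norm (z' t) \<le> (b * exp (- (b * t)) + 4 * (c / b) * exp (- (c / (4 * b) * t))) * (norm (z 0) + norm (z' 0) / b)"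
proof -
  let ?B = "norm (z 0) + norm (z' 0) / b"
  have B: "0 \<le> ?B" using b0 by simp
  \<comment> \<open>The integrand in Duhamel's formula is exp(b s) c |z(s)|, and |z(s)| decays like
    exp(-c s/(4b)), which leaves the exponent \<open>\<mu>\<close>. From
    \<open>c \<le> b\<^sup>2\<close> follows \<mu> \<ge> 3b/4, which turns the factor 3c/\<mu> into
    4c/b.\<close>
  define \<mu> where "\<mu> = b - c / (4 * b)"
  have \<mu>: "3 / 4 * b \<le> \<mu>" "0 < \<mu>"
  proof -
    have "c / (4 * b) \<le> b / 4" using b0 bc by (simp add: field_simps power2_eq_square)
    then show "3 / 4 * b \<le> \<mu>" by (simp add: \<mu>_def)
    then show "0 < \<mu>" using b0 by linarith
  qed
  let ?w = "\<lambda>s. exp (b * s) *\<^sub>R z' s"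
  let ?h = "\<lambda>s. 3 * c * ?B / \<mu> * exp (\<mu> * s)"
  have w: "(?w has_vector_derivative (exp (b * s) *\<^sub>R z'' s + (exp (b * s) * b) *\<^sub>R z' s)) (at s within {0..})"
    if "0 \<le> s" for s
    using z'[OF that] by (auto intro!: derivative_eq_intros)
  have h: "(?h has_vector_derivative 3 * c * ?B * exp (\<mu> * s)) (at s)" for s
    using \<mu> by (auto intro!: derivative_eq_intros simp flip: has_real_derivative_iff_has_vector_derivative)
  have diff: "norm (?w t - ?w 0) \<le> ?h t - ?h 0"
  proof (cases "t = 0")
    case False
    then have "0 < t" using t by simp
    then show ?thesis
    proof (rule differentiable_bound_general)
      show "continuous_on {0..t} ?w"
        by (rule continuous_on_vector_derivative[OF has_vector_derivative_within_subset[OF w]]) auto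
      show "continuous_on {0..t} ?h" by (intro continuous_intros)
      fix s assume s: "0 < s" "s < t"
      show "(?h has_vector_derivative 3 * c * ?B * exp (\<mu> * s)) (at s)" by (rule h)
      show "(?w has_vector_derivative (exp (b * s) *\<^sub>R z'' s + (exp (b * s) * b) *\<^sub>R z' s)) (at s)"
        using w[of s] s at_within_interior[of s "{0..}"] by (auto simp: interior_real_atLeast)
      have "exp (b * s) *\<^sub>R z'' s + (exp (b * s) * b) *\<^sub>R z' s = - ((exp (b * s) * c) *\<^sub>R z s)"
        using s by (simp add: z''_eq scaleR_diff_right mult.commute)
      then have "norm (exp (b * s) *\<^sub>R z'' s + (exp (b * s) * b) *\<^sub>R z' s) = exp (b * s) * c * norm (z s)"
        using c by simp
      also have "\<dots> \<le> exp (b * s) * c * (3 * exp (- (c / (4 * b) * s)) * ?B)"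
        using c s by (intro mult_left_mono norm_decay_overdamped[OF b0 bc]) auto
      also have "\<dots> = 3 * c * ?B * (exp (b * s) * exp (- (c / (4 * b) * s)))" by simp
      also have "exp (b * s) * exp (- (c / (4 * b) * s)) = exp (\<mu> * s)"
        by (simp add: \<mu>_def left_diff_distrib flip: exp_add)
      finally show "norm (exp (b * s) *\<^sub>R z'' s + (exp (b * s) * b) *\<^sub>R z' s) \<le> 3 * c * ?B * exp (\<mu> * s)" .
    qed
  qed simp
  have "0 \<le> ?h 0" using c B \<mu> by simp
  then have "norm (?w t) \<le> norm (z' 0) + ?h t"
    using diff norm_triangle_sub[of "?w t" "?w 0"] by simp
  moreover have "norm (z' 0) \<le> b * ?B" using b0 by (simp add: field_simps)
  moreover have "?h t \<le> 4 * (c / b) * ?B * exp (\<mu> * t)"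
  proof -
    have "3 * c * ?B / \<mu> \<le> 3 * c * ?B / (3 / 4 * b)" using \<mu> b0 c B by (intro divide_left_mono) auto
    also have "\<dots> = 4 * (c / b) * ?B" by (simp only: times_divide_eq_left times_divide_eq_right divide_divide_eq_left) simp
    finally show ?thesis by (intro mult_right_mono) auto
  qed
  ultimately have "exp (b * t) * norm (z' t) \<le> b * ?B + 4 * (c / b) * ?B * exp (\<mu> * t)" by simp
  then have "exp (- (b * t)) * (exp (b * t) * norm (z' t)) \<le> exp (- (b * t)) * (b * ?B + 4 * (c / b) * ?B * exp (\<mu> * t))"
    by (rule mult_left_mono) simp
  also have "\<dots> = b * exp (- (b * t)) * ?B + 4 * (c / b) * (exp (- (b * t)) * exp (\<mu> * t)) * ?B"
    unfolding distrib_left[of "exp (- (b * t))"] by (simp only: mult_ac)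
  also have "exp (- (b * t)) * exp (\<mu> * t) = exp (- (c / (4 * b) * t))"
    by (simp add: \<mu>_def left_diff_distrib flip: exp_add)
  also have "exp (- (b * t)) * (exp (b * t) * norm (z' t)) = norm (z' t)"
    by (simp add: mult.assoc[symmetric] flip: exp_add)
  finally show ?thesis by (simp add: distrib_right)
qed

end

text \<open>For distinct roots of the characteristic polynomial, \<open>A\<close> and
  \<open>B\<close> solve the linear system given by the initial values; regrouping by the initial
  values yields the classical solution formula. It serves the existence of solutions.\<close>

lemma oscillator_explicit:
  fixes l1 l2 w0 w1 :: complex
  assumes l: "l1 \<noteq> l2" "l1\<^sup>2 + of_real b * l1 + of_real c = 0" "l2\<^sup>2 + of_real b * l2 + of_real c = 0"
    and "0 \<le> b" "0 \<le> c"
  defines "A \<equiv> (w1 - l2 * w0) / (l1 - l2)" and "B \<equiv> (l1 * w0 - w1) / (l1 - l2)"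
  shows "damped_oscillator b c (\<lambda>t. A * exp (l1 * of_real t) + B * exp (l2 * of_real t))
      (\<lambda>t. A * l1 * exp (l1 * of_real t) + B * l2 * exp (l2 * of_real t))
      (\<lambda>t. A * l1\<^sup>2 * exp (l1 * of_real t) + B * l2\<^sup>2 * exp (l2 * of_real t))"
    and "A + B = w0" "A * l1 + B * l2 = w1"
proof -
  have e: "((\<lambda>t. exp (l * of_real t)) has_vector_derivative l * exp (l * of_real t)) (at t within S)" for l :: complex and t S
    by (rule has_vector_derivative_real_field[of "\<lambda>w. exp (l * w)"]) (auto intro!: derivative_eq_intros)
  show "damped_oscillator b c (\<lambda>t. A * exp (l1 * of_real t) + B * exp (l2 * of_real t))
      (\<lambda>t. A * l1 * exp (l1 * of_real t) + B * l2 * exp (l2 * of_real t))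
      (\<lambda>t. A * l1\<^sup>2 * exp (l1 * of_real t) + B * l2\<^sup>2 * exp (l2 * of_real t))"
  proof
    fix t :: real
    show "((\<lambda>t. A * exp (l1 * of_real t) + B * exp (l2 * of_real t)) has_vector_derivative
        A * l1 * exp (l1 * of_real t) + B * l2 * exp (l2 * of_real t)) (at t within {0..})"
      by (auto intro!: derivative_eq_intros e simp: mult.assoc)
    show "((\<lambda>t. A * l1 * exp (l1 * of_real t) + B * l2 * exp (l2 * of_real t)) has_vector_derivative
        A * l1\<^sup>2 * exp (l1 * of_real t) + B * l2\<^sup>2 * exp (l2 * of_real t)) (at t within {0..})"
      by (auto intro!: derivative_eq_intros e simp: mult.assoc power2_eq_square)
    have "A * l1\<^sup>2 * exp (l1 * of_real t) + B * l2\<^sup>2 * exp (l2 * of_real t) +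
        b *\<^sub>R (A * l1 * exp (l1 * of_real t) + B * l2 * exp (l2 * of_real t)) +
        c *\<^sub>R (A * exp (l1 * of_real t) + B * exp (l2 * of_real t)) =
        A * exp (l1 * of_real t) * (l1\<^sup>2 + of_real b * l1 + of_real c) +
        B * exp (l2 * of_real t) * (l2\<^sup>2 + of_real b * l2 + of_real c)"
      by (simp add: scaleR_conv_of_real algebra_simps)
    then show "A * l1\<^sup>2 * exp (l1 * of_real t) + B * l2\<^sup>2 * exp (l2 * of_real t) +
        b *\<^sub>R (A * l1 * exp (l1 * of_real t) + B * l2 * exp (l2 * of_real t)) +
        c *\<^sub>R (A * exp (l1 * of_real t) + B * exp (l2 * of_real t)) = 0" by (simp add: l)
  qed (use assms in auto)
  have d: "l1 - l2 \<noteq> 0" using l(1) by simp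
  show "A + B = w0" using d by (simp add: A_def B_def add_divide_distrib[symmetric] left_diff_distrib[symmetric])
  have "A * l1 + B * l2 = ((w1 - l2 * w0) * l1 + (l1 * w0 - w1) * l2) / (l1 - l2)"
    by (simp add: A_def B_def add_divide_distrib)
  also have "(w1 - l2 * w0) * l1 + (l1 * w0 - w1) * l2 = w1 * (l1 - l2)" by (simp add: algebra_simps)
  finally show "A * l1 + B * l2 = w1" using d by simp
qed

subsection \<open>Decay of the solution in frequency space\<close>

text \<open>Links the values at times 0 and \<open>t\<close> of some trajectory, so that a statement
  at fixed \<open>t\<close> can be made for almost every frequency without carrying a family of
  trajectories.\<close>

definition oscillator_state ::
  "real \<Rightarrow> real \<Rightarrow> real \<Rightarrow> real \<Rightarrow> complex \<Rightarrow> complex \<Rightarrow> complex \<Rightarrow> complex \<Rightarrow> bool" where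
  "oscillator_state \<sigma> \<delta> r t w0 w1 w w' \<longleftrightarrow> (\<exists>z z' z''.
     damped_oscillator (r powr (2 * \<delta>)) (r powr (2 * \<sigma>)) z z' z'' \<and>
     z 0 = w0 \<and> z' 0 = w1 \<and> z t = w \<and> z' t = w')"

lemma nn_integral_exp_decay_weight:
  fixes p q s \<kappa> :: real
  assumes p: "0 \<le> p" and q: "0 < q" and s: "0 \<le> s" and \<kappa>: "0 < \<kappa>"
  obtains C where "0 < C" and "\<And>(h :: 'a::euclidean_space \<Rightarrow> ennreal) A t. ball_growth h A p \<Longrightarrow> 0 \<le> t \<Longrightarrow>
    (\<integral>\<^sup>+x. ennreal (exp (- (\<kappa> * norm x powr q * t))) * (ennreal (norm x powr s) * h x) * indicator (cball 0 1) x \<partial>lborel)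
      \<le> ennreal (C * A * (1 + t) powr (- ((p + s) / q)))"
proof -
  show ?thesis
  proof (rule nn_integral_exp_decay[of "p + s" q \<kappa>, where 'a='a])
    fix C assume C: "0 < C" and le: "\<And>(h :: 'a \<Rightarrow> ennreal) A t. ball_growth h A (p + s) \<Longrightarrow> 0 \<le> t \<Longrightarrow>
      (\<integral>\<^sup>+x. ennreal (exp (- (\<kappa> * norm x powr q * t))) * h x * indicator (cball 0 1) x \<partial>lborel)
        \<le> ennreal (C * A * (1 + t) powr (- ((p + s) / q)))"
    show thesis by (rule that[OF C le[OF ball_growth_weight_nonneg]]) (use s in auto)
  qed (use assms in auto)
qed

lemma square_sum_le: "(x + y)\<^sup>2 \<le> 2 * x\<^sup>2 + 2 * (y::real)\<^sup>2"
  using sum_squares_bound[of x y] by (simp add: power2_sum)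

locale structural_damping =
  fixes \<sigma> \<delta> :: real
  assumes \<delta>: "0 < \<delta>" and \<sigma>\<delta>: "2 * \<delta> < \<sigma>"
begin

text \<open>The slow rate c/b at the frequency \<xi> is |\<xi>|^\<beta>.\<close>

definition \<beta> where "\<beta> = 2 * (\<sigma> - \<delta>)"

lemma \<beta>: "0 < \<beta>" "2 * \<delta> < \<beta>" using \<delta> \<sigma>\<delta> by (auto simp: \<beta>_def)

text \<open>Twice this quantity dominates the square of |w0| + |w1|/b with b = r^(2\<delta>), the
  amplitude in the overdamped estimates.\<close>

definition low_energy :: "real \<Rightarrow> complex \<Rightarrow> complex \<Rightarrow> real" where
  "low_energy r w0 w1 = (norm w0)\<^sup>2 + r powr (- (4 * \<delta>)) * (norm w1)\<^sup>2"

context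
  fixes r t :: real and w0 w1 w w' :: complex
  assumes st: "oscillator_state \<sigma> \<delta> r t w0 w1 w w'" and r: "0 < r" and t: "0 \<le> t"
begin

text \<open>Since 4\<delta> < 2\<sigma>, the condition r \<le> 1 gives
  \<open>c \<le> b\<^sup>2\<close>, so the overdamped bounds apply. They are squared here to be
  integrated.\<close>

lemma low_frequency:
  assumes r1: "r \<le> 1"
  shows "(norm w)\<^sup>2 \<le> 18 * exp (- (1/4 * r powr \<beta> * t)) * low_energy r w0 w1"
    and "(norm w')\<^sup>2 \<le> (4 * exp (- (1/4 * r powr (2 * \<delta>) * t)) * r powr (4 * \<delta>) +
      64 * exp (- (1/4 * r powr \<beta> * t)) * r powr (2 * \<beta>)) * low_energy r w0 w1"
proof -
  obtain z z' z'' where osc: "damped_oscillator (r powr (2 * \<delta>)) (r powr (2 * \<sigma>)) z z' z''"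
    and zs: "z 0 = w0" "z' 0 = w1" "z t = w" "z' t = w'"
    using st by (auto simp: oscillator_state_def)
  interpret damped_oscillator "r powr (2 * \<delta>)" "r powr (2 * \<sigma>)" z z' z'' by (rule osc)
  let ?B = "norm w0 + norm w1 / r powr (2 * \<delta>)"
  have bc: "r powr (2 * \<sigma>) \<le> (r powr (2 * \<delta>))\<^sup>2"
    unfolding powr_square using r r1 \<sigma>\<delta> by (intro powr_mono') auto
  have cb: "r powr (2 * \<sigma>) / r powr (2 * \<delta>) = r powr \<beta>"
    by (simp add: \<beta>_def right_diff_distrib powr_diff)
  then have cb4: "r powr (2 * \<sigma>) / (4 * r powr (2 * \<delta>)) = 1/4 * r powr \<beta>" by simp
  have B: "?B\<^sup>2 \<le> 2 * low_energy r w0 w1"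
  proof -
    have "(norm w1 / r powr (2 * \<delta>))\<^sup>2 = r powr (- (4 * \<delta>)) * (norm w1)\<^sup>2"
      by (simp add: power_divide powr_square powr_minus_divide)
    then show ?thesis
      using sum_squares_bound[of "norm w0" "norm w1 / r powr (2 * \<delta>)"]
      by (simp add: power2_sum low_energy_def mult.commute)
  qed
  \<comment> \<open>Squaring doubles the rate; the weaker rate is kept so that every low-frequency
    exponential has the coefficient 1/4.\<close>
  have ee: "(exp (- x))\<^sup>2 \<le> exp (- x)" if "0 \<le> x" for x :: real
    using that by (simp add: power2_eq_square mult_left_le)
  have e\<beta>: "(exp (- (1/4 * r powr \<beta> * t)))\<^sup>2 \<le> exp (- (1/4 * r powr \<beta> * t))"
    using t by (intro ee) auto
  have "norm w \<le> 3 * exp (- (1/4 * r powr \<beta> * t)) * ?B"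
    using norm_decay_overdamped[OF _ bc t] r unfolding cb4 zs by simp
  then have "(norm w)\<^sup>2 \<le> (3 * exp (- (1/4 * r powr \<beta> * t)) * ?B)\<^sup>2"
    by (intro power_mono) auto
  also have "\<dots> = 9 * (exp (- (1/4 * r powr \<beta> * t)))\<^sup>2 * ?B\<^sup>2" by (simp add: power_mult_distrib)
  also have "\<dots> \<le> 9 * exp (- (1/4 * r powr \<beta> * t)) * (2 * low_energy r w0 w1)"
    using e\<beta> B by (intro mult_mono mult_left_mono) auto
  finally show "(norm w)\<^sup>2 \<le> 18 * exp (- (1/4 * r powr \<beta> * t)) * low_energy r w0 w1" by simp
  let ?x = "r powr (2 * \<delta>) * exp (- (r powr (2 * \<delta>) * t))" and ?y = "4 * r powr \<beta> * exp (- (1/4 * r powr \<beta> * t))"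
  have "norm w' \<le> (?x + ?y) * ?B"
    using velocity_decay_overdamped[OF _ bc t] r unfolding cb cb4 zs by simp
  then have "(norm w')\<^sup>2 \<le> ((?x + ?y) * ?B)\<^sup>2" by (intro power_mono) auto
  also have "\<dots> \<le> (2 * ?x\<^sup>2 + 2 * ?y\<^sup>2) * ?B\<^sup>2"
    unfolding power_mult_distrib[of "?x + ?y"] by (intro mult_right_mono square_sum_le) auto
  also have "\<dots> \<le> (2 * ?x\<^sup>2 + 2 * ?y\<^sup>2) * (2 * low_energy r w0 w1)"
    by (intro mult_left_mono B) auto
  also have "\<dots> = (4 * ?x\<^sup>2 + 4 * ?y\<^sup>2) * low_energy r w0 w1" by (simp add: algebra_simps)
  also have "\<dots> \<le> (4 * exp (- (1/4 * r powr (2 * \<delta>) * t)) * r powr (4 * \<delta>) +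
      64 * exp (- (1/4 * r powr \<beta> * t)) * r powr (2 * \<beta>)) * low_energy r w0 w1"
  proof (intro mult_right_mono add_mono)
    have "(exp (- (r powr (2 * \<delta>) * t)))\<^sup>2 \<le> exp (- (r powr (2 * \<delta>) * t))"
      using t by (intro ee) auto
    also have "\<dots> \<le> exp (- (1/4 * r powr (2 * \<delta>) * t))"
      using t by simp
    finally show "4 * ?x\<^sup>2 \<le> 4 * exp (- (1/4 * r powr (2 * \<delta>) * t)) * r powr (4 * \<delta>)"
      by (simp add: power_mult_distrib powr_square mult.commute mult_left_mono)
    show "4 * ?y\<^sup>2 \<le> 64 * exp (- (1/4 * r powr \<beta> * t)) * r powr (2 * \<beta>)"
      using mult_left_mono[OF e\<beta>, of "64 * r powr (2 * \<beta>)"]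
      by (simp add: power_mult_distrib powr_square mult.commute mult.left_commute)
  qed (auto simp: low_energy_def)
  finally show "(norm w')\<^sup>2 \<le> (4 * exp (- (1/4 * r powr (2 * \<delta>) * t)) * r powr (4 * \<delta>) +
      64 * exp (- (1/4 * r powr \<beta> * t)) * r powr (2 * \<beta>)) * low_energy r w0 w1" .
qed

text \<open>For r \<ge> 1 one has both \<open>b\<^sup>2 \<le> c\<close> and b \<ge> 1, so the energy
  decays at least like exp(-t). The second bound follows on dividing by c \<ge> 1.\<close>

lemma high_frequency:
  assumes r1: "1 \<le> r"
  shows "(norm w')\<^sup>2 + r powr (2 * \<sigma>) * (norm w)\<^sup>2 \<le> 3 * exp (- t) * (r powr (2 * \<sigma>) * (norm w0)\<^sup>2 + (norm w1)\<^sup>2)"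
    and "(norm w)\<^sup>2 \<le> 3 * exp (- t) * ((norm w0)\<^sup>2 + (norm w1)\<^sup>2)"
proof -
  obtain z z' z'' where osc: "damped_oscillator (r powr (2 * \<delta>)) (r powr (2 * \<sigma>)) z z' z''"
    and zs: "z 0 = w0" "z' 0 = w1" "z t = w" "z' t = w'"
    using st by (auto simp: oscillator_state_def)
  interpret damped_oscillator "r powr (2 * \<delta>)" "r powr (2 * \<sigma>)" z z' z'' by (rule osc)
  let ?c = "r powr (2 * \<sigma>)"
  have bc: "(r powr (2 * \<delta>))\<^sup>2 \<le> ?c"
    unfolding powr_square using r1 \<sigma>\<delta> by (intro powr_mono) auto
  have b1: "1 \<le> r powr (2 * \<delta>)" using r1 \<delta> by (intro ge_one_powr_ge_zero) auto
  have c1: "1 \<le> ?c" using r1 \<delta> \<sigma>\<delta> by (intro ge_one_powr_ge_zero) auto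
  have "(norm w')\<^sup>2 + ?c * (norm w)\<^sup>2 \<le> 3 * exp (- (r powr (2 * \<delta>) * t)) * ((norm w1)\<^sup>2 + ?c * (norm w0)\<^sup>2)"
    using energy_decay_oscillating[OF bc t] unfolding zs .
  also have "\<dots> \<le> 3 * exp (- t) * ((norm w1)\<^sup>2 + ?c * (norm w0)\<^sup>2)"
    using t b1 mult_right_mono[OF b1 t] by (intro mult_right_mono) auto
  finally show 1: "(norm w')\<^sup>2 + ?c * (norm w)\<^sup>2 \<le> 3 * exp (- t) * (?c * (norm w0)\<^sup>2 + (norm w1)\<^sup>2)"
    by (simp add: add.commute)
  have "?c * (norm w)\<^sup>2 \<le> 3 * exp (- t) * (?c * (norm w0)\<^sup>2 + (norm w1)\<^sup>2)"
    using 1 zero_le_power2[of "norm w'"] by linarith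
  also have "\<dots> \<le> 3 * exp (- t) * (?c * (norm w0)\<^sup>2 + ?c * (norm w1)\<^sup>2)"
    using c1 by (intro mult_left_mono add_left_mono) (auto simp: mult_le_cancel_right1)
  also have "\<dots> = ?c * (3 * exp (- t) * ((norm w0)\<^sup>2 + (norm w1)\<^sup>2))" by (simp add: algebra_simps)
  finally show "(norm w)\<^sup>2 \<le> 3 * exp (- t) * ((norm w0)\<^sup>2 + (norm w1)\<^sup>2)"
    by (rule mult_left_le_imp_le) (use c1 in linarith)
qed

text \<open>A crude bound, growing in time and free of negative powers of \<open>r\<close>. It puts
  the solution in L^2 when the data are merely in L^2.\<close>

lemma all_frequency:
  "(norm w)\<^sup>2 \<le> (5 + 4 * t\<^sup>2) * ((norm w0)\<^sup>2 + (norm w1)\<^sup>2)"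
proof (cases "1 \<le> r")
  case True
  have "(norm w)\<^sup>2 \<le> 3 * exp (- t) * ((norm w0)\<^sup>2 + (norm w1)\<^sup>2)" by (rule high_frequency(2)[OF True])
  also have "\<dots> \<le> (5 + 4 * t\<^sup>2) * ((norm w0)\<^sup>2 + (norm w1)\<^sup>2)"
  proof (intro mult_right_mono)
    have "exp (- t) \<le> 1" using t by simp
    then show "3 * exp (- t) \<le> 5 + 4 * t\<^sup>2" using zero_le_power2[of t] by linarith
  qed auto
  finally show ?thesis .
next
  case False
  obtain z z' z'' where osc: "damped_oscillator (r powr (2 * \<delta>)) (r powr (2 * \<sigma>)) z z' z''"
    and zs: "z 0 = w0" "z' 0 = w1" "z t = w" "z' t = w'"
    using st by (auto simp: oscillator_state_def)
  interpret damped_oscillator "r powr (2 * \<delta>)" "r powr (2 * \<sigma>)" z z' z'' by (rule osc)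
  let ?S = "(norm w0)\<^sup>2 + (norm w1)\<^sup>2"
  have c1: "r powr (2 * \<sigma>) \<le> 1" using False r \<delta> \<sigma>\<delta> by (simp add: powr_le1)
  have "(norm w1)\<^sup>2 + r powr (2 * \<sigma>) * (norm w0)\<^sup>2 \<le> ?S"
    using c1 mult_right_mono[OF c1, of "(norm w0)\<^sup>2"] by simp
  then have "t * sqrt ((norm w1)\<^sup>2 + r powr (2 * \<sigma>) * (norm w0)\<^sup>2) \<le> t * sqrt ?S"
    using t by (intro mult_left_mono) auto
  then have "norm w \<le> norm w0 + t * sqrt ?S"
    using norm_le_linear[OF t] unfolding zs by linarith
  then have "(norm w)\<^sup>2 \<le> (norm w0 + t * sqrt ?S)\<^sup>2" by (intro power_mono) auto
  also have "\<dots> \<le> 2 * (norm w0)\<^sup>2 + 2 * (t * sqrt ?S)\<^sup>2"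
    using sum_squares_bound[of "norm w0" "t * sqrt ?S"] by (simp add: power2_sum)
  also have "(t * sqrt ?S)\<^sup>2 = t\<^sup>2 * ?S" by (simp add: power_mult_distrib)
  also have "2 * (norm w0)\<^sup>2 + 2 * (t\<^sup>2 * ?S) \<le> 5 * ?S + 4 * (t\<^sup>2 * ?S)"
    by (intro add_mono mult_right_mono) auto
  finally show ?thesis by (simp add: distrib_right mult.assoc)
qed

end

lemma nn_integral_low_high:
  fixes F g h :: "real ^ 'n \<Rightarrow> ennreal"
  assumes [measurable]: "g \<in> borel_measurable borel" "h \<in> borel_measurable borel"
    and "AE x in lborel. x \<noteq> 0 \<longrightarrow> norm x \<le> 1 \<longrightarrow> F x \<le> g x"
    and "AE x in lborel. x \<noteq> 0 \<longrightarrow> 1 \<le> norm x \<longrightarrow> F x \<le> h x"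
  shows "(\<integral>\<^sup>+x. F x \<partial>lborel) \<le> (\<integral>\<^sup>+x. g x * indicator (cball 0 1) x \<partial>lborel) + (\<integral>\<^sup>+x. h x \<partial>lborel)"
proof -
  have [measurable]: "cball 0 s \<in> sets (borel :: (real ^ 'n) measure)" for s by simp
  have "(\<integral>\<^sup>+x. F x \<partial>lborel) \<le> (\<integral>\<^sup>+x. g x * indicator (cball 0 1) x + h x \<partial>lborel)"
  proof (rule nn_integral_mono_AE, use assms(3,4) AE_lborel_singleton[of "0::real ^ 'n"] in eventually_elim)
    case (elim x)
    then show ?case
      by (cases "norm x \<le> 1") (auto intro: add_increasing2 add_increasing)
  qed
  also have "\<dots> = (\<integral>\<^sup>+x. g x * indicator (cball 0 1) x \<partial>lborel) + (\<integral>\<^sup>+x. h x \<partial>lborel)"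
    by (rule nn_integral_add) measurable
  finally show ?thesis .
qed

text \<open>The norms of the data enter through real upper bounds \<open>X0\<close>,
  \<open>X1\<close>, \<open>Y0\<close>, so each conclusion asks for finiteness of its own integrals
  only. In particular the bound for \<open>Z\<close> makes sense for \<open>f0\<close> without
  Sobolev regularity.\<close>

definition frequency_bounds where
  "frequency_bounds K p t A f0 f1 Z Z' \<longleftrightarrow> (\<forall>X0 X1 Y0. 0 \<le> X0 \<longrightarrow> 0 \<le> X1 \<longrightarrow> 0 \<le> Y0 \<longrightarrow>
     (\<integral>\<^sup>+\<xi>. ennreal ((norm (f1 \<xi>))\<^sup>2) \<partial>lborel) \<le> ennreal X1 \<longrightarrow>
      ((\<integral>\<^sup>+\<xi>. ennreal ((norm (f0 \<xi>))\<^sup>2) \<partial>lborel) \<le> ennreal X0 \<longrightarrow>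
        (\<integral>\<^sup>+\<xi>. ennreal ((norm (Z \<xi>))\<^sup>2) \<partial>lborel) \<le> ennreal (K * (1 + t) powr (- (p / \<beta>)) * (A + X0 + X1))) \<and>
      ((\<integral>\<^sup>+\<xi>. ennreal (norm \<xi> powr (2 * \<sigma>) * (norm (f0 \<xi>))\<^sup>2) \<partial>lborel) \<le> ennreal Y0 \<longrightarrow>
        (\<integral>\<^sup>+\<xi>. ennreal (norm \<xi> powr (2 * \<sigma>) * (norm (Z \<xi>))\<^sup>2) \<partial>lborel) \<le>
          ennreal (K * (1 + t) powr (- (p / \<beta> + 2 * \<sigma> / \<beta>)) * (A + Y0 + X1)) \<and>
        (\<integral>\<^sup>+\<xi>. ennreal ((norm (Z' \<xi>))\<^sup>2) \<partial>lborel) \<le>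
          ennreal (K * (1 + t) powr (- (p / \<beta> + 2)) * (A + Y0 + X1))))"
  for f0 f1 Z Z' :: "real ^ 'n \<Rightarrow> complex"

text \<open>High frequencies contribute exponentially small terms. At low frequency each factor
  |\<xi>|^s improves the rate by s/\<beta>: s = 0 for \<open>Z\<close>, s = 2\<sigma> for the
  Sobolev energy of \<open>Z\<close>, s = 2\<beta> for the slow part of \<open>Z'\<close>.
  \<open>Z\<close> and \<open>Z'\<close> are arbitrary functions, which permits a velocity chosen
  separately at each frequency.\<close>

lemma frequency_decay:
  fixes p :: real
  assumes p: "0 \<le> p"
  obtains K where "0 < K" and
    "\<And>(f0 :: real ^ 'n \<Rightarrow> complex) f1 Z Z' t A.
      f0 \<in> borel_measurable borel \<Longrightarrow> f1 \<in> borel_measurable borel \<Longrightarrow> 0 \<le> t \<Longrightarrow>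
      AE \<xi> in lborel. oscillator_state \<sigma> \<delta> (norm \<xi>) t (f0 \<xi>) (f1 \<xi>) (Z \<xi>) (Z' \<xi>) \<Longrightarrow>
      ball_growth (\<lambda>\<xi>. ennreal (low_energy (norm \<xi>) (f0 \<xi>) (f1 \<xi>)) * indicator (cball 0 1) \<xi>) A p \<Longrightarrow>
      frequency_bounds K p t A f0 f1 Z Z'"
proof -
  have \<sigma>: "0 < \<sigma>" using \<delta> \<sigma>\<delta> by simp
  obtain C0 where C0: "0 < C0" "\<And>(h :: real ^ 'n \<Rightarrow> ennreal) A t. ball_growth h A p \<Longrightarrow> 0 \<le> t \<Longrightarrow>
    (\<integral>\<^sup>+x. ennreal (exp (- (1/4 * norm x powr \<beta> * t))) * (ennreal (norm x powr 0) * h x) * indicator (cball 0 1) x \<partial>lborel)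
      \<le> ennreal (C0 * A * (1 + t) powr (- ((p + 0) / \<beta>)))"
    by (rule nn_integral_exp_decay_weight[OF p \<beta>(1), of 0 "1/4"]) auto
  obtain C1 where C1: "0 < C1" "\<And>(h :: real ^ 'n \<Rightarrow> ennreal) A t. ball_growth h A p \<Longrightarrow> 0 \<le> t \<Longrightarrow>
    (\<integral>\<^sup>+x. ennreal (exp (- (1/4 * norm x powr \<beta> * t))) * (ennreal (norm x powr (2 * \<sigma>)) * h x) * indicator (cball 0 1) x \<partial>lborel)
      \<le> ennreal (C1 * A * (1 + t) powr (- ((p + 2 * \<sigma>) / \<beta>)))"
    by (rule nn_integral_exp_decay_weight[OF p \<beta>(1), of "2 * \<sigma>" "1/4"]) (use \<sigma> in auto)
  obtain C2 where C2: "0 < C2" "\<And>(h :: real ^ 'n \<Rightarrow> ennreal) A t. ball_growth h A p \<Longrightarrow> 0 \<le> t \<Longrightarrow>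
    (\<integral>\<^sup>+x. ennreal (exp (- (1/4 * norm x powr \<beta> * t))) * (ennreal (norm x powr (2 * \<beta>)) * h x) * indicator (cball 0 1) x \<partial>lborel)
      \<le> ennreal (C2 * A * (1 + t) powr (- ((p + 2 * \<beta>) / \<beta>)))"
    by (rule nn_integral_exp_decay_weight[OF p \<beta>(1), of "2 * \<beta>" "1/4"]) (use \<beta> in auto)
  \<comment> \<open>For the fast velocity term b exp(-b t), which decays on its own scale b =
    |\<xi>|^(2\<delta>).\<close>
  obtain C3 where C3: "0 < C3" "\<And>(h :: real ^ 'n \<Rightarrow> ennreal) A t. ball_growth h A p \<Longrightarrow> 0 \<le> t \<Longrightarrow>
    (\<integral>\<^sup>+x. ennreal (exp (- (1/4 * norm x powr (2 * \<delta>) * t))) * (ennreal (norm x powr (4 * \<delta>)) * h x) * indicator (cball 0 1) x \<partial>lborel)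
      \<le> ennreal (C3 * A * (1 + t) powr (- ((p + 4 * \<delta>) / (2 * \<delta>))))"
    by (rule nn_integral_exp_decay_weight[OF p, of "2 * \<delta>" "4 * \<delta>" "1/4"]) (use \<delta> in auto)
  \<comment> \<open>Exceeds all three polynomial rates, so a single constant \<open>E\<close>
    converts exp(-t) in each of the estimates.\<close>
  define a where "a = p / \<beta> + 2 * \<sigma> / \<beta> + 2"
  have a: "p / \<beta> \<le> a" "p / \<beta> + 2 * \<sigma> / \<beta> \<le> a" "p / \<beta> + 2 \<le> a" "0 \<le> a"
    using p \<beta> \<sigma> by (auto simp: a_def)
  obtain E where E: "0 < E" "\<And>t. 0 \<le> t \<Longrightarrow> exp (- (1 * t)) \<le> E * (1 + t) powr (- a)"
    using exp_decay_le[of 1 a] a by auto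
  define K where "K = 18 * C0 + 18 * C1 + 64 * C2 + 4 * C3 + 3 * E"
  have K: "0 < K" using C0 C1 C2 C3 E by (simp add: K_def)
  have main: "(\<integral>\<^sup>+\<xi>. F \<xi> \<partial>lborel) \<le> ennreal (K * (1 + t) powr (- x) * (A + Y + X))"
    if [measurable]: "g \<in> borel_measurable borel" "k \<in> borel_measurable borel"
      and lo: "AE \<xi> in lborel. \<xi> \<noteq> 0 \<longrightarrow> norm \<xi> \<le> 1 \<longrightarrow> F \<xi> \<le> g \<xi>"
      and hi: "AE \<xi> in lborel. \<xi> \<noteq> 0 \<longrightarrow> 1 \<le> norm \<xi> \<longrightarrow> F \<xi> \<le> ennreal (3 * exp (- t)) * k \<xi>"
      and g: "(\<integral>\<^sup>+\<xi>. g \<xi> * indicator (cball 0 1) \<xi> \<partial>lborel) \<le> ennreal (c * A * (1 + t) powr (- x))"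
      and k: "(\<integral>\<^sup>+\<xi>. k \<xi> \<partial>lborel) \<le> ennreal (Y + X)"
      and c: "0 \<le> c" "c + 3 * E \<le> K" and x: "x \<le> a" and nn: "0 \<le> A" "0 \<le> X" "0 \<le> Y" and t: "0 \<le> t"
    for F g k :: "real ^ 'n \<Rightarrow> ennreal" and t c x A X Y
  proof -
    have "(\<integral>\<^sup>+\<xi>. F \<xi> \<partial>lborel) \<le> (\<integral>\<^sup>+\<xi>. g \<xi> * indicator (cball 0 1) \<xi> \<partial>lborel) + (\<integral>\<^sup>+\<xi>. ennreal (3 * exp (- t)) * k \<xi> \<partial>lborel)"
      using lo hi by (intro nn_integral_low_high) auto
    also have "(\<integral>\<^sup>+\<xi>. ennreal (3 * exp (- t)) * k \<xi> \<partial>lborel) = ennreal (3 * exp (- t)) * (\<integral>\<^sup>+\<xi>. k \<xi> \<partial>lborel)"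
      by (rule nn_integral_cmult) measurable
    also have "(\<integral>\<^sup>+\<xi>. g \<xi> * indicator (cball 0 1) \<xi> \<partial>lborel) + \<dots> \<le>
        ennreal (c * A * (1 + t) powr (- x)) + ennreal (3 * exp (- t)) * ennreal (Y + X)"
      by (intro add_mono mult_left_mono g k) auto
    also have "\<dots> = ennreal (c * A * (1 + t) powr (- x) + 3 * exp (- t) * (Y + X))"
      using nn c by (simp add: ennreal_mult'[symmetric] ennreal_plus[symmetric] del: ennreal_plus)
    also have "\<dots> \<le> ennreal (K * (1 + t) powr (- x) * (A + Y + X))"
    proof (rule ennreal_leI)
      have "(1 + t) powr (- a) \<le> (1 + t) powr (- x)" using x t by (intro powr_mono) auto
      then have "exp (- t) \<le> E * (1 + t) powr (- x)"
        using E(2)[OF t] E(1) by (smt (verit) mult_left_mono mult_1)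
      then have "c * A * (1 + t) powr (- x) + 3 * exp (- t) * (Y + X) \<le>
          c * A * (1 + t) powr (- x) + 3 * (E * (1 + t) powr (- x)) * (Y + X)"
        using nn by (intro add_left_mono mult_right_mono mult_left_mono) auto
      also have "\<dots> = (c * A + 3 * E * (Y + X)) * (1 + t) powr (- x)" by (simp add: algebra_simps)
      also have "\<dots> \<le> (K * A + K * (Y + X)) * (1 + t) powr (- x)"
        using c E nn by (intro mult_right_mono add_mono) auto
      also have "\<dots> = K * (1 + t) powr (- x) * (A + Y + X)" by (simp add: algebra_simps)
      finally show "c * A * (1 + t) powr (- x) + 3 * exp (- t) * (Y + X) \<le> K * (1 + t) powr (- x) * (A + Y + X)" .
    qed
    finally show ?thesis .
  qed
  show ?thesis
  proof (rule that[OF K], unfold frequency_bounds_def, intro conjI allI impI)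
    fix f0 f1 Z Z' :: "real ^ 'n \<Rightarrow> complex" and t A X0 X1 Y0 :: real
    assume [measurable]: "f0 \<in> borel_measurable borel" "f1 \<in> borel_measurable borel"
      and t: "0 \<le> t" and nn: "0 \<le> X0" "0 \<le> X1" "0 \<le> Y0"
      and st: "AE \<xi> in lborel. oscillator_state \<sigma> \<delta> (norm \<xi>) t (f0 \<xi>) (f1 \<xi>) (Z \<xi>) (Z' \<xi>)"
      and gr: "ball_growth (\<lambda>\<xi>. ennreal (low_energy (norm \<xi>) (f0 \<xi>) (f1 \<xi>)) * indicator (cball 0 1) \<xi>) A p"
      and X1: "(\<integral>\<^sup>+\<xi>. ennreal ((norm (f1 \<xi>))\<^sup>2) \<partial>lborel) \<le> ennreal X1"
    have [measurable]: "cball 0 1 \<in> sets (borel :: (real ^ 'n) measure)" by simp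
    have A: "0 \<le> A" using gr by (simp add: ball_growth_def)
    define h where "h \<xi> = ennreal (low_energy (norm \<xi>) (f0 \<xi>) (f1 \<xi>)) * indicator (cball 0 1) \<xi>" for \<xi>
    have [measurable]: "h \<in> borel_measurable borel" using gr by (simp add: ball_growth_def h_def[abs_def])
    have gr: "ball_growth h A p" using gr by (simp add: h_def[abs_def])
    have le0: "0 \<le> low_energy r w0 w1" for r w0 w1 by (simp add: low_energy_def)
    {
      assume X0: "(\<integral>\<^sup>+\<xi>. ennreal ((norm (f0 \<xi>))\<^sup>2) \<partial>lborel) \<le> ennreal X0"
      show "(\<integral>\<^sup>+\<xi>. ennreal ((norm (Z \<xi>))\<^sup>2) \<partial>lborel) \<le> ennreal (K * (1 + t) powr (- (p / \<beta>)) * (A + X0 + X1))"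
      proof (rule main)
        let ?g = "\<lambda>\<xi>. 18 * (ennreal (exp (- (1/4 * norm \<xi> powr \<beta> * t))) * (ennreal (norm \<xi> powr 0) * h \<xi>))"
        show "?g \<in> borel_measurable borel" by measurable
        show "(\<lambda>\<xi>. ennreal ((norm (f0 \<xi>))\<^sup>2) + ennreal ((norm (f1 \<xi>))\<^sup>2)) \<in> borel_measurable borel" by measurable
        show "AE \<xi> in lborel. \<xi> \<noteq> 0 \<longrightarrow> norm \<xi> \<le> 1 \<longrightarrow> ennreal ((norm (Z \<xi>))\<^sup>2) \<le> ?g \<xi>"
          using st
        proof eventually_elim
          case (elim \<xi>)
          show ?case
          proof (intro impI)
            assume "\<xi> \<noteq> 0" "norm \<xi> \<le> 1"
            with low_frequency(1)[OF elim _ t]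
            have "ennreal ((norm (Z \<xi>))\<^sup>2) \<le> ennreal (18 * exp (- (1/4 * norm \<xi> powr \<beta> * t)) * low_energy (norm \<xi>) (f0 \<xi>) (f1 \<xi>))"
              by (intro ennreal_leI) auto
            then show "ennreal ((norm (Z \<xi>))\<^sup>2) \<le> ?g \<xi>"
              using \<open>\<xi> \<noteq> 0\<close> \<open>norm \<xi> \<le> 1\<close> le0 by (simp add: h_def ennreal_mult' mult.assoc)
          qed
        qed
        show "AE \<xi> in lborel. \<xi> \<noteq> 0 \<longrightarrow> 1 \<le> norm \<xi> \<longrightarrow> ennreal ((norm (Z \<xi>))\<^sup>2) \<le>
            ennreal (3 * exp (- t)) * (ennreal ((norm (f0 \<xi>))\<^sup>2) + ennreal ((norm (f1 \<xi>))\<^sup>2))"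
          using st
        proof eventually_elim
          case (elim \<xi>)
          show ?case
            using ennreal_leI[OF high_frequency(2)[OF elim _ t]] by (simp add: ennreal_mult')
        qed
        have "(\<integral>\<^sup>+\<xi>. ?g \<xi> * indicator (cball 0 1) \<xi> \<partial>lborel) = 18 *
            (\<integral>\<^sup>+\<xi>. ennreal (exp (- (1/4 * norm \<xi> powr \<beta> * t))) * (ennreal (norm \<xi> powr 0) * h \<xi>) * indicator (cball 0 1) \<xi> \<partial>lborel)"
          unfolding mult.assoc[of 18] by (rule nn_integral_cmult) measurable
        also have "\<dots> \<le> 18 * ennreal (C0 * A * (1 + t) powr (- ((p + 0) / \<beta>)))"
          by (intro mult_left_mono C0 gr t) auto
        also have "\<dots> = ennreal (18 * C0 * A * (1 + t) powr (- (p / \<beta>)))"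
          by (simp add: ennreal_mult' mult.assoc)
        finally show "(\<integral>\<^sup>+\<xi>. ?g \<xi> * indicator (cball 0 1) \<xi> \<partial>lborel) \<le> ennreal (18 * C0 * A * (1 + t) powr (- (p / \<beta>)))" .
        show "(\<integral>\<^sup>+\<xi>. ennreal ((norm (f0 \<xi>))\<^sup>2) + ennreal ((norm (f1 \<xi>))\<^sup>2) \<partial>lborel) \<le> ennreal (X0 + X1)"
          using X0 X1 nn by (simp add: nn_integral_add ennreal_plus add_mono)
      qed (use C0 C1 C2 C3 E a nn A t in \<open>auto simp: K_def\<close>)
    }
    assume Y0: "(\<integral>\<^sup>+\<xi>. ennreal (norm \<xi> powr (2 * \<sigma>) * (norm (f0 \<xi>))\<^sup>2) \<partial>lborel) \<le> ennreal Y0"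
    let ?k = "\<lambda>\<xi>. ennreal (norm \<xi> powr (2 * \<sigma>) * (norm (f0 \<xi>))\<^sup>2) + ennreal ((norm (f1 \<xi>))\<^sup>2)"
    have km: "?k \<in> borel_measurable borel" by measurable
    have k: "(\<integral>\<^sup>+\<xi>. ?k \<xi> \<partial>lborel) \<le> ennreal (Y0 + X1)"
      using Y0 X1 nn by (simp add: nn_integral_add ennreal_plus add_mono)
    have split_le: "a \<le> K' \<and> b \<le> K'" if "a + b \<le> K'" for a b K' :: ennreal
      using order_trans[of a "a + b" K'] order_trans[of b "a + b" K'] that by simp
    have hi: "AE \<xi> in lborel. \<xi> \<noteq> 0 \<longrightarrow> 1 \<le> norm \<xi> \<longrightarrow>
        ennreal ((norm (Z' \<xi>))\<^sup>2 + norm \<xi> powr (2 * \<sigma>) * (norm (Z \<xi>))\<^sup>2) \<le> ennreal (3 * exp (- t)) * ?k \<xi>"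
      using st
    proof eventually_elim
      case (elim \<xi>)
      show ?case
      proof (intro impI)
        assume "\<xi> \<noteq> 0" "1 \<le> norm \<xi>"
        then have "ennreal ((norm (Z' \<xi>))\<^sup>2 + norm \<xi> powr (2 * \<sigma>) * (norm (Z \<xi>))\<^sup>2) \<le>
          ennreal (3 * exp (- t) * (norm \<xi> powr (2 * \<sigma>) * (norm (f0 \<xi>))\<^sup>2 + (norm (f1 \<xi>))\<^sup>2))"
          by (intro ennreal_leI high_frequency(1)[OF elim _ t]) auto
        also have "\<dots> = ennreal (3 * exp (- t)) * ?k \<xi>"
          by (simp add: ennreal_mult' ennreal_plus)
        finally show "ennreal ((norm (Z' \<xi>))\<^sup>2 + norm \<xi> powr (2 * \<sigma>) * (norm (Z \<xi>))\<^sup>2) \<le> ennreal (3 * exp (- t)) * ?k \<xi>" .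
      qed
    qed
    show "(\<integral>\<^sup>+\<xi>. ennreal (norm \<xi> powr (2 * \<sigma>) * (norm (Z \<xi>))\<^sup>2) \<partial>lborel) \<le>
          ennreal (K * (1 + t) powr (- (p / \<beta> + 2 * \<sigma> / \<beta>)) * (A + Y0 + X1))"
    proof (rule main[OF _ km _ _ _ k])
      let ?g = "\<lambda>\<xi>. 18 * (ennreal (exp (- (1/4 * norm \<xi> powr \<beta> * t))) * (ennreal (norm \<xi> powr (2 * \<sigma>)) * h \<xi>))"
      show "?g \<in> borel_measurable borel" by measurable
      show "AE \<xi> in lborel. \<xi> \<noteq> 0 \<longrightarrow> norm \<xi> \<le> 1 \<longrightarrow> ennreal (norm \<xi> powr (2 * \<sigma>) * (norm (Z \<xi>))\<^sup>2) \<le> ?g \<xi>"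
        using st
      proof eventually_elim
        case (elim \<xi>)
        show ?case
        proof (intro impI)
          assume "\<xi> \<noteq> 0" "norm \<xi> \<le> 1"
          with low_frequency(1)[OF elim _ t]
          have "ennreal (norm \<xi> powr (2 * \<sigma>) * (norm (Z \<xi>))\<^sup>2) \<le>
            ennreal (norm \<xi> powr (2 * \<sigma>) * (18 * exp (- (1/4 * norm \<xi> powr \<beta> * t)) * low_energy (norm \<xi>) (f0 \<xi>) (f1 \<xi>)))"
            by (intro ennreal_leI mult_left_mono) auto
          also have "\<dots> = ennreal (18 * (exp (- (1/4 * norm \<xi> powr \<beta> * t)) * (norm \<xi> powr (2 * \<sigma>) * low_energy (norm \<xi>) (f0 \<xi>) (f1 \<xi>))))"
            by (simp only: mult_ac)
          also have "\<dots> = ?g \<xi>"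
            using \<open>norm \<xi> \<le> 1\<close> by (simp add: h_def ennreal_mult')
          finally show "ennreal (norm \<xi> powr (2 * \<sigma>) * (norm (Z \<xi>))\<^sup>2) \<le> ?g \<xi>" .
        qed
      qed
      show "AE \<xi> in lborel. \<xi> \<noteq> 0 \<longrightarrow> 1 \<le> norm \<xi> \<longrightarrow>
          ennreal (norm \<xi> powr (2 * \<sigma>) * (norm (Z \<xi>))\<^sup>2) \<le> ennreal (3 * exp (- t)) * ?k \<xi>"
        using hi by eventually_elim (auto dest: split_le)
      have "(\<integral>\<^sup>+\<xi>. ?g \<xi> * indicator (cball 0 1) \<xi> \<partial>lborel) = 18 *
          (\<integral>\<^sup>+\<xi>. ennreal (exp (- (1/4 * norm \<xi> powr \<beta> * t))) * (ennreal (norm \<xi> powr (2 * \<sigma>)) * h \<xi>) * indicator (cball 0 1) \<xi> \<partial>lborel)"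
        unfolding mult.assoc[of 18] by (rule nn_integral_cmult) measurable
      also have "\<dots> \<le> 18 * ennreal (C1 * A * (1 + t) powr (- ((p + 2 * \<sigma>) / \<beta>)))"
        by (intro mult_left_mono C1 gr t) auto
      also have "\<dots> = ennreal (18 * C1 * A * (1 + t) powr (- (p / \<beta> + 2 * \<sigma> / \<beta>)))"
        by (simp add: ennreal_mult' mult.assoc add_divide_distrib)
      finally show "(\<integral>\<^sup>+\<xi>. ?g \<xi> * indicator (cball 0 1) \<xi> \<partial>lborel) \<le>
        ennreal (18 * C1 * A * (1 + t) powr (- (p / \<beta> + 2 * \<sigma> / \<beta>)))" .
    qed (use C0 C1 C2 C3 E a nn A t in \<open>auto simp: K_def\<close>)
    show "(\<integral>\<^sup>+\<xi>. ennreal ((norm (Z' \<xi>))\<^sup>2) \<partial>lborel) \<le> ennreal (K * (1 + t) powr (- (p / \<beta> + 2)) * (A + Y0 + X1))"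
    proof (rule main[OF _ km _ _ _ k])
      let ?g1 = "\<lambda>\<xi>. ennreal (exp (- (1/4 * norm \<xi> powr (2 * \<delta>) * t))) * (ennreal (norm \<xi> powr (4 * \<delta>)) * h \<xi>)"
      let ?g2 = "\<lambda>\<xi>. ennreal (exp (- (1/4 * norm \<xi> powr \<beta> * t))) * (ennreal (norm \<xi> powr (2 * \<beta>)) * h \<xi>)"
      let ?g = "\<lambda>\<xi>. 4 * ?g1 \<xi> + 64 * ?g2 \<xi>"
      show "?g \<in> borel_measurable borel" by measurable
      show "AE \<xi> in lborel. \<xi> \<noteq> 0 \<longrightarrow> norm \<xi> \<le> 1 \<longrightarrow> ennreal ((norm (Z' \<xi>))\<^sup>2) \<le> ?g \<xi>"
        using st
      proof eventually_elim
        case (elim \<xi>)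
        show ?case
        proof (intro impI)
          assume "\<xi> \<noteq> 0" "norm \<xi> \<le> 1"
          let ?l = "low_energy (norm \<xi>) (f0 \<xi>) (f1 \<xi>)"
          have "ennreal ((norm (Z' \<xi>))\<^sup>2) \<le>
            ennreal ((4 * exp (- (1/4 * norm \<xi> powr (2 * \<delta>) * t)) * norm \<xi> powr (4 * \<delta>) +
              64 * exp (- (1/4 * norm \<xi> powr \<beta> * t)) * norm \<xi> powr (2 * \<beta>)) * ?l)"
            using \<open>\<xi> \<noteq> 0\<close> \<open>norm \<xi> \<le> 1\<close> by (intro ennreal_leI low_frequency(2)[OF elim _ t]) auto
          also have "\<dots> = ennreal (4 * (exp (- (1/4 * norm \<xi> powr (2 * \<delta>) * t)) * (norm \<xi> powr (4 * \<delta>) * ?l)) +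
              64 * (exp (- (1/4 * norm \<xi> powr \<beta> * t)) * (norm \<xi> powr (2 * \<beta>) * ?l)))"
            by (simp only: distrib_right mult.assoc)
          also have "\<dots> = ?g \<xi>"
            using \<open>norm \<xi> \<le> 1\<close> le0 by (simp add: h_def ennreal_mult' ennreal_plus)
          finally show "ennreal ((norm (Z' \<xi>))\<^sup>2) \<le> ?g \<xi>" .
        qed
      qed
      show "AE \<xi> in lborel. \<xi> \<noteq> 0 \<longrightarrow> 1 \<le> norm \<xi> \<longrightarrow>
          ennreal ((norm (Z' \<xi>))\<^sup>2) \<le> ennreal (3 * exp (- t)) * ?k \<xi>"
        using hi by eventually_elim (auto dest: split_le)
      have "(\<integral>\<^sup>+\<xi>. ?g \<xi> * indicator (cball 0 1) \<xi> \<partial>lborel) =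
          (\<integral>\<^sup>+\<xi>. 4 * (?g1 \<xi> * indicator (cball 0 1) \<xi>) + 64 * (?g2 \<xi> * indicator (cball 0 1) \<xi>) \<partial>lborel)"
        by (simp only: distrib_right mult.assoc)
      also have "\<dots> = 4 * (\<integral>\<^sup>+\<xi>. ?g1 \<xi> * indicator (cball 0 1) \<xi> \<partial>lborel) + 64 * (\<integral>\<^sup>+\<xi>. ?g2 \<xi> * indicator (cball 0 1) \<xi> \<partial>lborel)"
      proof -
        have [measurable]: "cball 0 1 \<in> sets (borel :: (real ^ 'n) measure)" by simp
        show ?thesis by (subst nn_integral_add) (auto simp: nn_integral_cmult)
      qed
      also have "\<dots> \<le> 4 * ennreal (C3 * A * (1 + t) powr (- ((p + 4 * \<delta>) / (2 * \<delta>)))) +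
          64 * ennreal (C2 * A * (1 + t) powr (- ((p + 2 * \<beta>) / \<beta>)))"
        by (intro add_mono mult_left_mono C2 C3 gr t) auto
      also have "\<dots> = ennreal (4 * (C3 * A * (1 + t) powr (- ((p + 4 * \<delta>) / (2 * \<delta>)))) +
          64 * (C2 * A * (1 + t) powr (- ((p + 2 * \<beta>) / \<beta>))))"
        using C2(1) C3(1) A by (subst ennreal_plus) (auto simp: ennreal_mult')
      also have "\<dots> \<le> ennreal ((4 * C3 + 64 * C2) * A * (1 + t) powr (- (p / \<beta> + 2)))"
      proof (rule ennreal_leI)
        \<comment> \<open>Because 2\<delta> < \<beta>, the fast term decays at least as quickly as
          the slow one.\<close>
        have "p / \<beta> \<le> p / (2 * \<delta>)" using p \<beta> \<delta> by (intro divide_left_mono) auto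
        then have "p / \<beta> + 2 \<le> (p + 4 * \<delta>) / (2 * \<delta>)" using \<delta> by (simp add: add_divide_distrib)
        then have "(1 + t) powr (- ((p + 4 * \<delta>) / (2 * \<delta>))) \<le> (1 + t) powr (- (p / \<beta> + 2))"
          using t by (intro powr_mono) auto
        then have "C3 * A * (1 + t) powr (- ((p + 4 * \<delta>) / (2 * \<delta>))) \<le> C3 * A * (1 + t) powr (- (p / \<beta> + 2))"
          using C3(1) A by (intro mult_left_mono) auto
        moreover have "(p + 2 * \<beta>) / \<beta> = p / \<beta> + 2" using \<beta> by (simp add: add_divide_distrib)
        ultimately show "4 * (C3 * A * (1 + t) powr (- ((p + 4 * \<delta>) / (2 * \<delta>)))) +
          64 * (C2 * A * (1 + t) powr (- ((p + 2 * \<beta>) / \<beta>))) \<le> (4 * C3 + 64 * C2) * A * (1 + t) powr (- (p / \<beta> + 2))"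
          by (simp add: distrib_right mult.assoc)
      qed
      finally show "(\<integral>\<^sup>+\<xi>. ?g \<xi> * indicator (cball 0 1) \<xi> \<partial>lborel) \<le>
        ennreal ((4 * C3 + 64 * C2) * A * (1 + t) powr (- (p / \<beta> + 2)))" .
    qed (use C0 C1 C2 C3 E a nn A t in \<open>auto simp: K_def\<close>)
  qed
qed

end

subsection \<open>Low-frequency energy of the data\<close>

lemma ball_growth_add:
  assumes "ball_growth h A p" "ball_growth g B p"
  shows "ball_growth (\<lambda>x. h x + g x) (A + B) p"
  unfolding ball_growth_def
proof (intro conjI allI impI)
  fix R :: real assume R: "0 < R"
  have [measurable]: "h \<in> borel_measurable borel" "g \<in> borel_measurable borel" "cball (0::'a) R \<in> sets borel"
    using assms by (auto simp: ball_growth_def)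
  have "(\<integral>\<^sup>+x. (h x + g x) * indicator (cball 0 R) x \<partial>lborel) =
      (\<integral>\<^sup>+x. h x * indicator (cball 0 R) x \<partial>lborel) + (\<integral>\<^sup>+x. g x * indicator (cball 0 R) x \<partial>lborel)"
    unfolding distrib_right by (rule nn_integral_add) measurable
  also have "\<dots> \<le> ennreal (A * R powr p) + ennreal (B * R powr p)"
    using assms R by (intro add_mono) (auto simp: ball_growth_def)
  also have "\<dots> = ennreal ((A + B) * R powr p)"
    using assms by (simp add: ball_growth_def distrib_right ennreal_plus)
  finally show "(\<integral>\<^sup>+x. (h x + g x) * indicator (cball 0 R) x \<partial>lborel) \<le> ennreal ((A + B) * R powr p)" .
qed (use assms in \<open>auto simp: ball_growth_def\<close>)

lemma ball_growth_mono: "ball_growth h A p \<Longrightarrow> A \<le> B \<Longrightarrow> ball_growth h B p"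
  by (auto simp: ball_growth_def intro: order_trans ennreal_leI mult_right_mono)

text \<open>The convention \<open>0 powr 0 = 0\<close> makes the weight of exponent 0 vanish at the
  origin, so it equals 1 only almost everywhere.\<close>

lemma weighted_Lp_0:
  assumes f: "f \<in> Lp_space m"
  shows "f \<in> weighted_Lp_space 0 m" "weighted_Lp_norm 0 m f = Lp_norm m f"
proof -
  have [measurable]: "f \<in> borel_measurable borel" using f by (rule Lp_space_borel_measurable)
  have ae: "AE x in lborel. (norm x powr 0) *\<^sub>R f x = f x"
    using AE_lborel_singleton[of 0] by eventually_elim simp
  show "f \<in> weighted_Lp_space 0 m"
    using f Lp_space_cong_AE[OF ae] by (simp add: weighted_Lp_space_def)
  show "weighted_Lp_norm 0 m f = Lp_norm m f"
    unfolding weighted_Lp_norm_def by (rule Lp_norm_cong_AE[OF ae]) measurable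
qed

context structural_damping
begin

abbreviation "data_energy u0 u1 \<xi> \<equiv> ennreal (low_energy (norm \<xi>) (fourier u0 \<xi>) (fourier u1 \<xi>)) * indicator (cball 0 1) \<xi>"

lemma data_energy_measurable:
  fixes u0 u1 :: "real ^ 'n \<Rightarrow> complex"
  assumes "u0 \<in> Lp_space 2" "u1 \<in> Lp_space 2"
  shows "data_energy u0 u1 \<in> borel_measurable borel"
proof -
  have [measurable]: "fourier u0 \<in> borel_measurable borel" "fourier u1 \<in> borel_measurable borel"
      "cball 0 1 \<in> sets (borel :: (real ^ 'n) measure)"
    using assms by (auto intro: fourier_measurable)
  show ?thesis unfolding low_energy_def by measurable
qed

text \<open>The weight on \<open>u1\<close> yields the growth exponent 4\<delta> + p, and the factor
  |\<xi>|^(-4\<delta>) in \<open>low_energy\<close> brings it back to the exponent p of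
  \<open>u0\<close>. That p is positive, by m < 2, makes the dyadic sum behind this step
  converge.\<close>

lemma data_energy_growth_Lm:
  fixes m :: real
  assumes m: "1 < m" "m < 2" and n: "2 * m * \<delta> / (m - 1) < real CARD('n::finite)"
  obtains C where "0 < C" and "\<And>u0 u1 :: real ^ 'n \<Rightarrow> complex. u0 \<in> Lp_space 2 \<Longrightarrow> u1 \<in> Lp_space 2 \<Longrightarrow>
    u0 \<in> Lp_space m \<Longrightarrow> u1 \<in> weighted_Lp_space (2 * \<delta>) m \<Longrightarrow>
    ball_growth (data_energy u0 u1) (C * ((Lp_norm m u0)\<^sup>2 + (weighted_Lp_norm (2 * \<delta>) m u1)\<^sup>2))
      (2 * real CARD('n) / m - real CARD('n))"
proof -
  let ?p = "2 * real CARD('n) / m - real CARD('n)"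
  have p: "0 < ?p" using m by (simp add: field_simps)
  obtain C0 where C0: "0 < C0" "\<And>f. f \<in> Lp_space 2 \<Longrightarrow> f \<in> weighted_Lp_space 0 m \<Longrightarrow>
    ball_growth (\<lambda>\<xi>::real ^ 'n. ennreal ((norm (fourier f \<xi>))\<^sup>2)) (C0 * (weighted_Lp_norm 0 m f)\<^sup>2) (2 * 0 + ?p)"
    by (rule weighted_low_frequency_bound[of 0 m, where 'n='n]) (use m in auto)
  obtain C1 where C1: "0 < C1" "\<And>f. f \<in> Lp_space 2 \<Longrightarrow> f \<in> weighted_Lp_space (2 * \<delta>) m \<Longrightarrow>
    ball_growth (\<lambda>\<xi>::real ^ 'n. ennreal ((norm (fourier f \<xi>))\<^sup>2)) (C1 * (weighted_Lp_norm (2 * \<delta>) m f)\<^sup>2) (2 * (2 * \<delta>) + ?p)"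
    by (rule weighted_low_frequency_bound[of "2 * \<delta>" m, where 'n='n]) (use m \<delta> n in \<open>auto simp: mult_ac\<close>)
  define k where "k = (1 + 2 powr (- (- (4 * \<delta>)))) / (1 - 2 powr (- (2 * (2 * \<delta>) + ?p + - (4 * \<delta>))))"
  have k: "0 < k"
    unfolding k_def using p powr_less_mono[of "- ?p" 0 2] by (intro divide_pos_pos add_pos_pos) auto
  define C where "C = C0 + k * C1"
  have C: "0 < C" "C0 \<le> C" "k * C1 \<le> C" using C0 C1 k by (auto simp: C_def add_pos_pos)
  show ?thesis
  proof (rule that[OF C(1)])
    fix u0 u1 :: "real ^ 'n \<Rightarrow> complex"
    assume u: "u0 \<in> Lp_space 2" "u1 \<in> Lp_space 2" and um: "u0 \<in> Lp_space m" "u1 \<in> weighted_Lp_space (2 * \<delta>) m"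
    let ?a = "(Lp_norm m u0)\<^sup>2" and ?b = "(weighted_Lp_norm (2 * \<delta>) m u1)\<^sup>2"
    have g0: "ball_growth (\<lambda>\<xi>. ennreal ((norm (fourier u0 \<xi>))\<^sup>2)) (C0 * ?a) ?p"
      using C0(2)[OF u(1) weighted_Lp_0(1)[OF um(1)]] weighted_Lp_0(2)[OF um(1)] by simp
    have g1: "ball_growth (\<lambda>\<xi>. ennreal (norm \<xi> powr (- (4 * \<delta>))) * ennreal ((norm (fourier u1 \<xi>))\<^sup>2)) (k * (C1 * ?b)) ?p"
      using ball_growth_weight[OF C1(2)[OF u(2) um(2)], of "- (4 * \<delta>)"] p unfolding k_def by simp
    have "ball_growth (data_energy u0 u1) (C0 * ?a + k * (C1 * ?b)) ?p"
    proof (rule ball_growth_cong_le[OF ball_growth_add[OF g0 g1] data_energy_measurable[OF u]])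
      show "AE \<xi> in lborel. data_energy u0 u1 \<xi> \<le> ennreal ((norm (fourier u0 \<xi>))\<^sup>2) +
          ennreal (norm \<xi> powr (- (4 * \<delta>))) * ennreal ((norm (fourier u1 \<xi>))\<^sup>2)"
        by (auto simp: low_energy_def indicator_def ennreal_mult' ennreal_plus)
    qed
    moreover have "C0 * ?a + k * (C1 * ?b) \<le> C * (?a + ?b)"
      using mult_right_mono[OF C(2), of ?a] mult_right_mono[OF C(3), of ?b] by (simp add: distrib_left mult.assoc)
    ultimately show "ball_growth (data_energy u0 u1) (C * (?a + ?b)) ?p" by (rule ball_growth_mono)
  qed
qed

text \<open>At m = 2 the exponent is 0 and only total mass is recorded: Plancherel bounds the part
  of \<open>u0\<close>, and the Hardy inequality with a = 2\<delta> bounds that of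
  \<open>u1\<close>.\<close>

lemma data_energy_growth_L2:
  assumes n: "4 * \<delta> < real CARD('n::finite)"
  obtains C where "0 < C" and "\<And>u0 u1 :: real ^ 'n \<Rightarrow> complex. u0 \<in> Lp_space 2 \<Longrightarrow> u1 \<in> Lp_space 2 \<Longrightarrow>
    u1 \<in> weighted_Lp_space (2 * \<delta>) 2 \<Longrightarrow>
    ball_growth (data_energy u0 u1) (C * ((Lp_norm 2 u0)\<^sup>2 + (weighted_Lp_norm (2 * \<delta>) 2 u1)\<^sup>2)) 0"
proof -
  obtain C1 where C1: "0 < C1" "\<And>f :: real ^ 'n \<Rightarrow> complex. f \<in> Lp_space 2 \<Longrightarrow> f \<in> weighted_Lp_space (2 * \<delta>) 2 \<Longrightarrow>
    (\<integral>\<^sup>+\<xi>. ennreal (norm \<xi> powr (- (2 * (2 * \<delta>)))) * ennreal ((norm (fourier f \<xi>))\<^sup>2) * indicator (cball 0 1) \<xi> \<partial>lborel)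
      \<le> ennreal (C1 * (weighted_Lp_norm (2 * \<delta>) 2 f)\<^sup>2)"
    by (rule hardy_low_frequency[of "2 * \<delta>", where 'n='n]) (use \<delta> n in auto)
  show ?thesis
  proof (rule that[of "1 + C1"])
    show "0 < 1 + C1" using C1 by simp
    fix u0 u1 :: "real ^ 'n \<Rightarrow> complex"
    assume u: "u0 \<in> Lp_space 2" "u1 \<in> Lp_space 2" and uw: "u1 \<in> weighted_Lp_space (2 * \<delta>) 2"
    let ?a = "(Lp_norm 2 u0)\<^sup>2" and ?b = "(weighted_Lp_norm (2 * \<delta>) 2 u1)\<^sup>2"
    have [measurable]: "fourier u0 \<in> borel_measurable borel" "fourier u1 \<in> borel_measurable borel"
        "cball 0 1 \<in> sets (borel :: (real ^ 'n) measure)"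
      using u by (auto intro: fourier_measurable)
    have "(\<integral>\<^sup>+\<xi>. data_energy u0 u1 \<xi> * indicator (cball 0 R) \<xi> \<partial>lborel) \<le> ennreal ((1 + C1) * (?a + ?b) * R powr 0)"
      if R: "0 < R" for R
    proof -
      have "(\<integral>\<^sup>+\<xi>. data_energy u0 u1 \<xi> * indicator (cball 0 R) \<xi> \<partial>lborel) \<le>
          (\<integral>\<^sup>+\<xi>. ennreal ((norm (fourier u0 \<xi>))\<^sup>2) +
            ennreal (norm \<xi> powr (- (2 * (2 * \<delta>)))) * ennreal ((norm (fourier u1 \<xi>))\<^sup>2) * indicator (cball 0 1) \<xi> \<partial>lborel)"
        by (intro nn_integral_mono) (auto simp: low_energy_def indicator_def ennreal_mult' ennreal_plus)
      also have "\<dots> = (\<integral>\<^sup>+\<xi>. ennreal ((norm (fourier u0 \<xi>))\<^sup>2) \<partial>lborel) +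
          (\<integral>\<^sup>+\<xi>. ennreal (norm \<xi> powr (- (2 * (2 * \<delta>)))) * ennreal ((norm (fourier u1 \<xi>))\<^sup>2) * indicator (cball 0 1) \<xi> \<partial>lborel)"
        by (rule nn_integral_add) measurable
      also have "\<dots> \<le> ennreal ?a + ennreal (C1 * ?b)"
        using C1(2)[OF u(2) uw] u by (intro add_mono) (auto simp: ennreal_Lp_norm_2_power2[symmetric] fourier_Lp_space plancherel)
      also have "\<dots> = ennreal (?a + C1 * ?b)" using C1 by (simp add: ennreal_plus)
      also have "\<dots> \<le> ennreal ((1 + C1) * (?a + ?b) * R powr 0)"
        using C1(1) R mult_nonneg_nonneg[of C1 ?a] by (intro ennreal_leI) (simp add: algebra_simps)
      finally show ?thesis .
    qed
    then show "ball_growth (data_energy u0 u1) ((1 + C1) * (?a + ?b)) 0"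
      unfolding ball_growth_def using data_energy_measurable[OF u] C1(1) by auto
  qed
qed

subsection \<open>Existence of solutions\<close>

definition solves_at :: "real ^ 'n \<Rightarrow> complex \<Rightarrow> complex \<Rightarrow> (real \<Rightarrow> complex) \<Rightarrow> bool" where
  "solves_at \<xi> w0 w1 z \<longleftrightarrow> (\<exists>z' z''. damped_oscillator (norm \<xi> powr (2 * \<delta>)) (norm \<xi> powr (2 * \<sigma>)) z z' z'' \<and> z 0 = w0 \<and> z' 0 = w1)"

lemma is_solution_iff:
  "is_solution \<sigma> \<delta> u0 u1 u \<longleftrightarrow> (\<forall>t\<ge>0. u t \<in> Lp_space 2) \<and>
     (\<exists>v. (\<forall>t\<ge>0. AE \<xi> in lborel. fourier (u t) \<xi> = v t \<xi>) \<and>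
       (AE \<xi> in lborel. solves_at \<xi> (fourier u0 \<xi>) (fourier u1 \<xi>) (\<lambda>t. v t \<xi>)))"
proof -
  have "(\<exists>v' v''. v 0 \<xi> = fourier u0 \<xi> \<and> v' 0 = fourier u1 \<xi> \<and>
           (\<forall>t\<ge>0.
              ((\<lambda>s. v s \<xi>) has_vector_derivative v' t) (at t within {0..}) \<and>
              (v' has_vector_derivative v'' t) (at t within {0..}) \<and>
              v'' t + (norm \<xi> powr (2 * \<delta>)) *\<^sub>R v' t + (norm \<xi> powr (2 * \<sigma>)) *\<^sub>R v t \<xi> = 0)) \<longleftrightarrow>
      solves_at \<xi> (fourier u0 \<xi>) (fourier u1 \<xi>) (\<lambda>t. v t \<xi>)" for v \<xi>
    unfolding solves_at_def damped_oscillator_def by auto blast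
  then show ?thesis unfolding is_solution_def by simp
qed

lemma solves_at_state:
  assumes "solves_at \<xi> w0 w1 z"
  shows "\<exists>w'. oscillator_state \<sigma> \<delta> (norm \<xi>) t w0 w1 (z t) w'"
  using assms unfolding solves_at_def oscillator_state_def by blast

lemma AE_norm_neq: "AE \<xi> in lborel. norm (\<xi> :: real ^ 'n) \<noteq> \<rho>"
proof -
  have "sphere (0 :: real ^ 'n) \<rho> \<in> null_sets lborel"
    using negligible_sphere[of "0 :: real ^ 'n" \<rho>]
    by (auto simp: null_sets_completion_iff negligible_iff_null_sets)
  then have "AE \<xi> in lborel. \<xi> \<notin> sphere (0 :: real ^ 'n) \<rho>" by (rule AE_not_in)
  then show ?thesis by eventually_elim simp
qed

text \<open>The explicit formula applies at almost every frequency; \<open>all_frequency\<close>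
  shows that its values lie in L^2, and surjectivity of the Fourier transform gives
  \<open>u t\<close> separately for each t.\<close>

lemma solution_exists:
  fixes u0 u1 :: "real ^ 'n \<Rightarrow> complex"
  assumes u0: "u0 \<in> Lp_space 2" and u1: "u1 \<in> Lp_space 2"
  shows "\<exists>u. is_solution \<sigma> \<delta> u0 u1 u"
proof -
  note F0 = fourier_Lp_space[OF u0] and F1 = fourier_Lp_space[OF u1]
  have [measurable]: "fourier u0 \<in> borel_measurable borel" "fourier u1 \<in> borel_measurable borel"
    using F0 F1 by (auto intro: Lp_space_borel_measurable)
  define d where "d \<xi> = (norm \<xi> powr (2 * \<delta>))\<^sup>2 / 4 - norm \<xi> powr (2 * \<sigma>)" for \<xi> :: "real ^ 'n"
  \<comment> \<open>A square root of \<open>d\<close>, a quarter of the discriminant. It is written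
    by cases on the sign, so measurability is immediate.\<close>
  define \<mu> where "\<mu> \<xi> = (if 0 \<le> d \<xi> then complex_of_real (sqrt (d \<xi>)) else \<i> * complex_of_real (sqrt (- d \<xi>)))" for \<xi>
  define l1 where "l1 \<xi> = - complex_of_real (norm \<xi> powr (2 * \<delta>) / 2) + \<mu> \<xi>" for \<xi>
  define l2 where "l2 \<xi> = - complex_of_real (norm \<xi> powr (2 * \<delta>) / 2) - \<mu> \<xi>" for \<xi>
  define v where "v t \<xi> = (fourier u1 \<xi> - l2 \<xi> * fourier u0 \<xi>) / (l1 \<xi> - l2 \<xi>) * exp (l1 \<xi> * of_real t) +
      (l1 \<xi> * fourier u0 \<xi> - fourier u1 \<xi>) / (l1 \<xi> - l2 \<xi>) * exp (l2 \<xi> * of_real t)" for t \<xi>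
  have [measurable]: "d \<in> borel_measurable borel" unfolding d_def by measurable
  have [measurable]: "\<mu> \<in> borel_measurable borel" unfolding \<mu>_def by measurable
  have [measurable]: "l1 \<in> borel_measurable borel" "l2 \<in> borel_measurable borel"
    unfolding l1_def l2_def by measurable
  have vm: "v t \<in> borel_measurable borel" for t unfolding v_def by measurable
  have sq: "(\<mu> \<xi>)\<^sup>2 = complex_of_real (d \<xi>)" for \<xi>
    by (auto simp: \<mu>_def power_mult_distrib simp flip: of_real_power)
  \<comment> \<open>Away from the origin the roots coincide only for |\<xi>|^(2\<sigma>-4\<delta>) =
    1/4, a single sphere, which is a null set.\<close>
  have "AE \<xi> in lborel. d (\<xi> :: real ^ 'n) \<noteq> 0"
    using AE_norm_neq[of "(1/4) powr (1 / (2 * \<sigma> - 4 * \<delta>))"] AE_norm_neq[of 0]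
  proof eventually_elim
    case (elim \<xi>)
    then have r: "0 < norm \<xi>" by simp
    show ?case
    proof
      assume "d \<xi> = 0"
      then have "norm \<xi> powr (2 * \<sigma>) = norm \<xi> powr (4 * \<delta>) / 4" by (simp add: d_def powr_square)
      then have e: "norm \<xi> powr (2 * \<sigma> - 4 * \<delta>) = 1/4" using r by (simp add: powr_diff)
      have "(1/4) powr (1 / (2 * \<sigma> - 4 * \<delta>)) = (norm \<xi> powr (2 * \<sigma> - 4 * \<delta>)) powr (1 / (2 * \<sigma> - 4 * \<delta>))" by (simp only: e)
      also have "\<dots> = norm \<xi>" using r \<sigma>\<delta> by (simp add: powr_powr)
      finally show False using elim by simp
    qed
  qed
  then have sol: "AE \<xi> in lborel. solves_at \<xi> (fourier u0 \<xi>) (fourier u1 \<xi>) (\<lambda>t. v t \<xi>)"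
  proof eventually_elim
    case (elim \<xi>)
    let ?b = "norm \<xi> powr (2 * \<delta>)" and ?c = "norm \<xi> powr (2 * \<sigma>)"
    have "\<mu> \<xi> \<noteq> 0" using elim sq[of \<xi>] by auto
    then have ne: "l1 \<xi> \<noteq> l2 \<xi>" by (simp add: l1_def l2_def)
    have dd: "complex_of_real (d \<xi>) = (of_real ?b)\<^sup>2 / 4 - of_real ?c" by (simp add: d_def)
    have r1: "(l1 \<xi>)\<^sup>2 + of_real ?b * l1 \<xi> + of_real ?c = (\<mu> \<xi>)\<^sup>2 - ((of_real ?b)\<^sup>2 / 4 - of_real ?c)"
      by (simp add: l1_def power2_eq_square field_simps)
    have r2: "(l2 \<xi>)\<^sup>2 + of_real ?b * l2 \<xi> + of_real ?c = (\<mu> \<xi>)\<^sup>2 - ((of_real ?b)\<^sup>2 / 4 - of_real ?c)"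
      by (simp add: l2_def power2_eq_square field_simps)
    have "(l1 \<xi>)\<^sup>2 + of_real ?b * l1 \<xi> + of_real ?c = 0" "(l2 \<xi>)\<^sup>2 + of_real ?b * l2 \<xi> + of_real ?c = 0"
      unfolding r1 r2 sq dd by simp_all
    note ex = oscillator_explicit[OF ne this, of "fourier u1 \<xi>" "fourier u0 \<xi>"]
    show ?case
      unfolding solves_at_def v_def
    proof (intro exI conjI)
      show "damped_oscillator ?b ?c (\<lambda>t. (fourier u1 \<xi> - l2 \<xi> * fourier u0 \<xi>) / (l1 \<xi> - l2 \<xi>) * exp (l1 \<xi> * of_real t) +
          (l1 \<xi> * fourier u0 \<xi> - fourier u1 \<xi>) / (l1 \<xi> - l2 \<xi>) * exp (l2 \<xi> * of_real t))
          (\<lambda>t. (fourier u1 \<xi> - l2 \<xi> * fourier u0 \<xi>) / (l1 \<xi> - l2 \<xi>) * l1 \<xi> * exp (l1 \<xi> * of_real t) +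
          (l1 \<xi> * fourier u0 \<xi> - fourier u1 \<xi>) / (l1 \<xi> - l2 \<xi>) * l2 \<xi> * exp (l2 \<xi> * of_real t))
          (\<lambda>t. (fourier u1 \<xi> - l2 \<xi> * fourier u0 \<xi>) / (l1 \<xi> - l2 \<xi>) * (l1 \<xi>)\<^sup>2 * exp (l1 \<xi> * of_real t) +
          (l1 \<xi> * fourier u0 \<xi> - fourier u1 \<xi>) / (l1 \<xi> - l2 \<xi>) * (l2 \<xi>)\<^sup>2 * exp (l2 \<xi> * of_real t))"
        by (rule ex(1)) auto
    qed (use ex(2,3) in simp_all)
  qed
  have vL2: "v t \<in> Lp_space 2" if t: "0 \<le> t" for t
  proof -
    have int: "integrable lborel (\<lambda>\<xi>. (5 + 4 * t\<^sup>2) * ((norm (fourier u0 \<xi>))\<^sup>2 + (norm (fourier u1 \<xi>))\<^sup>2))"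
      using F0 F1 by (intro integrable_mult_right Bochner_Integration.integrable_add) (auto simp: Lp_space_2_iff)
    have "integrable lborel (\<lambda>\<xi>. (norm (v t \<xi>))\<^sup>2)"
    proof (rule Bochner_Integration.integrable_bound[OF int])
      show "AE \<xi> in lborel. norm ((norm (v t \<xi>))\<^sup>2) \<le>
          norm ((5 + 4 * t\<^sup>2) * ((norm (fourier u0 \<xi>))\<^sup>2 + (norm (fourier u1 \<xi>))\<^sup>2))"
        using sol AE_norm_neq[of 0]
      proof eventually_elim
        case (elim \<xi>)
        from solves_at_state[OF elim(1)] obtain w' where
          "oscillator_state \<sigma> \<delta> (norm \<xi>) t (fourier u0 \<xi>) (fourier u1 \<xi>) (v t \<xi>) w'" by blast
        from all_frequency[OF this _ t] elim(2) show ?case by simp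
      qed
    qed (use vm in measurable)
    then show ?thesis using vm by (simp add: Lp_space_2_iff)
  qed
  have "\<forall>t. \<exists>f. 0 \<le> t \<longrightarrow> f \<in> Lp_space 2 \<and> (AE \<xi> in lborel. fourier f \<xi> = v t \<xi>)"
    using vL2 fourier_surj by metis
  then obtain u where "\<And>t. 0 \<le> t \<Longrightarrow> u t \<in> Lp_space 2 \<and> (AE \<xi> in lborel. fourier (u t) \<xi> = v t \<xi>)" by metis
  then show ?thesis using sol unfolding is_solution_iff by blast
qed

end

subsection \<open>The time derivative and the fractional Laplacian\<close>

lemma has_vector_derivative_tendsto:
  fixes z :: "real \<Rightarrow> 'a::real_normed_vector"
  assumes "(z has_vector_derivative z') (at t within S)"
  shows "((\<lambda>s. (z s - z t) /\<^sub>R (s - t)) \<longlongrightarrow> z') (at t within S)"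
proof -
  have "((\<lambda>s. (1 / norm (s - t)) *\<^sub>R (z s - (z t + (s - t) *\<^sub>R z'))) \<longlongrightarrow> 0) (at t within S)"
    using assms unfolding has_vector_derivative_def has_derivative_within by simp
  then have "((\<lambda>s. norm ((1 / norm (s - t)) *\<^sub>R (z s - (z t + (s - t) *\<^sub>R z')))) \<longlongrightarrow> 0) (at t within S)"
    by (rule tendsto_norm_zero)
  moreover have "\<forall>\<^sub>F s in at t within S. norm ((1 / norm (s - t)) *\<^sub>R (z s - (z t + (s - t) *\<^sub>R z'))) =
      norm ((z s - z t) /\<^sub>R (s - t) - z')"
  proof (rule eventually_at_filter[THEN iffD2], intro always_eventually allI impI)
    fix s assume "s \<noteq> t"
    then have "(z s - z t) /\<^sub>R (s - t) - z' = (1 / (s - t)) *\<^sub>R (z s - (z t + (s - t) *\<^sub>R z'))"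
      by (simp add: scaleR_diff_right scaleR_add_right inverse_eq_divide)
    then show "norm ((1 / norm (s - t)) *\<^sub>R (z s - (z t + (s - t) *\<^sub>R z'))) = norm ((z s - z t) /\<^sub>R (s - t) - z')"
      by simp
  qed
  ultimately have "((\<lambda>s. norm ((z s - z t) /\<^sub>R (s - t) - z')) \<longlongrightarrow> 0) (at t within S)"
    by (simp add: tendsto_cong)
  then show ?thesis using LIM_zero_iff tendsto_norm_zero_iff by blast
qed

text \<open>Limits in L^2 are unique almost everywhere, so the value chosen by
  \<open>time_deriv\<close> agrees with any given time derivative.\<close>

lemma Lp_norm_time_deriv:
  assumes "has_time_deriv u w t" "0 \<le> t"
  shows "Lp_norm 2 (time_deriv u t) = Lp_norm 2 w"
proof -
  have td: "has_time_deriv u (time_deriv u t) t"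
    unfolding time_deriv_def using assms(1) by (rule someI[of "\<lambda>w. has_time_deriv u w t"])
  \<comment> \<open>Uniqueness asks for a nontrivial filter; the points to the right of t provide
    it, also at t = 0.\<close>
  have "{t<..} \<subseteq> {0..}" using assms(2) by auto
  from at_le[OF this, of t] have "at t within {0..} \<noteq> bot"
    using trivial_limit_at_right_real[of t] by (auto simp: bot_unique)
  then have "AE x in lborel. time_deriv u t x = w x"
    using assms(1) td unfolding has_time_deriv_def by (auto intro: L2_tendsto_unique)
  then show ?thesis
    using assms(1) td by (intro Lp_norm_cong_AE) (auto simp: has_time_deriv_def Lp_space_def)
qed

lemma Lp_norm_frac_laplacian:
  assumes "f \<in> frac_laplacian_domain a"
  shows "Lp_norm 2 (frac_laplacian a f) = Lp_norm 2 (\<lambda>\<xi>. (norm \<xi> powr (2 * a)) *\<^sub>R fourier f \<xi>)"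
proof -
  let ?h = "\<lambda>\<xi>. (norm \<xi> powr (2 * a)) *\<^sub>R fourier f \<xi>"
  have h: "?h \<in> Lp_space 2" using assms by (simp add: frac_laplacian_domain_def)
  then have "\<exists>g. g \<in> Lp_space 2 \<and> (AE \<xi> in lborel. fourier g \<xi> = ?h \<xi>)" using fourier_surj by metis
  then have g: "frac_laplacian a f \<in> Lp_space 2 \<and> (AE \<xi> in lborel. fourier (frac_laplacian a f) \<xi> = ?h \<xi>)"
    unfolding frac_laplacian_def by (rule someI_ex)
  then have "Lp_norm 2 (fourier (frac_laplacian a f)) = Lp_norm 2 ?h"
    using h fourier_measurable by (intro Lp_norm_cong_AE) (auto simp: Lp_space_def)
  then show ?thesis using plancherel g by metis
qed

lemma fourier_quotient:
  assumes "f \<in> Lp_space 2" "g \<in> Lp_space 2" "w \<in> Lp_space 2"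
  shows "Lp_norm 2 (\<lambda>x. (f x - g x) /\<^sub>R c - w x) = Lp_norm 2 (\<lambda>\<xi>. (fourier f \<xi> - fourier g \<xi>) /\<^sub>R c - fourier w \<xi>)"
proof -
  have d: "(\<lambda>x. f x - g x) \<in> Lp_space 2" "(\<lambda>x. (f x - g x) /\<^sub>R c) \<in> Lp_space 2"
    using assms by (auto intro: Lp_space_2_diff Lp_space_2_scaleR)
  have dw: "(\<lambda>x. (f x - g x) /\<^sub>R c - w x) \<in> Lp_space 2" by (intro Lp_space_2_diff d assms)
  have [measurable]: "fourier f \<in> borel_measurable borel" "fourier g \<in> borel_measurable borel"
      "fourier w \<in> borel_measurable borel" "fourier (\<lambda>x. (f x - g x) /\<^sub>R c - w x) \<in> borel_measurable borel"
    using assms dw by (auto intro: fourier_measurable)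
  have "AE \<xi> in lborel. fourier (\<lambda>x. (f x - g x) /\<^sub>R c - w x) \<xi> = (fourier f \<xi> - fourier g \<xi>) /\<^sub>R c - fourier w \<xi>"
    using fourier_diff[OF d(2) assms(3)] fourier_scaleR[OF d(1), of "inverse c"] fourier_diff[OF assms(1,2)]
    by eventually_elim simp
  then have "Lp_norm 2 (fourier (\<lambda>x. (f x - g x) /\<^sub>R c - w x)) = Lp_norm 2 (\<lambda>\<xi>. (fourier f \<xi> - fourier g \<xi>) /\<^sub>R c - fourier w \<xi>)"
    by (rule Lp_norm_cong_AE) measurable
  then show ?thesis by (simp add: plancherel[OF dw])
qed

lemma sobolev_space_Lp: "f \<in> sobolev_space s \<Longrightarrow> f \<in> Lp_space 2"
  by (simp add: sobolev_space_def)

lemma sobolev_weight: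
  assumes f: "f \<in> sobolev_space s" and s: "0 \<le> s"
  shows "(\<integral>\<^sup>+\<xi>. ennreal (norm \<xi> powr (2 * s) * (norm (fourier f \<xi>))\<^sup>2) \<partial>lborel) \<le> ennreal ((sobolev_norm s f)\<^sup>2)"
    and "Lp_norm 2 f \<le> sobolev_norm s f"
proof -
  let ?g = "\<lambda>\<xi>. ((1 + (norm \<xi>)\<^sup>2) powr (s / 2)) *\<^sub>R fourier f \<xi>"
  have g: "?g \<in> Lp_space 2" using f by (simp add: sobolev_space_def)
  note f2 = sobolev_space_Lp[OF f]
  have "norm \<xi> powr (2 * s) \<le> (1 + (norm \<xi>)\<^sup>2) powr s" for \<xi> :: "real ^ 'n"
  proof -
    have "norm \<xi> powr (2 * s) = ((norm \<xi>)\<^sup>2) powr s"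
      using powr_powr[of "norm \<xi>" 2 s] by simp
    also have "\<dots> \<le> (1 + (norm \<xi>)\<^sup>2) powr s" using s by (intro powr_mono2) auto
    finally show ?thesis .
  qed
  then have "(\<integral>\<^sup>+\<xi>. ennreal (norm \<xi> powr (2 * s) * (norm (fourier f \<xi>))\<^sup>2) \<partial>lborel) \<le>
      (\<integral>\<^sup>+\<xi>. ennreal ((norm (?g \<xi>))\<^sup>2) \<partial>lborel)"
    by (intro nn_integral_mono ennreal_leI) (auto simp: power_mult_distrib powr_square intro!: mult_right_mono)
  also have "\<dots> = ennreal ((sobolev_norm s f)\<^sup>2)"
    unfolding sobolev_norm_def by (rule ennreal_Lp_norm_2_power2[OF g, symmetric])
  finally show "(\<integral>\<^sup>+\<xi>. ennreal (norm \<xi> powr (2 * s) * (norm (fourier f \<xi>))\<^sup>2) \<partial>lborel) \<le> ennreal ((sobolev_norm s f)\<^sup>2)" .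
  have "Lp_norm 2 (fourier f) \<le> Lp_norm 2 ?g"
  proof (rule Lp_space_2_bound(2)[OF g fourier_measurable[OF f2]])
    have "1 \<le> (1 + (norm \<xi>)\<^sup>2) powr (s / 2)" for \<xi> :: "real ^ 'n"
      using s by (intro ge_one_powr_ge_zero) auto
    then show "AE \<xi> in lborel. norm (fourier f \<xi>) \<le> norm (?g \<xi>)"
      by (auto simp: mult_le_cancel_right1)
  qed
  then show "Lp_norm 2 f \<le> sobolev_norm s f" by (simp add: plancherel[OF f2] sobolev_norm_def)
qed

lemma sobolev_norm_nonneg [simp]: "0 \<le> sobolev_norm s f"
  by (simp add: sobolev_norm_def)

context structural_damping
begin

text \<open>The difference quotients converge at almost every frequency and are dominated by the
  Lipschitz constant of the trajectory, so dominated convergence gives the limit in L^2. The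
  argument runs along sequences: \<open>fourier (u s)\<close> agrees with \<open>v s\<close> only
  off a null set depending on s, and only countably many such sets can be discarded.\<close>

lemma time_derivative_exists:
  fixes u0 u1 :: "real ^ 'n \<Rightarrow> complex"
  assumes u0: "u0 \<in> sobolev_space \<sigma>" and u1: "u1 \<in> Lp_space 2"
    and sol: "is_solution \<sigma> \<delta> u0 u1 u" and t: "0 \<le> t"
  obtains w where "has_time_deriv u w t"
    "AE \<xi> in lborel. oscillator_state \<sigma> \<delta> (norm \<xi>) t (fourier u0 \<xi>) (fourier u1 \<xi>) (fourier (u t) \<xi>) (fourier w \<xi>)"
proof -
  have \<sigma>: "0 \<le> \<sigma>" using \<delta> \<sigma>\<delta> by simp
  obtain v where u: "\<And>t. 0 \<le> t \<Longrightarrow> u t \<in> Lp_space 2"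
    and uv: "\<And>t. 0 \<le> t \<Longrightarrow> AE \<xi> in lborel. fourier (u t) \<xi> = v t \<xi>"
    and v: "AE \<xi> in lborel. solves_at \<xi> (fourier u0 \<xi>) (fourier u1 \<xi>) (\<lambda>t. v t \<xi>)"
    using sol unfolding is_solution_iff by blast
  have um[measurable]: "fourier (u s) \<in> borel_measurable borel" if "0 \<le> s" for s
    using that by (intro fourier_measurable u)
  have [measurable]: "fourier u0 \<in> borel_measurable borel" "fourier u1 \<in> borel_measurable borel"
    using u1 sobolev_space_Lp[OF u0] by (auto intro: fourier_measurable)
  define q where "q s \<xi> = (fourier (u s) \<xi> - fourier (u t) \<xi>) /\<^sub>R (s - t)" for s \<xi>
  have qm[measurable]: "q s \<in> borel_measurable borel" if "0 \<le> s" for s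
    unfolding q_def using um[OF that] um[OF t] by measurable
  define D where "D \<xi> = (norm (fourier u1 \<xi>))\<^sup>2 + norm \<xi> powr (2 * \<sigma>) * (norm (fourier u0 \<xi>))\<^sup>2" for \<xi>
  have D0: "0 \<le> D \<xi>" for \<xi> by (simp add: D_def)
  \<comment> \<open>\<open>D\<close> is the initial energy at each frequency; the Sobolev regularity
    of \<open>u0\<close> makes it integrable.\<close>
  have D: "integrable lborel D"
  proof -
    have "integrable lborel (\<lambda>\<xi>. norm \<xi> powr (2 * \<sigma>) * (norm (fourier u0 \<xi>))\<^sup>2)"
      using sobolev_weight(1)[OF u0 \<sigma>] by (intro integrableI_bounded) (auto intro: order_le_less_trans)
    then show ?thesis
      unfolding D_def using fourier_Lp_space[OF u1] by (auto simp: Lp_space_2_iff)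
  qed
  \<comment> \<open>The limit along one fixed sequence, which makes \<open>W\<close> measurable. By
    \<open>W_deriv\<close> it is the velocity at time t of every trajectory following
    \<open>v\<close>.\<close>
  define W where "W \<xi> = lim (\<lambda>k. q (t + 1 / real (Suc k)) \<xi>)" for \<xi>
  have [measurable]: "W \<in> borel_measurable borel"
    unfolding W_def using t by (intro borel_measurable_lim_metric qm) auto
  have quotients: "AE \<xi> in lborel. (\<forall>k. norm (q (X k) \<xi>) \<le> sqrt (D \<xi>)) \<and>
      (\<forall>z'. (\<exists>z''. damped_oscillator (norm \<xi> powr (2 * \<delta>)) (norm \<xi> powr (2 * \<sigma>)) (\<lambda>t. v t \<xi>) z' z'') \<longrightarrow>
        (\<lambda>k. q (X k) \<xi>) \<longlonglongrightarrow> z' t)"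
    if X: "\<And>k. X k \<in> {0..} - {t}" "X \<longlonglongrightarrow> t" for X :: "nat \<Rightarrow> real"
  proof -
    have "AE \<xi> in lborel. \<forall>k. fourier (u (X k)) \<xi> = v (X k) \<xi>"
      using X by (subst AE_all_countable) (auto intro: uv)
    then show ?thesis
      using uv[OF t] v
    proof eventually_elim
      case (elim \<xi>)
      have q: "q (X k) \<xi> = (v (X k) \<xi> - v t \<xi>) /\<^sub>R (X k - t)" for k
        using elim by (simp add: q_def)
      show ?case
      proof (intro conjI allI impI)
        fix k
        obtain y' y'' where osc: "damped_oscillator (norm \<xi> powr (2 * \<delta>)) (norm \<xi> powr (2 * \<sigma>)) (\<lambda>t. v t \<xi>) y' y''"
          and y: "v 0 \<xi> = fourier u0 \<xi>" "y' 0 = fourier u1 \<xi>"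
          using elim(3) by (auto simp: solves_at_def)
        have "norm (v (X k) \<xi> - v t \<xi>) \<le> sqrt (D \<xi>) * \<bar>X k - t\<bar>"
          using damped_oscillator.norm_diff_le[OF osc, of "X k" t] X(1)[of k] t by (simp add: y D_def)
        moreover have "0 < \<bar>X k - t\<bar>" using X(1)[of k] by simp
        ultimately show "norm (q (X k) \<xi>) \<le> sqrt (D \<xi>)"
          unfolding q by (simp add: divide_inverse_commute[symmetric] pos_divide_le_eq inverse_eq_divide)
      next
        fix z' assume "\<exists>z''. damped_oscillator (norm \<xi> powr (2 * \<delta>)) (norm \<xi> powr (2 * \<sigma>)) (\<lambda>t. v t \<xi>) z' z''"
        then have "((\<lambda>s. v s \<xi>) has_vector_derivative z' t) (at t within {0..})"
          using t by (auto simp: damped_oscillator_def)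
        from has_vector_derivative_tendsto[OF this]
        have "((\<lambda>s. (v s \<xi> - v t \<xi>) /\<^sub>R (s - t)) \<circ> X) \<longlonglongrightarrow> z' t"
          unfolding tendsto_at_iff_sequentially using X by blast
        then show "(\<lambda>k. q (X k) \<xi>) \<longlonglongrightarrow> z' t" by (simp add: q comp_def)
      qed
    qed
  qed
  have seq: "t + 1 / real (Suc k) \<in> {0..} - {t}" "(\<lambda>k. t + 1 / real (Suc k)) \<longlonglongrightarrow> t" for k
  proof -
    have "(\<lambda>k. t + 1 / real (Suc k)) \<longlonglongrightarrow> t + 0"
      by (intro tendsto_intros LIMSEQ_Suc lim_1_over_n)
    then show "(\<lambda>k. t + 1 / real (Suc k)) \<longlonglongrightarrow> t" by simp
  qed (use t in auto)
  have W_deriv: "AE \<xi> in lborel. \<forall>z'. (\<exists>z''. damped_oscillator (norm \<xi> powr (2 * \<delta>)) (norm \<xi> powr (2 * \<sigma>)) (\<lambda>t. v t \<xi>) z' z'')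
      \<longrightarrow> z' t = W \<xi>"
    using quotients[OF seq]
  proof eventually_elim
    case (elim \<xi>)
    then show ?case unfolding W_def by (auto intro: limI[symmetric])
  qed
  have q_W: "AE \<xi> in lborel. (\<forall>k. norm (q (X k) \<xi>) \<le> sqrt (D \<xi>)) \<and> (\<lambda>k. q (X k) \<xi>) \<longlonglongrightarrow> W \<xi> \<and> norm (W \<xi>) \<le> sqrt (D \<xi>)"
    if X: "\<And>k. X k \<in> {0..} - {t}" "X \<longlonglongrightarrow> t" for X :: "nat \<Rightarrow> real"
    using quotients[OF X] W_deriv v
  proof eventually_elim
    case (elim \<xi>)
    then obtain z' z'' where osc: "damped_oscillator (norm \<xi> powr (2 * \<delta>)) (norm \<xi> powr (2 * \<sigma>)) (\<lambda>t. v t \<xi>) z' z''"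
      by (auto simp: solves_at_def)
    then have lim: "(\<lambda>k. q (X k) \<xi>) \<longlonglongrightarrow> W \<xi>" using elim by metis
    have "norm (W \<xi>) \<le> sqrt (D \<xi>)"
      by (rule LIMSEQ_le_const2[OF tendsto_norm[OF lim]]) (use elim in blast)
    then show ?case using lim elim by blast
  qed
  have W2: "W \<in> Lp_space 2"
  proof -
    have "integrable lborel (\<lambda>\<xi>. (norm (W \<xi>))\<^sup>2)"
    proof (rule Bochner_Integration.integrable_bound[OF D])
      show "AE \<xi> in lborel. norm ((norm (W \<xi>))\<^sup>2) \<le> norm (D \<xi>)"
        using q_W[OF seq]
      proof eventually_elim
        case (elim \<xi>)
        then have "(norm (W \<xi>))\<^sup>2 \<le> (sqrt (D \<xi>))\<^sup>2" by (intro power_mono) auto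
        then show ?case using D0[of \<xi>] by simp
      qed
    qed measurable
    then show ?thesis by (simp add: Lp_space_2_iff)
  qed
  obtain w where w: "w \<in> Lp_space 2" "AE \<xi> in lborel. fourier w \<xi> = W \<xi>" using fourier_surj[OF W2] by blast
  have [measurable]: "fourier w \<in> borel_measurable borel" by (intro fourier_measurable w)
  have lim: "((\<lambda>s. Lp_norm 2 (\<lambda>\<xi>. q s \<xi> - fourier w \<xi>)) \<longlongrightarrow> 0) (at t within {0..})"
    unfolding tendsto_at_iff_sequentially
  proof (intro allI impI)
    fix X :: "nat \<Rightarrow> real" assume "\<forall>k. X k \<in> {0..} - {t}" and Xt: "X \<longlonglongrightarrow> t"
    then have X: "X k \<in> {0..} - {t}" for k by blast
    have [measurable]: "q (X k) \<in> borel_measurable borel" for k using X[of k] by (intro qm) auto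
    have "(\<lambda>k. LINT \<xi>|lborel. (norm (q (X k) \<xi> - fourier w \<xi>))\<^sup>2) \<longlonglongrightarrow> (LINT \<xi>|(lborel :: (real ^ 'n) measure). 0)"
    proof (rule integral_dominated_convergence)
      show "integrable lborel (\<lambda>\<xi>. 4 * D \<xi>)" using D by simp
      show "AE \<xi> in lborel. (\<lambda>k. (norm (q (X k) \<xi> - fourier w \<xi>))\<^sup>2) \<longlonglongrightarrow> 0"
        using q_W[OF X Xt] w(2)
      proof eventually_elim
        case (elim \<xi>)
        then have "(\<lambda>k. (norm (q (X k) \<xi> - fourier w \<xi>))\<^sup>2) \<longlonglongrightarrow> (norm (W \<xi> - fourier w \<xi>))\<^sup>2"
          by (intro tendsto_intros) auto
        then show ?case using elim by simp
      qed
      show "AE \<xi> in lborel. norm ((norm (q (X k) \<xi> - fourier w \<xi>))\<^sup>2) \<le> 4 * D \<xi>" for k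
        using q_W[OF X Xt] w(2)
      proof eventually_elim
        case (elim \<xi>)
        have "norm (q (X k) \<xi> - fourier w \<xi>) \<le> norm (q (X k) \<xi>) + norm (W \<xi>)"
          using elim norm_triangle_ineq4[of "q (X k) \<xi>" "W \<xi>"] by simp
        also have "\<dots> \<le> 2 * sqrt (D \<xi>)" using elim(1) by (smt (verit))
        finally have "(norm (q (X k) \<xi> - fourier w \<xi>))\<^sup>2 \<le> (2 * sqrt (D \<xi>))\<^sup>2" by (intro power_mono) auto
        then show ?case using D0[of \<xi>] by (simp add: power_mult_distrib)
      qed
    qed measurable
    then have "(\<lambda>k. sqrt (LINT \<xi>|lborel. (norm (q (X k) \<xi> - fourier w \<xi>))\<^sup>2)) \<longlonglongrightarrow> sqrt 0"
      by (intro tendsto_intros) simp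
    then show "((\<lambda>s. Lp_norm 2 (\<lambda>\<xi>. q s \<xi> - fourier w \<xi>)) \<circ> X) \<longlonglongrightarrow> 0"
      by (simp add: Lp_norm_2_eq comp_def)
  qed
  have ev: "\<forall>\<^sub>F s in at t within {0..}. 0 \<le> s" by (simp add: eventually_at_filter)
  have "has_time_deriv u w t"
    unfolding has_time_deriv_def L2_tendsto_def
  proof (intro conjI w)
    show "\<forall>\<^sub>F s in at t within {0..}. (\<lambda>x. (u s x - u t x) /\<^sub>R (s - t) - w x) \<in> Lp_space 2"
      using ev by eventually_elim (intro Lp_space_2_diff Lp_space_2_scaleR u t w)
    have "\<forall>\<^sub>F s in at t within {0..}. Lp_norm 2 (\<lambda>x. (u s x - u t x) /\<^sub>R (s - t) - w x) = Lp_norm 2 (\<lambda>\<xi>. q s \<xi> - fourier w \<xi>)"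
      using ev by eventually_elim (simp add: fourier_quotient u t w q_def)
    then show "((\<lambda>s. Lp_norm 2 (\<lambda>x. (u s x - u t x) /\<^sub>R (s - t) - w x)) \<longlongrightarrow> 0) (at t within {0..})"
      using lim by (simp add: tendsto_cong)
  qed
  moreover have "AE \<xi> in lborel. oscillator_state \<sigma> \<delta> (norm \<xi>) t (fourier u0 \<xi>) (fourier u1 \<xi>) (fourier (u t) \<xi>) (fourier w \<xi>)"
    using v W_deriv w(2) uv[OF t]
  proof eventually_elim
    case (elim \<xi>)
    then obtain z' z'' where osc: "damped_oscillator (norm \<xi> powr (2 * \<delta>)) (norm \<xi> powr (2 * \<sigma>)) (\<lambda>t. v t \<xi>) z' z''"
      and z: "v 0 \<xi> = fourier u0 \<xi>" "z' 0 = fourier u1 \<xi>" by (auto simp: solves_at_def)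
    moreover have "z' t = fourier w \<xi>" using elim osc by metis
    ultimately show ?case using elim unfolding oscillator_state_def by metis
  qed
  ultimately show ?thesis using that by blast
qed

text \<open>The parameters \<open>a0\<close> and \<open>a1\<close> stand for the L^m norm of
  \<open>u0\<close> and the weighted norm of \<open>u1\<close>, with m < 2 or m = 2, so both
  families of estimates are instances. The rates are half of those in
  \<open>frequency_bounds\<close>, which concern squares.\<close>

definition decay_bounds where
  "decay_bounds K p a0 a1 u0 u1 u t \<longleftrightarrow>
     Lp_norm 2 (u t) \<le> K * (1 + t) powr (- (p / (2 * \<beta>))) * (a0 + Lp_norm 2 u0 + (a1 + Lp_norm 2 u1)) \<and>
     (u0 \<in> sobolev_space \<sigma> \<longrightarrow>
       (u t \<in> frac_laplacian_domain (\<sigma> / 2) \<and>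
        Lp_norm 2 (frac_laplacian (\<sigma> / 2) (u t)) \<le>
          K * (1 + t) powr (- (p / (2 * \<beta>)) - \<sigma> / \<beta>) * (a0 + sobolev_norm \<sigma> u0 + (a1 + Lp_norm 2 u1))) \<and>
       (\<exists>w. has_time_deriv u w t) \<and>
       Lp_norm 2 (time_deriv u t) \<le>
          K * (1 + t) powr (- (p / (2 * \<beta>)) - 1) * (a0 + sobolev_norm \<sigma> u0 + (a1 + Lp_norm 2 u1)))"
  for u0 u1 :: "real ^ 'n \<Rightarrow> complex"

lemma solution_estimates:
  fixes p c :: real
  assumes p: "0 \<le> p" and c: "0 < c"
  obtains K where "0 < K" and
    "\<And>(u0 :: real ^ 'n \<Rightarrow> complex) u1 u t a0 a1. u0 \<in> Lp_space 2 \<Longrightarrow> u1 \<in> Lp_space 2 \<Longrightarrow>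
      is_solution \<sigma> \<delta> u0 u1 u \<Longrightarrow> 0 \<le> t \<Longrightarrow> 0 \<le> a0 \<Longrightarrow> 0 \<le> a1 \<Longrightarrow>
      ball_growth (data_energy u0 u1) (c * (a0\<^sup>2 + a1\<^sup>2)) p \<Longrightarrow> decay_bounds K p a0 a1 u0 u1 u t"
proof -
  have \<sigma>: "0 \<le> \<sigma>" using \<delta> \<sigma>\<delta> by simp
  obtain K where K: "0 < K" and bound: "\<And>(f0 :: real ^ 'n \<Rightarrow> complex) f1 Z Z' t A.
      f0 \<in> borel_measurable borel \<Longrightarrow> f1 \<in> borel_measurable borel \<Longrightarrow> 0 \<le> t \<Longrightarrow>
      AE \<xi> in lborel. oscillator_state \<sigma> \<delta> (norm \<xi>) t (f0 \<xi>) (f1 \<xi>) (Z \<xi>) (Z' \<xi>) \<Longrightarrow>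
      ball_growth (\<lambda>\<xi>. ennreal (low_energy (norm \<xi>) (f0 \<xi>) (f1 \<xi>)) * indicator (cball 0 1) \<xi>) A p \<Longrightarrow>
      frequency_bounds K p t A f0 f1 Z Z'"
    using frequency_decay[OF p, where 'n='n] by blast
  \<comment> \<open>The value \<open>c + 1\<close> bounds both the coefficient \<open>c\<close> of
    the squared data norms and the coefficient 1 of the other two; the square roots pass from
    squared norms to norms.\<close>
  define M where "M = sqrt K * sqrt (c + 1)"
  have M: "0 < M" using K c by (simp add: M_def)
  have root: "K * s powr (- (2 * x)) * (c * (a0\<^sup>2 + a1\<^sup>2) + X\<^sup>2 + Y\<^sup>2) \<le> (M * s powr (- x) * (a0 + X + (a1 + Y)))\<^sup>2"
    if "0 \<le> a0" "0 \<le> a1" "0 \<le> X" "0 \<le> Y" for a0 a1 X Y s x :: real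
  proof -
    have 1: "a0\<^sup>2 + a1\<^sup>2 + X\<^sup>2 + Y\<^sup>2 \<le> (a0 + X + (a1 + Y))\<^sup>2"
      using that by (simp add: power2_eq_square algebra_simps)
    have "c * (a0\<^sup>2 + a1\<^sup>2) + X\<^sup>2 + Y\<^sup>2 \<le> (c + 1) * (a0\<^sup>2 + a1\<^sup>2 + X\<^sup>2 + Y\<^sup>2)"
      using that c by (simp add: algebra_simps)
    also have "\<dots> \<le> (c + 1) * (a0 + X + (a1 + Y))\<^sup>2" using c 1 by (intro mult_left_mono) auto
    finally have "K * s powr (- (2 * x)) * (c * (a0\<^sup>2 + a1\<^sup>2) + X\<^sup>2 + Y\<^sup>2) \<le>
        K * s powr (- (2 * x)) * ((c + 1) * (a0 + X + (a1 + Y))\<^sup>2)"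
      using K by (intro mult_left_mono) auto
    also have "\<dots> = (M * s powr (- x) * (a0 + X + (a1 + Y)))\<^sup>2"
      using K c by (simp add: M_def power_mult_distrib powr_square)
    finally show ?thesis .
  qed
  show ?thesis
  proof (rule that[OF M], unfold decay_bounds_def, intro conjI impI)
    fix u0 u1 :: "real ^ 'n \<Rightarrow> complex" and u and t a0 a1 :: real
    assume u0: "u0 \<in> Lp_space 2" and u1: "u1 \<in> Lp_space 2" and sol: "is_solution \<sigma> \<delta> u0 u1 u" and t: "0 \<le> t"
      and nn: "0 \<le> a0" "0 \<le> a1" and gr: "ball_growth (data_energy u0 u1) (c * (a0\<^sup>2 + a1\<^sup>2)) p"
    have ut: "u t \<in> Lp_space 2" using sol t by (simp add: is_solution_iff)
    have [measurable]: "fourier (u t) \<in> borel_measurable borel" by (intro fourier_measurable ut)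
    have fm: "fourier u0 \<in> borel_measurable borel" "fourier u1 \<in> borel_measurable borel"
      using u0 u1 by (auto intro: fourier_measurable)
    have X1: "(\<integral>\<^sup>+\<xi>. ennreal ((norm (fourier u1 \<xi>))\<^sup>2) \<partial>lborel) \<le> ennreal ((Lp_norm 2 u1)\<^sup>2)"
      using plancherel[OF u1] by (simp add: ennreal_Lp_norm_2_power2[symmetric] fourier_Lp_space u1)
    have X0: "(\<integral>\<^sup>+\<xi>. ennreal ((norm (fourier u0 \<xi>))\<^sup>2) \<partial>lborel) \<le> ennreal ((Lp_norm 2 u0)\<^sup>2)"
      using plancherel[OF u0] by (simp add: ennreal_Lp_norm_2_power2[symmetric] fourier_Lp_space u0)
    {
      obtain v where uv: "AE \<xi> in lborel. fourier (u t) \<xi> = v t \<xi>"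
        and v: "AE \<xi> in lborel. solves_at \<xi> (fourier u0 \<xi>) (fourier u1 \<xi>) (\<lambda>t. v t \<xi>)"
        using sol t unfolding is_solution_iff by blast
      have "AE \<xi> in lborel. \<exists>w'. oscillator_state \<sigma> \<delta> (norm \<xi>) t (fourier u0 \<xi>) (fourier u1 \<xi>) (fourier (u t) \<xi>) w'"
        using uv v
      proof eventually_elim
        case (elim \<xi>)
        then show ?case using solves_at_state[OF elim(2), of t] by simp
      qed
      \<comment> \<open>For \<open>u0\<close> merely in L^2 there may be no time derivative in L^2,
        so the velocity at time t is chosen frequency by frequency.\<close>
      then have st: "AE \<xi> in lborel. oscillator_state \<sigma> \<delta> (norm \<xi>) t (fourier u0 \<xi>) (fourier u1 \<xi>) (fourier (u t) \<xi>)
          (SOME w'. oscillator_state \<sigma> \<delta> (norm \<xi>) t (fourier u0 \<xi>) (fourier u1 \<xi>) (fourier (u t) \<xi>) w')"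
        by eventually_elim (rule someI_ex)
      have "(\<integral>\<^sup>+\<xi>. ennreal ((norm (fourier (u t) \<xi>))\<^sup>2) \<partial>lborel) \<le>
          ennreal (K * (1 + t) powr (- (p / \<beta>)) * (c * (a0\<^sup>2 + a1\<^sup>2) + (Lp_norm 2 u0)\<^sup>2 + (Lp_norm 2 u1)\<^sup>2))"
        using bound[OF fm t st gr, unfolded frequency_bounds_def, rule_format, of "(Lp_norm 2 u0)\<^sup>2" "(Lp_norm 2 u1)\<^sup>2" 0] X0 X1 by simp
      also have "\<dots> \<le> ennreal ((M * (1 + t) powr (- (p / (2 * \<beta>))) * (a0 + Lp_norm 2 u0 + (a1 + Lp_norm 2 u1)))\<^sup>2)"
        using root[of a0 a1 "Lp_norm 2 u0" "Lp_norm 2 u1" "1 + t" "p / (2 * \<beta>)"] nn by (intro ennreal_leI) simp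
      finally have "Lp_norm 2 (fourier (u t)) \<le> M * (1 + t) powr (- (p / (2 * \<beta>))) * (a0 + Lp_norm 2 u0 + (a1 + Lp_norm 2 u1))"
        using nn M by (intro Lp_norm_2_leI) auto
      then show "Lp_norm 2 (u t) \<le> M * (1 + t) powr (- (p / (2 * \<beta>))) * (a0 + Lp_norm 2 u0 + (a1 + Lp_norm 2 u1))"
        by (simp add: plancherel ut)
    }
    assume s0: "u0 \<in> sobolev_space \<sigma>"
    obtain w where w: "has_time_deriv u w t" and st: "AE \<xi> in lborel. oscillator_state \<sigma> \<delta> (norm \<xi>) t
        (fourier u0 \<xi>) (fourier u1 \<xi>) (fourier (u t) \<xi>) (fourier w \<xi>)"
      using time_derivative_exists[OF s0 u1 sol t] .
    have w2: "w \<in> Lp_space 2" using w by (simp add: has_time_deriv_def)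
    note bounds = bound[OF fm t st gr, unfolded frequency_bounds_def, rule_format, of 0 "(Lp_norm 2 u1)\<^sup>2" "(sobolev_norm \<sigma> u0)\<^sup>2",
        OF _ _ _ X1, THEN conjunct2, rule_format, OF _ _ _ sobolev_weight(1)[OF s0 \<sigma>], simplified]
    let ?h = "\<lambda>\<xi>. (norm \<xi> powr (2 * (\<sigma> / 2))) *\<^sub>R fourier (u t) \<xi>"
    let ?a = "M * (1 + t) powr (- (p / (2 * \<beta>)) - \<sigma> / \<beta>) * (a0 + sobolev_norm \<sigma> u0 + (a1 + Lp_norm 2 u1))"
    have "(\<integral>\<^sup>+\<xi>. ennreal ((norm (?h \<xi>))\<^sup>2) \<partial>lborel) =
        (\<integral>\<^sup>+\<xi>. ennreal (norm \<xi> powr (2 * \<sigma>) * (norm (fourier (u t) \<xi>))\<^sup>2) \<partial>lborel)"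
      by (simp add: power_mult_distrib powr_square)
    also have "\<dots> \<le> ennreal (K * (1 + t) powr (- (p / \<beta> + 2 * \<sigma> / \<beta>)) * (c * (a0\<^sup>2 + a1\<^sup>2) + (sobolev_norm \<sigma> u0)\<^sup>2 + (Lp_norm 2 u1)\<^sup>2))"
      using bounds by simp
    also have "\<dots> \<le> ennreal (?a\<^sup>2)"
    proof (rule ennreal_leI)
      have "- (p / \<beta> + 2 * \<sigma> / \<beta>) = - (2 * (p / (2 * \<beta>) + \<sigma> / \<beta>))" "- (p / (2 * \<beta>)) - \<sigma> / \<beta> = - (p / (2 * \<beta>) + \<sigma> / \<beta>)"
        by simp_all
      then show "K * (1 + t) powr (- (p / \<beta> + 2 * \<sigma> / \<beta>)) * (c * (a0\<^sup>2 + a1\<^sup>2) + (sobolev_norm \<sigma> u0)\<^sup>2 + (Lp_norm 2 u1)\<^sup>2) \<le> ?a\<^sup>2"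
        using root[of a0 a1 "sobolev_norm \<sigma> u0" "Lp_norm 2 u1" "1 + t" "p / (2 * \<beta>) + \<sigma> / \<beta>"] nn
        by (simp only: sobolev_norm_nonneg Lp_norm_nonneg)
    qed
    finally have h: "(\<integral>\<^sup>+\<xi>. ennreal ((norm (?h \<xi>))\<^sup>2) \<partial>lborel) \<le> ennreal (?a\<^sup>2)" .
    have hm: "?h \<in> borel_measurable borel" by measurable
    show dom: "u t \<in> frac_laplacian_domain (\<sigma> / 2)"
      unfolding frac_laplacian_domain_def using ut Lp_space_2_I[OF hm h] by simp
    show "Lp_norm 2 (frac_laplacian (\<sigma> / 2) (u t)) \<le> ?a"
      unfolding Lp_norm_frac_laplacian[OF dom] using nn M by (intro Lp_norm_2_leI[OF hm _ h]) auto
    show "\<exists>w. has_time_deriv u w t" using w by blast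
    let ?d = "M * (1 + t) powr (- (p / (2 * \<beta>)) - 1) * (a0 + sobolev_norm \<sigma> u0 + (a1 + Lp_norm 2 u1))"
    have "(\<integral>\<^sup>+\<xi>. ennreal ((norm (fourier w \<xi>))\<^sup>2) \<partial>lborel) \<le>
        ennreal (K * (1 + t) powr (- (p / \<beta> + 2)) * (c * (a0\<^sup>2 + a1\<^sup>2) + (sobolev_norm \<sigma> u0)\<^sup>2 + (Lp_norm 2 u1)\<^sup>2))"
      using bounds by simp
    also have "\<dots> \<le> ennreal (?d\<^sup>2)"
    proof (rule ennreal_leI)
      have "- (p / \<beta> + 2) = - (2 * (p / (2 * \<beta>) + 1))" "- (p / (2 * \<beta>)) - 1 = - (p / (2 * \<beta>) + 1)"
        by simp_all
      then show "K * (1 + t) powr (- (p / \<beta> + 2)) * (c * (a0\<^sup>2 + a1\<^sup>2) + (sobolev_norm \<sigma> u0)\<^sup>2 + (Lp_norm 2 u1)\<^sup>2) \<le> ?d\<^sup>2"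
        using root[of a0 a1 "sobolev_norm \<sigma> u0" "Lp_norm 2 u1" "1 + t" "p / (2 * \<beta>) + 1"] nn
        by (simp only: sobolev_norm_nonneg Lp_norm_nonneg)
    qed
    finally have "Lp_norm 2 (fourier w) \<le> ?d"
      using nn M by (intro Lp_norm_2_leI fourier_measurable w2) auto
    then show "Lp_norm 2 (time_deriv u t) \<le> ?d"
      by (simp add: Lp_norm_time_deriv[OF w t] plancherel w2)
  qed
qed

end

subsection \<open>The decay estimates\<close>

text \<open>Existence is part of the claim, so the estimates for all solutions are not vacuous.
  Domain membership and differentiability accompany the estimates because
  \<open>frac_laplacian\<close> and \<open>time_deriv\<close> are choices that mean something only
  then.\<close>

theorem theorem1p1:
  fixes \<sigma> \<delta> m :: real
  assumes "\<sigma> \<ge> 1" and "0 < 2 * \<delta>" and "2 * \<delta> < \<sigma>" and "1 < m" and "m < 2"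
    and "real CARD('n::finite) > 2 * m * \<delta> / (m - 1)"
  shows "\<exists>C>0. \<forall>u0 \<in> Lp_space 2. \<forall>u1 \<in> Lp_space 2.
    (\<exists>u :: real \<Rightarrow> real ^ 'n \<Rightarrow> complex. is_solution \<sigma> \<delta> u0 u1 u) \<and>
    (\<forall>u :: real \<Rightarrow> real ^ 'n \<Rightarrow> complex. is_solution \<sigma> \<delta> u0 u1 u \<longrightarrow> (\<forall>t\<ge>0.
      (u0 \<in> Lp_space m \<inter> Lp_space 2 \<and> u1 \<in> weighted_Lp_space (2 * \<delta>) m \<inter> Lp_space 2 \<longrightarrow>
         Lp_norm 2 (u t)
           \<le> C * (1 + t) powr (- (real CARD('n) / (2 * (\<sigma> - \<delta>))) * (1 / m - 1 / 2))
                * (Lp_norm m u0 + Lp_norm 2 u0)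
             + C * (1 + t) powr (- (real CARD('n) / (2 * (\<sigma> - \<delta>))) * (1 / m - 1 / 2))
                * (weighted_Lp_norm (2 * \<delta>) m u1 + Lp_norm 2 u1)) \<and>
      (u0 \<in> Lp_space m \<inter> sobolev_space \<sigma> \<and> u1 \<in> weighted_Lp_space (2 * \<delta>) m \<inter> Lp_space 2 \<longrightarrow>
         u t \<in> frac_laplacian_domain (\<sigma> / 2) \<and>
         Lp_norm 2 (frac_laplacian (\<sigma> / 2) (u t))
           \<le> C * (1 + t) powr (- (real CARD('n) / (2 * (\<sigma> - \<delta>))) * (1 / m - 1 / 2)
                                - \<sigma> / (2 * (\<sigma> - \<delta>)))
                * (Lp_norm m u0 + sobolev_norm \<sigma> u0)
             + C * (1 + t) powr (- (real CARD('n) / (2 * (\<sigma> - \<delta>))) * (1 / m - 1 / 2)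
                                - \<sigma> / (2 * (\<sigma> - \<delta>)))
                * (weighted_Lp_norm (2 * \<delta>) m u1 + Lp_norm 2 u1)) \<and>
      (u0 \<in> Lp_space m \<inter> sobolev_space \<sigma> \<and> u1 \<in> weighted_Lp_space (2 * \<delta>) m \<inter> Lp_space 2 \<longrightarrow>
         (\<exists>w. has_time_deriv u w t) \<and>
         Lp_norm 2 (time_deriv u t)
           \<le> C * (1 + t) powr (- (real CARD('n) / (2 * (\<sigma> - \<delta>))) * (1 / m - 1 / 2) - 1)
                * (Lp_norm m u0 + sobolev_norm \<sigma> u0)
             + C * (1 + t) powr (- (real CARD('n) / (2 * (\<sigma> - \<delta>))) * (1 / m - 1 / 2) - 1)
                * (weighted_Lp_norm (2 * \<delta>) m u1 + Lp_norm 2 u1)) \<and>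
      (u0 \<in> Lp_space 2 \<and> u1 \<in> weighted_Lp_space (2 * \<delta>) 2 \<inter> Lp_space 2 \<longrightarrow>
         Lp_norm 2 (u t)
           \<le> C * (Lp_norm 2 u0 + (weighted_Lp_norm (2 * \<delta>) 2 u1 + Lp_norm 2 u1))) \<and>
      (u0 \<in> sobolev_space \<sigma> \<and> u1 \<in> weighted_Lp_space (2 * \<delta>) 2 \<inter> Lp_space 2 \<longrightarrow>
         u t \<in> frac_laplacian_domain (\<sigma> / 2) \<and>
         Lp_norm 2 (frac_laplacian (\<sigma> / 2) (u t))
           \<le> C * (1 + t) powr (- (\<sigma> / (2 * (\<sigma> - \<delta>))))
                * (sobolev_norm \<sigma> u0 + (weighted_Lp_norm (2 * \<delta>) 2 u1 + Lp_norm 2 u1))) \<and>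
      (u0 \<in> sobolev_space \<sigma> \<and> u1 \<in> weighted_Lp_space (2 * \<delta>) 2 \<inter> Lp_space 2 \<longrightarrow>
         (\<exists>w. has_time_deriv u w t) \<and>
         Lp_norm 2 (time_deriv u t)
           \<le> C * (1 + t) powr (- 1)
                * (sobolev_norm \<sigma> u0 + (weighted_Lp_norm (2 * \<delta>) 2 u1 + Lp_norm 2 u1)))))"
proof -
  interpret structural_damping \<sigma> \<delta> using assms by unfold_locales auto
  let ?n = "real CARD('n)" and ?N = "Lp_norm 2 :: (real ^ 'n \<Rightarrow> complex) \<Rightarrow> real"
  let ?p = "2 * ?n / m - ?n"
  \<comment> \<open>From m < 2 follows 2 (m - 1) \<le> m, so the assumed lower bound on n is at
    least 4\<delta>, the threshold of the Hardy inequality with a = 2\<delta>.\<close>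
  have n4: "4 * \<delta> < ?n"
  proof -
    have "2 * (m - 1) \<le> m" using assms by simp
    then have "4 * \<delta> \<le> 2 * m * \<delta> / (m - 1)"
      using assms mult_left_mono[of "2 * (m - 1)" m "2 * \<delta>"] by (simp add: pos_le_divide_eq mult_ac)
    then show ?thesis using assms by linarith
  qed
  have p: "0 \<le> ?p" using assms by (simp add: field_simps)
  obtain c1 where c1: "0 < c1" and g1: "\<And>u0 u1 :: real ^ 'n \<Rightarrow> complex. u0 \<in> Lp_space 2 \<Longrightarrow> u1 \<in> Lp_space 2 \<Longrightarrow>
      u0 \<in> Lp_space m \<Longrightarrow> u1 \<in> weighted_Lp_space (2 * \<delta>) m \<Longrightarrow>
      ball_growth (data_energy u0 u1) (c1 * ((Lp_norm m u0)\<^sup>2 + (weighted_Lp_norm (2 * \<delta>) m u1)\<^sup>2)) ?p"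
    using data_energy_growth_Lm[OF assms(4-6)] by blast
  obtain c2 where c2: "0 < c2" and g2: "\<And>u0 u1 :: real ^ 'n \<Rightarrow> complex. u0 \<in> Lp_space 2 \<Longrightarrow> u1 \<in> Lp_space 2 \<Longrightarrow>
      u1 \<in> weighted_Lp_space (2 * \<delta>) 2 \<Longrightarrow>
      ball_growth (data_energy u0 u1) (c2 * ((Lp_norm 2 u0)\<^sup>2 + (weighted_Lp_norm (2 * \<delta>) 2 u1)\<^sup>2)) 0"
    using data_energy_growth_L2[OF n4] by blast
  obtain K1 where K1: "0 < K1" and e1: "\<And>(u0 :: real ^ 'n \<Rightarrow> complex) u1 u t a0 a1. u0 \<in> Lp_space 2 \<Longrightarrow> u1 \<in> Lp_space 2 \<Longrightarrow>
      is_solution \<sigma> \<delta> u0 u1 u \<Longrightarrow> 0 \<le> t \<Longrightarrow> 0 \<le> a0 \<Longrightarrow> 0 \<le> a1 \<Longrightarrow>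
      ball_growth (data_energy u0 u1) (c1 * (a0\<^sup>2 + a1\<^sup>2)) ?p \<Longrightarrow> decay_bounds K1 ?p a0 a1 u0 u1 u t"
    using solution_estimates[OF p c1, where 'n='n] by blast
  obtain K2 where K2: "0 < K2" and e2: "\<And>(u0 :: real ^ 'n \<Rightarrow> complex) u1 u t a0 a1. u0 \<in> Lp_space 2 \<Longrightarrow> u1 \<in> Lp_space 2 \<Longrightarrow>
      is_solution \<sigma> \<delta> u0 u1 u \<Longrightarrow> 0 \<le> t \<Longrightarrow> 0 \<le> a0 \<Longrightarrow> 0 \<le> a1 \<Longrightarrow>
      ball_growth (data_energy u0 u1) (c2 * (a0\<^sup>2 + a1\<^sup>2)) 0 \<Longrightarrow> decay_bounds K2 0 a0 a1 u0 u1 u t"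
    using solution_estimates[OF order_refl c2, where 'n='n] by blast
  \<comment> \<open>The factor 2 is for the second family: there \<open>a0\<close> is itself the L^2
    norm of \<open>u0\<close>, so the datum is counted twice.\<close>
  define C where "C = K1 + 2 * K2"
  have C: "0 < C" "K1 \<le> C" "2 * K2 \<le> C" using K1 K2 by (auto simp: C_def)
  have rate: "- (?p / (2 * \<beta>)) = - (?n / (2 * (\<sigma> - \<delta>))) * (1 / m - 1 / 2)"
    using assms \<beta>(1) by (simp add: \<beta>_def field_simps)
  have rates: "\<sigma> / \<beta> = \<sigma> / (2 * (\<sigma> - \<delta>))" by (simp add: \<beta>_def)
  have up1: "x \<le> C * s powr r * X + C * s powr r * Y" if "x \<le> K1 * s powr r * (X + Y)" "0 \<le> X" "0 \<le> Y" for x s r X Y :: real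
  proof -
    have "K1 * s powr r * (X + Y) \<le> C * s powr r * (X + Y)"
      using C that by (intro mult_right_mono) auto
    then show ?thesis using that by (simp add: distrib_left)
  qed
  have up2: "x \<le> C * s powr r * (X + Y)"
    if "x \<le> K2 * s powr r * (X' + X + Y)" "X' \<le> X" "0 \<le> X" "0 \<le> Y" for x s r X X' Y :: real
  proof -
    have "x \<le> K2 * s powr r * (2 * (X + Y))"
      using that(1) by (rule order_trans) (use that K2 in \<open>intro mult_left_mono\<close>, auto)
    also have "\<dots> = 2 * K2 * s powr r * (X + Y)" by simp
    also have "\<dots> \<le> C * s powr r * (X + Y)" using C that by (intro mult_right_mono) auto
    finally show ?thesis .
  qed
  show ?thesis
  proof (intro exI[of _ C] conjI ballI allI impI)
    show "0 < C" by (rule C)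
    fix u0 u1 :: "real ^ 'n \<Rightarrow> complex"
    assume u: "u0 \<in> Lp_space 2" "u1 \<in> Lp_space 2"
    show "\<exists>u. is_solution \<sigma> \<delta> u0 u1 u" by (rule solution_exists[OF u])
    fix u t assume sol: "is_solution \<sigma> \<delta> u0 u1 u" and t: "0 \<le> (t::real)"
    note E1 = e1[OF u sol t Lp_norm_nonneg weighted_Lp_norm_nonneg g1[OF u], unfolded decay_bounds_def rate rates]
    note E2 = e2[OF u sol t Lp_norm_nonneg weighted_Lp_norm_nonneg g2[OF u], unfolded decay_bounds_def rates]
    {
      assume a: "u0 \<in> Lp_space m \<inter> Lp_space 2 \<and> u1 \<in> weighted_Lp_space (2 * \<delta>) m \<inter> Lp_space 2"
      show "Lp_norm 2 (u t) \<le> C * (1 + t) powr (- (?n / (2 * (\<sigma> - \<delta>))) * (1 / m - 1 / 2)) * (Lp_norm m u0 + Lp_norm 2 u0)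
          + C * (1 + t) powr (- (?n / (2 * (\<sigma> - \<delta>))) * (1 / m - 1 / 2)) * (weighted_Lp_norm (2 * \<delta>) m u1 + Lp_norm 2 u1)"
        by (rule up1) (use E1 a in auto)
    next
      assume a: "u0 \<in> Lp_space m \<inter> sobolev_space \<sigma> \<and> u1 \<in> weighted_Lp_space (2 * \<delta>) m \<inter> Lp_space 2"
      show "u t \<in> frac_laplacian_domain (\<sigma> / 2)" using E1 a by blast
      show "Lp_norm 2 (frac_laplacian (\<sigma> / 2) (u t)) \<le>
          C * (1 + t) powr (- (?n / (2 * (\<sigma> - \<delta>))) * (1 / m - 1 / 2) - \<sigma> / (2 * (\<sigma> - \<delta>))) * (Lp_norm m u0 + sobolev_norm \<sigma> u0)
          + C * (1 + t) powr (- (?n / (2 * (\<sigma> - \<delta>))) * (1 / m - 1 / 2) - \<sigma> / (2 * (\<sigma> - \<delta>))) * (weighted_Lp_norm (2 * \<delta>) m u1 + Lp_norm 2 u1)"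
        by (rule up1) (use E1 a in auto)
    next
      assume a: "u0 \<in> Lp_space m \<inter> sobolev_space \<sigma> \<and> u1 \<in> weighted_Lp_space (2 * \<delta>) m \<inter> Lp_space 2"
      show "\<exists>w. has_time_deriv u w t" using E1 a by blast
      show "Lp_norm 2 (time_deriv u t) \<le>
          C * (1 + t) powr (- (?n / (2 * (\<sigma> - \<delta>))) * (1 / m - 1 / 2) - 1) * (Lp_norm m u0 + sobolev_norm \<sigma> u0)
          + C * (1 + t) powr (- (?n / (2 * (\<sigma> - \<delta>))) * (1 / m - 1 / 2) - 1) * (weighted_Lp_norm (2 * \<delta>) m u1 + Lp_norm 2 u1)"
        by (rule up1) (use E1 a in auto)
    next
      assume a: "u0 \<in> Lp_space 2 \<and> u1 \<in> weighted_Lp_space (2 * \<delta>) 2 \<inter> Lp_space 2"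
      have "Lp_norm 2 (u t) \<le> C * (1 + t) powr 0 * (Lp_norm 2 u0 + (weighted_Lp_norm (2 * \<delta>) 2 u1 + Lp_norm 2 u1))"
        by (rule up2[OF _ order_refl]) (use E2 a in auto)
      then show "Lp_norm 2 (u t) \<le> C * (Lp_norm 2 u0 + (weighted_Lp_norm (2 * \<delta>) 2 u1 + Lp_norm 2 u1))"
        using t by simp
    next
      assume a: "u0 \<in> sobolev_space \<sigma> \<and> u1 \<in> weighted_Lp_space (2 * \<delta>) 2 \<inter> Lp_space 2"
      then have le: "Lp_norm 2 u0 \<le> sobolev_norm \<sigma> u0" using assms by (intro sobolev_weight(2)) auto
      show "u t \<in> frac_laplacian_domain (\<sigma> / 2)" using E2 a by blast
      show "Lp_norm 2 (frac_laplacian (\<sigma> / 2) (u t)) \<le> C * (1 + t) powr (- (\<sigma> / (2 * (\<sigma> - \<delta>)))) *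
          (sobolev_norm \<sigma> u0 + (weighted_Lp_norm (2 * \<delta>) 2 u1 + Lp_norm 2 u1))"
        by (rule up2[OF _ le]) (use E2 a in auto)
    next
      assume a: "u0 \<in> sobolev_space \<sigma> \<and> u1 \<in> weighted_Lp_space (2 * \<delta>) 2 \<inter> Lp_space 2"
      then have le: "Lp_norm 2 u0 \<le> sobolev_norm \<sigma> u0" using assms by (intro sobolev_weight(2)) auto
      show "\<exists>w. has_time_deriv u w t" using E2 a by blast
      show "Lp_norm 2 (time_deriv u t) \<le> C * (1 + t) powr (- 1) *
          (sobolev_norm \<sigma> u0 + (weighted_Lp_norm (2 * \<delta>) 2 u1 + Lp_norm 2 u1))"
        by (rule up2[OF _ le]) (use E2 a in auto)
    }
  qed
qed

end
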